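(* Let $M\in\mathbb N$ and let $\varepsilon_M>0$ be such that $P^\varepsilon_N(\eta)\ge\frac\lambda2|\eta|^2$ for all $\eta\in K$, all $0<\varepsilon<\varepsilon_M$ and all $N\in\mathbb N$ with $N\le M$. Then there exists a constant $C>0$, independent of $\varepsilon$, such that for every $0<\varepsilon<\varepsilon_M$ with $K\subset Z/\varepsilon$ the unique minimizer $\hat u^*_{\varepsilon,0}\in\hat U_{ad}$ of $\hat J^\varepsilon$ over $\hat U_{ad}$ and the unique minimizer $\hat u^*_M\in\hat U_{ad}$ of $\hat J^*_M$ over $\hat U_{ad}$ satisfy $$\|\hat u^*_{\varepsilon,0}-\hat u^*_M\|_{L^2(K;\mathbb C)}\le C\varepsilon^{2M}.$$
   Context: **Bloch waves.** Let $n\in\mathbb N$, $Y=[0,1]^n$, $Z=[-\tfrac12,\tfrac12)^n$. $A\in L^\infty(\mathbb R^n;\mathbb R^{n\times n})$ is symmetric, uniformly elliptic and $Y$-periodic. For $\eta\in Z$ let $0\le\lambda_0(\eta)\le\lambda_1(\eta)\le\dots$ be the eigenvalues of $-(\nabla+2\pi i\eta)\cdot(A(\nabla+2\pi i\eta))$ on $Y$-periodic functions, with eigenfunctions $\Phi_m(\cdot;\eta)\in H^1_\sharp(Y;\mathbb C)$, $m\in\mathbb N_0$, forming an orthonormal basis of $L^2_\sharp(Y;\mathbb C)$ ($\sharp$: periodic functions), chosen measurable in $\eta$ and with $\Phi_m(\cdot;-\eta)=\overline{\Phi_m(\cdot;\eta)}$ for a.e. $\eta$. For $\eta\in Z/\varepsilon$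 put $\lambda^\varepsilon_m(\eta)=\varepsilon^{-2}\lambda_m(\varepsilon\eta)$ and $\omega^\varepsilon_m(x;\eta)=\Phi_m(x/\varepsilon;\varepsilon\eta)e^{2\pi i\eta\cdot x}$. The Bloch coefficients of $u\in L^2(\mathbb R^n;\mathbb C)$ are $\hat u^\varepsilon_m(\eta)=\int_{\mathbb R^n}u\,\overline{\omega^\varepsilon_m(\cdot;\eta)}\,dx$ ($L^2$ sense), so $u=\int_{Z/\varepsilon}\sum_m\hat u^\varepsilon_m(\eta)\omega^\varepsilon_m(\cdot;\eta)\,d\eta$. The Fourier transform is $\hat u(\eta)=\int u(x)e^{-2\pi ix\cdot\eta}dx$. $L^2(\mathbb R^n)$ denotes real-valued functions. The adaption of $f\in L^2(\mathbb R^n;\mathbb C)$ is $\mathcal A^\varepsilon(f)=\int_{Z/\varepsilon}\hat f(\eta)\omega^\varepsilon_0(\cdot;\eta)\,d\eta$. **Data.** $\mu_1,\mu_2\ge0$, $\kappa>0$; $f,y_{d,1},y_{d,2}\in L^2(\mathbb R^n)$ have Fourier transforms supported in a compact set $K\subset\mathbb R^n$ with $-K=K$. **Admissible sets.** For each $\varepsilon>0$, $\emptyset\ne U^\varepsilon_{ad}\subset L^2(\mathbb R^n)$ satisfies: (i) $U^\varepsilon_{ad}$ is convex and closed. (ii) There is $u_0\in L^2(\mathbb R^n)$ (independent of $\varepsilon$) with $\mathcal A^\varepsilon(u_0)\in U^\varepsilon_{ad}$ for every $\varepsilon>0$. (iii) For $u\in U^\varepsilon_{ad}$ the projection $u_K=\int_K\hat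 u^\varepsilon_0(\eta)\omega^\varepsilon_0(\cdot;\eta)\,d\eta$ lies in $U^\varepsilon_{ad}$. For $K\subset Z/\varepsilon$ define $U^*_{ad}=\{u=\int_K\hat u(\eta)e^{2\pi i\eta\cdot x}d\eta:\mathcal A^\varepsilon(u)\in U^\varepsilon_{ad}\}$ and $\hat U_{ad}=\{\hat u\in L^2(K;\mathbb C): u_F\in U^*_{ad}\text{ with }u_F(x)=\int_K\hat u(\eta)e^{2\pi i\eta\cdot x}d\eta\}$. **Taylor polynomial.** $\mathbb A^*_{2k}$ ($k\ge1$) are real tensors of order $2k$ with $\lambda_0(\eta)=\sum_{k=1}^M(2\pi)^{2k}\mathbb A^*_{2k}\cdot\eta^{\otimes2k}+O(|\eta|^{2M+2})$ as $\eta\to0$ for each $M$ ($\lambda_0$ is even and analytic near $0$, $\lambda_0(0)=0$), where $\mathbb A^*_{2k}\cdot\eta^{\otimes2k}=\sum_{i_1,\dots,i_{2k}}(\mathbb A^*_{2k})_{i_1\dots i_{2k}}\eta_{i_1}\cdots\eta_{i_{2k}}$; $\mathbb A^*_2$ is positive definite and $\lambda>0$ satisfies $\mathbb A^*_2\cdot\eta^{\otimes2}\ge\lambda|\eta|^2$ for all $\eta$. $P^\varepsilon_N(\eta)=\sum_{k=1}^N\varepsilon^{2k-2}(2\pi)^{2k}\mathbb A^*_{2k}\cdot\eta^{\otimes2k}$. **Functionals on $L^2(K;\mathbb C)$.** $$\hat J^\varepsilon(\hat u)=\frac{\mu_1}2\int_K\Big|\frac{\hat f+\hat u}{1+\lambda^\varepsilon_0}-\hat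 y_{d,1}\Big|^2(1+\lambda^\varepsilon_0)\,d\eta+\frac{\mu_2}2\int_K\Big|\frac{\hat f+\hat u}{1+\lambda^\varepsilon_0}-\hat y_{d,2}\Big|^2d\eta+\frac\kappa2\int_K|\hat u|^2d\eta,$$ and $\hat J^*_M$ is the same expression with $\lambda^\varepsilon_0$ replaced by $P^\varepsilon_M$ everywhere. *)

theory Defs
  imports "HOL-Analysis.Analysis" "HOL-Library.Landau_Symbols"
begin

section \<open>Square-integrable functions\<close>

text \<open>
  Elements of \<open>L\<^sup>2(S)\<close> are represented by functions; two functions represent the same element
  iff they agree almost everywhere on \<open>S\<close>.
\<close>

definition L2 :: "'a::euclidean_space set \<Rightarrow> ('a \<Rightarrow> 'b::real_normed_vector) set" where
  "L2 S = {u. set_borel_measurable lebesgue S u \<and>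
              set_integrable lebesgue S (\<lambda>x. (norm (u x))\<^sup>2)}"

definition L2norm :: "'a::euclidean_space set \<Rightarrow> ('a \<Rightarrow> 'b::real_normed_vector) \<Rightarrow> real" where
  "L2norm S u = sqrt (LINT x:S|lebesgue. (norm (u x))\<^sup>2)"

text \<open>
  Membership in \<open>L2 S\<close> is demanded explicitly, since \<open>L2norm\<close> returns a meaningless value
  on functions that are not square-integrable.
\<close>

definition L2_tendsto ::
  "'a::euclidean_space set \<Rightarrow> ('i \<Rightarrow> 'a \<Rightarrow> 'b::real_normed_vector) \<Rightarrow> ('a \<Rightarrow> 'b) \<Rightarrow> 'i filter \<Rightarrow> bool"
where
  "L2_tendsto S u v F \<longleftrightarrow> v \<in> L2 S \<and> (\<forall>\<^sub>F k in F. u k \<in> L2 S) \<and>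
     ((\<lambda>k. L2norm S (\<lambda>x. u k x - v x)) \<longlongrightarrow> 0) F"

text \<open>
  By taking constant sequences, an \<open>L2\<close>-closed set contains with a function all functions
  representing the same element of \<open>L\<^sup>2\<close>.
\<close>

definition L2_closed :: "('a::euclidean_space \<Rightarrow> real) set \<Rightarrow> bool" where
  "L2_closed U \<longleftrightarrow>
     (\<forall>u v. (\<forall>k::nat. u k \<in> U) \<longrightarrow> L2_tendsto UNIV u v sequentially \<longrightarrow> v \<in> U)"

definition fun_convex :: "('a \<Rightarrow> real) set \<Rightarrow> bool" where
  "fun_convex U \<longleftrightarrow>
     (\<forall>u\<in>U. \<forall>v\<in>U. \<forall>t\<in>{0..1}. (\<lambda>x. (1 - t) * u x + t * v x) \<in> U)"

text \<open>A complex-valued function belongs, as an element of \<open>L\<^sup>2\<close>, to a set of real-valued ones.\<close>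

definition real_member :: "('a::euclidean_space \<Rightarrow> complex) \<Rightarrow> ('a \<Rightarrow> real) set \<Rightarrow> bool" where
  "real_member F U \<longleftrightarrow> (\<exists>g\<in>U. AE x in lebesgue. F x = complex_of_real (g x))"


section \<open>Fourier transform\<close>

text \<open>The \<open>L\<^sup>2\<close> (Plancherel) extension of \<open>\<integral> u(x) e\<^sup>-\<^sup>2\<^sup>\<pi>\<^sup>i\<^sup>x\<^sup>\<cdot>\<^sup>\<eta> dx\<close>; determined up to a null set.\<close>

definition fourier_L2 :: "(real^'n \<Rightarrow> complex) \<Rightarrow> real^'n \<Rightarrow> complex" where
  "fourier_L2 u = (SOME v. L2_tendsto UNIV
     (\<lambda>R \<eta>. LINT x:cball 0 R|lebesgue. u x * cis (- (2 * pi * (x \<bullet> \<eta>)))) v at_top)"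

definition fourier_real :: "(real^'n \<Rightarrow> real) \<Rightarrow> real^'n \<Rightarrow> complex" where
  "fourier_real f = fourier_L2 (\<lambda>x. complex_of_real (f x))"

definition fourier_synth :: "(real^'n) set \<Rightarrow> (real^'n \<Rightarrow> complex) \<Rightarrow> real^'n \<Rightarrow> complex" where
  "fourier_synth K v x = (LINT \<eta>:K|lebesgue. v \<eta> * cis (2 * pi * (\<eta> \<bullet> x)))"


section \<open>Periodic Sobolev functions\<close>

definition Ycell :: "(real^'n) set" where
  "Ycell = {y. \<forall>i. 0 \<le> y $ i \<and> y $ i \<le> 1}"

definition Zcell :: "(real^'n) set" where
  "Zcell = {\<eta>. \<forall>i. - 1/2 \<le> \<eta> $ i \<and> \<eta> $ i < 1/2}"

text \<open>\<open>Z/\<epsilon>\<close>, for \<open>\<epsilon> > 0\<close>.\<close>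

definition Zscaled :: "real \<Rightarrow> (real^'n) set" where
  "Zscaled \<epsilon> = {\<eta>. \<epsilon> *\<^sub>R \<eta> \<in> Zcell}"

definition Y_periodic :: "(real^'n \<Rightarrow> 'b) \<Rightarrow> bool" where
  "Y_periodic u \<longleftrightarrow>
     (\<forall>k. (\<forall>i. k $ i \<in> \<int>) \<longrightarrow> (AE x in lebesgue. u (x + k) = u x))"

definition L2_per :: "(real^'n \<Rightarrow> 'b::real_normed_vector) set" where
  "L2_per = {u \<in> borel_measurable lebesgue. Y_periodic u \<and> u \<in> L2 Ycell}"

primrec Ck_fun :: "nat \<Rightarrow> (real^'n \<Rightarrow> real) \<Rightarrow> bool" where
  "Ck_fun 0 \<psi> \<longleftrightarrow> continuous_on UNIV \<psi>"
| "Ck_fun (Suc k) \<psi> \<longleftrightarrow> (\<forall>x. \<psi> differentiable (at x)) \<and>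
     (\<forall>i. Ck_fun k (\<lambda>x. frechet_derivative \<psi> (at x) (axis i 1)))"

definition test_function :: "(real^'n \<Rightarrow> real) \<Rightarrow> bool" where
  "test_function \<psi> \<longleftrightarrow> (\<forall>k. Ck_fun k \<psi>) \<and> compact (closure {x. \<psi> x \<noteq> 0})"

definition has_weak_gradient :: "(real^'n \<Rightarrow> complex) \<Rightarrow> (real^'n \<Rightarrow> complex^'n) \<Rightarrow> bool" where
  "has_weak_gradient \<phi> g \<longleftrightarrow> (\<forall>\<psi> i. test_function \<psi> \<longrightarrow>
     (LINT x|lebesgue. \<phi> x * complex_of_real (frechet_derivative \<psi> (at x) (axis i 1))) =
     - (LINT x|lebesgue. g x $ i * complex_of_real (\<psi> x)))"

text \<open>\<open>\<phi> \<in> H\<^sup>1\<^sub>\<sharp>(Y;\<complex>)\<close> with weak gradient \<open>g\<close>.\<close>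

definition H1_per :: "(real^'n \<Rightarrow> complex) \<Rightarrow> (real^'n \<Rightarrow> complex^'n) \<Rightarrow> bool" where
  "H1_per \<phi> g \<longleftrightarrow> \<phi> \<in> L2_per \<and> g \<in> L2_per \<and> has_weak_gradient \<phi> g"


section \<open>Bloch waves\<close>

definition admissible_coefficient :: "(real^'n \<Rightarrow> real^'n^'n) \<Rightarrow> bool" where
  "admissible_coefficient A \<longleftrightarrow>
     A \<in> borel_measurable lebesgue \<and>
     (\<exists>\<beta>. AE x in lebesgue. norm (A x) \<le> \<beta>) \<and>
     (AE x in lebesgue. transpose (A x) = A x) \<and>
     (\<exists>\<alpha>>0. AE x in lebesgue. \<forall>\<xi>. \<xi> \<bullet> (A x *v \<xi>) \<ge> \<alpha> * (norm \<xi>)\<^sup>2) \<and>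
     Y_periodic A"

definition inner_Y :: "(real^'n \<Rightarrow> complex) \<Rightarrow> (real^'n \<Rightarrow> complex) \<Rightarrow> complex" where
  "inner_Y u v = (LINT x:Ycell|lebesgue. u x * cnj (v x))"

text \<open>\<open>(\<nabla> + 2\<pi>i\<eta>)\<phi>\<close>, where \<open>g\<close> is the weak gradient of \<open>\<phi>\<close>.\<close>

definition shifted_grad ::
  "real^'n \<Rightarrow> (real^'n \<Rightarrow> complex) \<Rightarrow> (real^'n \<Rightarrow> complex^'n) \<Rightarrow> real^'n \<Rightarrow> complex^'n" where
  "shifted_grad \<eta> \<phi> g x = (\<chi> i. g x $ i + 2 * pi * \<i> * complex_of_real (\<eta> $ i) * \<phi> x)"

definition bloch_form ::
  "(real^'n \<Rightarrow> real^'n^'n) \<Rightarrow> real^'n \<Rightarrow> (real^'n \<Rightarrow> complex) \<Rightarrow> (real^'n \<Rightarrow> complex^'n) \<Rightarrow>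
   (real^'n \<Rightarrow> complex) \<Rightarrow> (real^'n \<Rightarrow> complex^'n) \<Rightarrow> complex" where
  "bloch_form A \<eta> \<phi> g \<psi> h = (LINT x:Ycell|lebesgue. \<Sum>i\<in>UNIV. \<Sum>j\<in>UNIV.
     complex_of_real (A x $ i $ j) * shifted_grad \<eta> \<phi> g x $ j * cnj (shifted_grad \<eta> \<psi> h x $ i))"

text \<open>Weak form of \<open>-(\<nabla> + 2\<pi>i\<eta>)\<cdot>(A(\<nabla> + 2\<pi>i\<eta>)\<phi>) = l \<phi>\<close> on \<open>Y\<close>-periodic functions.\<close>

definition bloch_eigen ::
  "(real^'n \<Rightarrow> real^'n^'n) \<Rightarrow> real^'n \<Rightarrow> real \<Rightarrow> (real^'n \<Rightarrow> complex) \<Rightarrow> bool" where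
  "bloch_eigen A \<eta> l \<phi> \<longleftrightarrow> (\<exists>g. H1_per \<phi> g \<and>
     (\<forall>\<psi> h. H1_per \<psi> h \<longrightarrow> bloch_form A \<eta> \<phi> g \<psi> h = complex_of_real l * inner_Y \<phi> \<psi>))"

definition orthonormal_basis_per :: "(nat \<Rightarrow> real^'n \<Rightarrow> complex) \<Rightarrow> bool" where
  "orthonormal_basis_per \<phi> \<longleftrightarrow>
     (\<forall>m. \<phi> m \<in> L2_per) \<and>
     (\<forall>m l. inner_Y (\<phi> m) (\<phi> l) = (if m = l then 1 else 0)) \<and>
     (\<forall>u\<in>L2_per. L2_tendsto Ycell (\<lambda>N x. \<Sum>m<N. inner_Y u (\<phi> m) * \<phi> m x) u sequentially)"

text \<open>
  \<open>lam m \<eta>\<close> is \<open>\<lambda>\<^sub>m(\<eta>)\<close> and \<open>Phi m \<eta> x\<close> is \<open>\<Phi>\<^sub>m(x;\<eta>)\<close>. Since the \<open>Phi m \<eta>\<close> form an orthonormal basis,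
  \<open>lam 0 \<eta>, lam 1 \<eta>, \<dots>\<close> exhausts the spectrum, counted with multiplicity.
  Measurability in \<open>\<eta>\<close> is joint Lebesgue measurability in \<open>(\<eta>, x)\<close>.
\<close>

definition bloch_system ::
  "(real^'n \<Rightarrow> real^'n^'n) \<Rightarrow> (nat \<Rightarrow> real^'n \<Rightarrow> real) \<Rightarrow> (nat \<Rightarrow> real^'n \<Rightarrow> real^'n \<Rightarrow> complex) \<Rightarrow> bool"
where
  "bloch_system A lam Phi \<longleftrightarrow>
     (\<forall>\<eta>\<in>Zcell. 0 \<le> lam 0 \<eta> \<and> (\<forall>m. lam m \<eta> \<le> lam (Suc m) \<eta>) \<and>
        (\<forall>m. bloch_eigen A \<eta> (lam m \<eta>) (Phi m \<eta>)) \<and>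
        orthonormal_basis_per (\<lambda>m. Phi m \<eta>)) \<and>
     (\<forall>m. set_borel_measurable lebesgue (Zcell \<times> UNIV) (\<lambda>(\<eta>, x). Phi m \<eta> x)) \<and>
     (\<forall>m. AE \<eta> in lebesgue. \<eta> \<in> Zcell \<longrightarrow>
        (AE x in lebesgue. Phi m (- \<eta>) x = cnj (Phi m \<eta> x)))"

definition bloch_value :: "(nat \<Rightarrow> real^'n \<Rightarrow> real) \<Rightarrow> real \<Rightarrow> nat \<Rightarrow> real^'n \<Rightarrow> real" where
  "bloch_value lam \<epsilon> m \<eta> = lam m (\<epsilon> *\<^sub>R \<eta>) / \<epsilon>\<^sup>2"

definition bloch_wave ::
  "(nat \<Rightarrow> real^'n \<Rightarrow> real^'n \<Rightarrow> complex) \<Rightarrow> real \<Rightarrow> nat \<Rightarrow> real^'n \<Rightarrow> real^'n \<Rightarrow> complex" where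
  "bloch_wave Phi \<epsilon> m \<eta> x = Phi m (\<epsilon> *\<^sub>R \<eta>) (x /\<^sub>R \<epsilon>) * cis (2 * pi * (\<eta> \<bullet> x))"

text \<open>The defining integral over \<open>\<real>\<^sup>n\<close> is the limit in \<open>L\<^sup>2(Z/\<epsilon>)\<close> of the integrals over balls.\<close>

definition bloch_coeff ::
  "(nat \<Rightarrow> real^'n \<Rightarrow> real^'n \<Rightarrow> complex) \<Rightarrow> real \<Rightarrow> nat \<Rightarrow> (real^'n \<Rightarrow> complex) \<Rightarrow> real^'n \<Rightarrow> complex"
where
  "bloch_coeff Phi \<epsilon> m u = (SOME c. L2_tendsto (Zscaled \<epsilon>)
     (\<lambda>R \<eta>. LINT x:cball 0 R|lebesgue. u x * cnj (bloch_wave Phi \<epsilon> m \<eta> x)) c at_top)"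

text \<open>
  The integral over \<open>\<eta>\<close> converges absolutely for almost every \<open>x\<close>, because \<open>S\<close> will be a bounded
  subset of \<open>Z/\<epsilon>\<close>.
\<close>

definition bloch_synth ::
  "(nat \<Rightarrow> real^'n \<Rightarrow> real^'n \<Rightarrow> complex) \<Rightarrow> real \<Rightarrow> (real^'n) set \<Rightarrow> (real^'n \<Rightarrow> complex) \<Rightarrow>
   real^'n \<Rightarrow> complex" where
  "bloch_synth Phi \<epsilon> S c x = (LINT \<eta>:S|lebesgue. c \<eta> * bloch_wave Phi \<epsilon> 0 \<eta> x)"

definition adaption ::
  "(nat \<Rightarrow> real^'n \<Rightarrow> real^'n \<Rightarrow> complex) \<Rightarrow> real \<Rightarrow> (real^'n \<Rightarrow> complex) \<Rightarrow> real^'n \<Rightarrow> complex" where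
  "adaption Phi \<epsilon> f = bloch_synth Phi \<epsilon> (Zscaled \<epsilon>) (fourier_L2 f)"


section \<open>Admissible sets\<close>

text \<open>
  The projection property refers to \<open>\<omega>\<^sup>\<epsilon>\<^sub>0(\<cdot>;\<eta>)\<close> for \<open>\<eta> \<in> K\<close>, which is only defined if \<open>K \<subseteq> Z/\<epsilon>\<close>.
\<close>

definition admissible_sets ::
  "(nat \<Rightarrow> real^'n \<Rightarrow> real^'n \<Rightarrow> complex) \<Rightarrow> (real^'n) set \<Rightarrow> (real \<Rightarrow> (real^'n \<Rightarrow> real) set) \<Rightarrow> bool"
where
  "admissible_sets Phi K Uad \<longleftrightarrow>
     (\<forall>\<epsilon>>0. Uad \<epsilon> \<noteq> {} \<and> Uad \<epsilon> \<subseteq> L2 UNIV \<and> fun_convex (Uad \<epsilon>) \<and> L2_closed (Uad \<epsilon>)) \<and>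
     (\<exists>u0\<in>L2 UNIV. \<forall>\<epsilon>>0.
        real_member (adaption Phi \<epsilon> (\<lambda>x. complex_of_real (u0 x))) (Uad \<epsilon>)) \<and>
     (\<forall>\<epsilon>>0. K \<subseteq> Zscaled \<epsilon> \<longrightarrow> (\<forall>u\<in>Uad \<epsilon>.
        real_member
          (bloch_synth Phi \<epsilon> K (bloch_coeff Phi \<epsilon> 0 (\<lambda>x. complex_of_real (u x)))) (Uad \<epsilon>)))"

definition Ustar ::
  "(nat \<Rightarrow> real^'n \<Rightarrow> real^'n \<Rightarrow> complex) \<Rightarrow> (real^'n) set \<Rightarrow> (real \<Rightarrow> (real^'n \<Rightarrow> real) set) \<Rightarrow> real \<Rightarrow>
   (real^'n \<Rightarrow> complex) set" where
  "Ustar Phi K Uad \<epsilon> =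
     {u. (\<exists>v\<in>L2 K. u = fourier_synth K v) \<and> real_member (adaption Phi \<epsilon> u) (Uad \<epsilon>)}"

definition Uhat ::
  "(nat \<Rightarrow> real^'n \<Rightarrow> real^'n \<Rightarrow> complex) \<Rightarrow> (real^'n) set \<Rightarrow> (real \<Rightarrow> (real^'n \<Rightarrow> real) set) \<Rightarrow> real \<Rightarrow>
   (real^'n \<Rightarrow> complex) set" where
  "Uhat Phi K Uad \<epsilon> = {v \<in> L2 K. fourier_synth K v \<in> Ustar Phi K Uad \<epsilon>}"


section \<open>Taylor polynomial of the lowest Bloch eigenvalue\<close>

text \<open>
  A tensor of order \<open>p\<close> is given by its entries, indexed by lists of length \<open>p\<close>;
  this is \<open>T \<cdot> \<eta>\<^sup>\<otimes>\<^sup>p\<close>.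
\<close>

definition tensor_contract :: "nat \<Rightarrow> ('n::finite list \<Rightarrow> real) \<Rightarrow> real^'n \<Rightarrow> real" where
  "tensor_contract p T \<eta> = (\<Sum>is | length is = p. T is * (\<Prod>i\<leftarrow>is. \<eta> $ i))"

text \<open>\<open>Ast k\<close> is the tensor \<open>\<bbbA>\<^sup>*\<^sub>2\<^sub>k\<close> of order \<open>2k\<close>.\<close>

definition taylor_poly :: "(nat \<Rightarrow> 'n::finite list \<Rightarrow> real) \<Rightarrow> real \<Rightarrow> nat \<Rightarrow> real^'n \<Rightarrow> real" where
  "taylor_poly Ast \<epsilon> N \<eta> =
     (\<Sum>k=1..N. \<epsilon> ^ (2 * k - 2) * (2 * pi) ^ (2 * k) * tensor_contract (2 * k) (Ast k) \<eta>)"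

definition taylor_tensors ::
  "(real^'n \<Rightarrow> real) \<Rightarrow> (nat \<Rightarrow> 'n::finite list \<Rightarrow> real) \<Rightarrow> bool" where
  "taylor_tensors lam0 Ast \<longleftrightarrow> (\<forall>N\<ge>1.
     (\<lambda>\<eta>. lam0 \<eta> - (\<Sum>k=1..N. (2 * pi) ^ (2 * k) * tensor_contract (2 * k) (Ast k) \<eta>))
       \<in> O[at 0](\<lambda>\<eta>. norm \<eta> ^ (2 * N + 2)))"


section \<open>Functionals and minimizers\<close>

text \<open>
  The functional with weight \<open>L\<close>: taking \<open>\<lambda>\<^sup>\<epsilon>\<^sub>0\<close> for \<open>L\<close> gives the exact functional, taking \<open>P\<^sup>\<epsilon>\<^sub>M\<close> the
  approximate one. The arguments \<open>fh\<close>, \<open>y1h\<close>, \<open>y2h\<close> are the Fourier transforms of the data.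
\<close>

definition cost ::
  "real \<Rightarrow> real \<Rightarrow> real \<Rightarrow> (real^'n) set \<Rightarrow> (real^'n \<Rightarrow> complex) \<Rightarrow> (real^'n \<Rightarrow> complex) \<Rightarrow>
   (real^'n \<Rightarrow> complex) \<Rightarrow> (real^'n \<Rightarrow> real) \<Rightarrow> (real^'n \<Rightarrow> complex) \<Rightarrow> real" where
  "cost \<mu>1 \<mu>2 \<kappa> K fh y1h y2h L v =
     \<mu>1 / 2 * (LINT \<eta>:K|lebesgue.
        (cmod ((fh \<eta> + v \<eta>) / complex_of_real (1 + L \<eta>) - y1h \<eta>))\<^sup>2 * (1 + L \<eta>)) +
     \<mu>2 / 2 * (LINT \<eta>:K|lebesgue.
        (cmod ((fh \<eta> + v \<eta>) / complex_of_real (1 + L \<eta>) - y2h \<eta>))\<^sup>2) +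
     \<kappa> / 2 * (LINT \<eta>:K|lebesgue. (cmod (v \<eta>))\<^sup>2)"

definition is_minimizer :: "('c \<Rightarrow> real) \<Rightarrow> 'c set \<Rightarrow> 'c \<Rightarrow> bool" where
  "is_minimizer J U v \<longleftrightarrow> v \<in> U \<and> (\<forall>w\<in>U. J v \<le> J w)"

text \<open>Uniqueness is uniqueness as an element of \<open>L\<^sup>2(K;\<complex>)\<close>.\<close>

definition is_unique_minimizer ::
  "'a::euclidean_space set \<Rightarrow> (('a \<Rightarrow> complex) \<Rightarrow> real) \<Rightarrow> ('a \<Rightarrow> complex) set \<Rightarrow> ('a \<Rightarrow> complex) \<Rightarrow> bool"
where
  "is_unique_minimizer K J U v \<longleftrightarrow> is_minimizer J U v \<and>
     (\<forall>w. is_minimizer J U w \<longrightarrow> (AE \<eta> in lebesgue. \<eta> \<in> K \<longrightarrow> w \<eta> = v \<eta>))"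

end

theory Submission
  imports Defs
begin

text \<open>
  Completing the square turns both functionals into weighted quadratic ones,
  \<open>\<integral>\<^sub>K q|v|\<^sup>2 - 2 b\<cdot>v\<close> up to a constant, whose weight \<open>q\<close> and load \<open>b\<close> depend on the symbol \<open>L\<close>
  (the exact eigenvalue or its Taylor polynomial) only through \<open>1/(1+L)\<close>. Since \<open>q \<ge> \<kappa>/2\<close>, such a
  functional has exactly one minimiser over a nonempty closed convex set (\<open>minimizer_exists\<close>,
  \<open>minimizer_unique\<close>), characterised by a variational inequality. Testing the inequality of each
  minimiser with the other one and adding (\<open>minimizer_stability\<close>) bounds the distance of the two
  minimisers by the differences of the weights and of the loads. Both are controlled by
  \<open>sup\<^sub>K |\<lambda>\<^sup>\<epsilon>\<^sub>0 - P\<^sup>\<epsilon>\<^sub>M|\<close>, because \<open>t \<mapsto> 1/(1+t)\<close> is Lipschitz on \<open>[0,\<infinity>)\<close>, and that supremum is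
  \<open>O(\<epsilon>\<^sup>2\<^sup>M)\<close> by Taylor's formula (\<open>taylor_error\<close>). For the \<open>\<epsilon>\<close> that are not small the formula says
  nothing, but then \<open>\<epsilon>\<close> is bounded below and boundedness of the symbols is enough.

  Three facts feed this argument. First, the set over which one minimises has to be nonempty,
  convex and closed, with an element whose norm does not depend on \<open>\<epsilon>\<close>. This rests on two
  identities of Plancherel type: the Fourier transform inverts \<open>fourier_synth\<close>
  (\<open>fourier_inversion\<close>), and the lowest Bloch coefficient inverts the synthesis with lowest Bloch
  waves (\<open>bloch_coeff_syn\<close>). Both are instances of one statement: for any periodic profile,
  normalised on the unit cell for each quasi-momentum, superposing the modulated profiles is an
  isometry from \<open>L\<^sup>2(Z/\<epsilon>)\<close> into \<open>L\<^sup>2(\<real>\<^sup>n)\<close> (\<open>syn_isometry\<close>); the constant profile gives the Fourier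
  transform. On the lattice translates \<open>y - k\<close> of a point, the values of the superposition are the
  Fourier coefficients of a function on the cube, so the isometry is Parseval's identity on the cube
  integrated over \<open>y\<close>. As superposition \<open>S\<close> is an isometry with adjoint \<open>S\<^sup>*\<close>, truncating \<open>S g\<close> to a ball and
  applying \<open>S\<^sup>*\<close> recovers \<open>g\<close> in the limit (\<open>ana_close\<close>).

  Second, the cost only makes sense if \<open>\<lambda>\<^sub>0\<close> is measurable. The Rayleigh quotient of the
  operator at \<open>\<eta>'\<close> on the ground state at \<open>\<eta>\<close> bounds \<open>\<lambda>\<^sub>0(\<eta>')\<close> from above, which makes \<open>\<lambda>\<^sub>0\<close>
  continuous and bounded on \<open>Z\<close> (\<open>ground_state_regular\<close>).

  Third, the minimiser at the Taylor symbol is bounded independently of \<open>\<epsilon>\<close>, by comparison with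
  the common admissible element (\<open>minimizer_bound\<close>).
\<close>

section \<open>Square-integrable functions over a measure\<close>

text \<open>
  Square integrability over an arbitrary measure. The arguments below move between Lebesgue
  measure, its restriction to a set, and the Borel measure \<open>lborel\<close>, over which Tonelli's theorem is
  available.
\<close>

definition sqint :: "'a measure \<Rightarrow> ('a \<Rightarrow> 'b::euclidean_space) \<Rightarrow> bool" where
  "sqint M f \<longleftrightarrow> f \<in> borel_measurable M \<and> integrable M (\<lambda>x. (norm (f x))\<^sup>2)"

definition n2 :: "'a measure \<Rightarrow> ('a \<Rightarrow> 'b::euclidean_space) \<Rightarrow> real" where
  "n2 M f = sqrt (\<integral>x. (norm (f x))\<^sup>2 \<partial>M)"

text \<open>
  The real inner product. For complex-valued functions it is the real part of the Hermitian one,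
  which suffices for variational inequalities and for isometries.
\<close>

definition ip :: "'a measure \<Rightarrow> ('a \<Rightarrow> 'b::euclidean_space) \<Rightarrow> ('a \<Rightarrow> 'b) \<Rightarrow> real" where
  "ip M f g = (\<integral>x. f x \<bullet> g x \<partial>M)"

lemma sqintD: "sqint M f \<Longrightarrow> f \<in> borel_measurable M"
  "sqint M f \<Longrightarrow> integrable M (\<lambda>x. (norm (f x))\<^sup>2)"
  by (auto simp: sqint_def)

lemma n2_nonneg [simp]: "0 \<le> n2 M f"
  by (simp add: n2_def)

lemma n2_sq: "(n2 M f)\<^sup>2 = (\<integral>x. (norm (f x))\<^sup>2 \<partial>M)"
  by (simp add: n2_def)

lemma n2_sq_ip: "(n2 M f)\<^sup>2 = ip M f f"
  by (simp add: n2_sq ip_def power2_norm_eq_inner)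

lemma nn_n2:
  assumes "sqint M f"
  shows "(\<integral>\<^sup>+x. ennreal ((norm (f x))\<^sup>2) \<partial>M) = ennreal ((n2 M f)\<^sup>2)"
  unfolding n2_sq using sqintD(2)[OF assms] by (intro nn_integral_eq_integral) auto

text \<open>
  Bounds obtained from Tonelli's theorem arrive as bounds on nonnegative integrals.
\<close>

lemma sqintI_nn:
  assumes "f \<in> borel_measurable M" "(\<integral>\<^sup>+x. ennreal ((norm (f x))\<^sup>2) \<partial>M) \<le> ennreal (c\<^sup>2)" "0 \<le> c"
  shows "sqint M f" "n2 M f \<le> c"
proof -
  have fin: "(\<integral>\<^sup>+x. ennreal ((norm (f x))\<^sup>2) \<partial>M) < \<infinity>"
    using assms(2) by (metis ennreal_less_top infinity_ennreal_def order_le_less_trans)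
  show s: "sqint M f"
    unfolding sqint_def using assms(1) fin by (auto intro!: integrableI_bounded)
  have "ennreal ((n2 M f)\<^sup>2) \<le> ennreal (c\<^sup>2)"
    unfolding nn_n2[OF s, symmetric] by (rule assms(2))
  then have "(n2 M f)\<^sup>2 \<le> c\<^sup>2"
    by (subst (asm) ennreal_le_iff) auto
  then show "n2 M f \<le> c"
    using assms(3) by (rule power2_le_imp_le)
qed

lemma sqint_norm_mult:
  assumes "sqint M f" "sqint M g"
  shows "integrable M (\<lambda>x. norm (f x) * norm (g x))"
proof (rule Bochner_Integration.integrable_bound)
  show "integrable M (\<lambda>x. (norm (f x))\<^sup>2 + (norm (g x))\<^sup>2)"
    using assms by (auto simp: sqint_def)
  show "(\<lambda>x. norm (f x) * norm (g x)) \<in> borel_measurable M"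
    using assms by (auto simp: sqint_def)
  show "AE x in M. norm (norm (f x) * norm (g x)) \<le> norm ((norm (f x))\<^sup>2 + (norm (g x))\<^sup>2)"
  proof (intro AE_I2)
    fix x
    have "0 \<le> (norm (f x) - norm (g x))\<^sup>2" "0 \<le> norm (f x) * norm (g x)" by auto
    then have "norm (f x) * norm (g x) \<le> (norm (f x))\<^sup>2 + (norm (g x))\<^sup>2"
      unfolding power2_diff by linarith
    then show "norm (norm (f x) * norm (g x)) \<le> norm ((norm (f x))\<^sup>2 + (norm (g x))\<^sup>2)"
      by simp
  qed
qed

lemma sqint_inner:
  assumes "sqint M f" "sqint M g"
  shows "integrable M (\<lambda>x. f x \<bullet> g x)"
proof (rule Bochner_Integration.integrable_bound[OF sqint_norm_mult[OF assms]])
  show "(\<lambda>x. f x \<bullet> g x) \<in> borel_measurable M"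
    using assms by (auto simp: sqint_def)
qed (auto intro!: AE_I2 simp: Cauchy_Schwarz_ineq2 abs_mult)

lemma sqint_dominated:
  assumes "sqint M g" "f \<in> borel_measurable M" "AE x in M. norm (f x) \<le> norm (g x)"
  shows "sqint M f"
  unfolding sqint_def
proof (intro conjI assms(2))
  show "integrable M (\<lambda>x. (norm (f x))\<^sup>2)"
    by (rule Bochner_Integration.integrable_bound[OF sqintD(2)[OF assms(1)]])
      (use assms in \<open>auto intro: power_mono\<close>)
qed

lemma sqint_scale:
  assumes "sqint M f" "h \<in> borel_measurable M" "AE x in M. norm (h x) \<le> c * norm (f x)"
  shows "sqint M h"
proof -
  have "sqint M (\<lambda>x. c *\<^sub>R f x)"
    using assms(1) by (auto simp: sqint_def power_mult_distrib)
  then show ?thesis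
  proof (rule sqint_dominated[OF _ assms(2)])
    show "AE x in M. norm (h x) \<le> norm (c *\<^sub>R f x)"
    using assms(3)
  proof eventually_elim
    case (elim x)
    have "c * norm (f x) \<le> \<bar>c\<bar> * norm (f x)" by (intro mult_right_mono) auto
    with elim show ?case by simp
  qed
  qed
qed

lemma sqint_norm: "sqint M f \<Longrightarrow> sqint M (\<lambda>x. norm (f x))"
  by (auto simp: sqint_def)

lemma n2_norm: "n2 M (\<lambda>x. norm (f x)) = n2 M f"
  by (simp add: n2_def)

lemma sqint_zero [simp]: "sqint M (\<lambda>x. 0)"
  by (simp add: sqint_def)

lemma n2_zero [simp]: "n2 M (\<lambda>x. 0) = 0"
  by (simp add: n2_def)

lemma sqint_scaleR: "sqint M f \<Longrightarrow> sqint M (\<lambda>x. c *\<^sub>R f x)"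
  by (auto simp: sqint_def power_mult_distrib)

lemma sqint_cmult: "sqint M (f::_ \<Rightarrow> complex) \<Longrightarrow> sqint M (\<lambda>x. c * f x)"
  by (auto simp: sqint_def power_mult_distrib norm_mult)

lemma n2_scaleR: "n2 M (\<lambda>x. c *\<^sub>R f x) = \<bar>c\<bar> * n2 M f"
  by (simp add: n2_def power_mult_distrib real_sqrt_mult)

lemma sqint_add:
  assumes "sqint M f" "sqint M g"
  shows "sqint M (\<lambda>x. f x + g x)"
  unfolding sqint_def
proof
  show "(\<lambda>x. f x + g x) \<in> borel_measurable M"
    using assms by (auto simp: sqint_def)
  have "integrable M (\<lambda>x. (norm (f x))\<^sup>2 + 2 * (f x \<bullet> g x) + (norm (g x))\<^sup>2)"
    using assms sqint_inner[OF assms] by (auto simp: sqint_def)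
  then show "integrable M (\<lambda>x. (norm (f x + g x))\<^sup>2)"
    by (rule Bochner_Integration.integrable_cong[THEN iffD1, rotated 2])
      (auto simp: power2_norm_eq_inner inner_add_left inner_add_right inner_commute)
qed

lemma sqint_uminus: "sqint M f \<Longrightarrow> sqint M (\<lambda>x. - f x)"
  by (auto simp: sqint_def)

lemma sqint_diff: "sqint M f \<Longrightarrow> sqint M g \<Longrightarrow> sqint M (\<lambda>x. f x - g x)"
  using sqint_add[OF _ sqint_uminus, of M f g] by simp

lemma sqint_sum: "finite I \<Longrightarrow> (\<And>i. i \<in> I \<Longrightarrow> sqint M (f i)) \<Longrightarrow> sqint M (\<lambda>x. \<Sum>i\<in>I. f i x)"
  by (induction I rule: finite_induct) (auto intro: sqint_add)

lemma ip_commute: "ip M f g = ip M g f"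
  by (simp add: ip_def inner_commute)

lemma ip_add:
  assumes "sqint M f" "sqint M g" "sqint M h"
  shows "ip M f (\<lambda>x. g x + h x) = ip M f g + ip M f h" "ip M (\<lambda>x. g x + h x) f = ip M g f + ip M h f"
  using sqint_inner[OF assms(1,2)] sqint_inner[OF assms(1,3)]
        sqint_inner[OF assms(2,1)] sqint_inner[OF assms(3,1)]
  by (simp_all add: ip_def inner_add_right inner_add_left)

lemma ip_diff:
  assumes "sqint M f" "sqint M g" "sqint M h"
  shows "ip M f (\<lambda>x. g x - h x) = ip M f g - ip M f h" "ip M (\<lambda>x. g x - h x) f = ip M g f - ip M h f"
  using sqint_inner[OF assms(1,2)] sqint_inner[OF assms(1,3)]
        sqint_inner[OF assms(2,1)] sqint_inner[OF assms(3,1)]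
  by (simp_all add: ip_def inner_diff_right inner_diff_left)

lemma ip_scaleR:
  "ip M f (\<lambda>x. c *\<^sub>R g x) = c * ip M f g" "ip M (\<lambda>x. c *\<^sub>R g x) f = c * ip M g f"
  by (simp_all add: ip_def)

lemma n2_add_sq:
  assumes "sqint M f" "sqint M g"
  shows "(n2 M (\<lambda>x. f x + g x))\<^sup>2 = (n2 M f)\<^sup>2 + 2 * ip M f g + (n2 M g)\<^sup>2"
  using assms by (simp add: n2_sq_ip ip_add sqint_add ip_commute[of M g f])

lemma n2_diff_sq:
  assumes "sqint M f" "sqint M g"
  shows "(n2 M (\<lambda>x. f x - g x))\<^sup>2 = (n2 M f)\<^sup>2 - 2 * ip M f g + (n2 M g)\<^sup>2"
  using assms by (simp add: n2_sq_ip ip_diff sqint_diff ip_commute[of M g f])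

lemma n2_eq_0:
  assumes "sqint M f"
  shows "n2 M f = 0 \<longleftrightarrow> (AE x in M. f x = 0)"
  unfolding n2_def using integral_nonneg_eq_0_iff_AE[OF sqintD(2)[OF assms]] by simp

lemma n2_cong_AE:
  assumes "f \<in> borel_measurable M" "g \<in> borel_measurable M" "AE x in M. f x = g x"
  shows "n2 M f = n2 M g"
  unfolding n2_def using assms by (auto intro!: arg_cong[where f=sqrt] integral_cong_AE)

lemma CS_ip:
  assumes "sqint M f" "sqint M g"
  shows "\<bar>ip M f g\<bar> \<le> n2 M f * n2 M g"
proof -
  have *: "ip M f g \<le> n2 M f * n2 M g" if f: "sqint M f" and g: "sqint M g" for f g :: "_ \<Rightarrow> 'b"
  proof (cases "n2 M f = 0 \<or> n2 M g = 0")
    case True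
    then have "AE x in M. f x \<bullet> g x = 0"
      using f g by (auto simp: n2_eq_0 elim: eventually_mono)
    then have "ip M f g = 0"
      unfolding ip_def by (rule integral_eq_zero_AE)
    then show ?thesis by simp
  next
    case False
    define a b where "a = n2 M f" and "b = n2 M g"
    have ab: "a > 0" "b > 0" using False unfolding a_def b_def by (auto simp: less_le)
    have "0 \<le> (n2 M (\<lambda>x. b *\<^sub>R f x - a *\<^sub>R g x))\<^sup>2" by simp
    also have "\<dots> = (b * a)\<^sup>2 - 2 * (b * (a * ip M f g)) + (a * b)\<^sup>2"
      using ab by (subst n2_diff_sq[OF sqint_scaleR[OF f] sqint_scaleR[OF g]])
        (simp add: n2_scaleR ip_scaleR a_def[symmetric] b_def[symmetric])
    also have "\<dots> = 2 * a * b * (a * b - ip M f g)"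
      by (simp add: algebra_simps power2_eq_square)
    finally have "0 \<le> 2 * a * b * (a * b - ip M f g)" .
    then show ?thesis
      using ab mult_pos_pos[OF ab] by (auto simp: a_def[symmetric] b_def[symmetric] zero_le_mult_iff)
  qed
  from *[OF assms] *[OF assms(1) sqint_uminus[OF assms(2)]] show ?thesis
    by (simp add: n2_def ip_def)
qed

lemma n2_triangle:
  assumes "sqint M f" "sqint M g"
  shows "n2 M (\<lambda>x. f x + g x) \<le> n2 M f + n2 M g"
proof (rule power2_le_imp_le)
  show "(n2 M (\<lambda>x. f x + g x))\<^sup>2 \<le> (n2 M f + n2 M g)\<^sup>2"
    using CS_ip[OF assms] by (simp add: n2_add_sq[OF assms] power2_sum)
qed simp

lemma n2_uminus [simp]: "n2 M (\<lambda>x. - f x) = n2 M f"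
  by (simp add: n2_def)

lemma n2_minus_commute: "n2 M (\<lambda>x. f x - g x) = n2 M (\<lambda>x. g x - f x)"
  by (simp add: n2_def norm_minus_commute)

lemma n2_triangle_diff:
  assumes "sqint M f" "sqint M g"
  shows "n2 M (\<lambda>x. f x - g x) \<le> n2 M f + n2 M g"
  using n2_triangle[OF assms(1) sqint_uminus[OF assms(2)]] by simp

lemma n2_triangle3:
  assumes "sqint M f" "sqint M g" "sqint M h"
  shows "n2 M (\<lambda>x. f x - h x) \<le> n2 M (\<lambda>x. f x - g x) + n2 M (\<lambda>x. g x - h x)"
  using n2_triangle[OF sqint_diff[OF assms(1,2)] sqint_diff[OF assms(2,3)]] by simp

lemma n2_mono:
  assumes "sqint M g" "f \<in> borel_measurable M" "AE x in M. norm (f x) \<le> norm (g x)"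
  shows "n2 M f \<le> n2 M g"
proof -
  have "AE x in M. (norm (f x))\<^sup>2 \<le> (norm (g x))\<^sup>2"
    using assms(3) by eventually_elim (rule power_mono, auto)
  then show ?thesis
    unfolding n2_def
    by (intro real_sqrt_le_mono integral_mono_AE sqintD(2) assms(1) sqint_dominated[OF assms])
qed

lemma n2_scale:
  assumes "sqint M f" "h \<in> borel_measurable M" "AE x in M. norm (h x) \<le> c * norm (f x)" "0 \<le> c"
  shows "n2 M h \<le> c * n2 M f"
proof -
  have "n2 M h \<le> n2 M (\<lambda>x. c *\<^sub>R f x)"
    using assms by (intro n2_mono sqint_scaleR) auto
  then show ?thesis using assms(4) by (simp add: n2_scaleR)
qed

lemma n2_sum:
  assumes "finite I" "\<And>i. i \<in> I \<Longrightarrow> sqint M (f i)"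
  shows "n2 M (\<lambda>x. \<Sum>i\<in>I. f i x) \<le> (\<Sum>i\<in>I. n2 M (f i))"
  using assms
proof (induction I rule: finite_induct)
  case (insert i I)
  then have "n2 M (\<lambda>x. f i x + (\<Sum>i\<in>I. f i x)) \<le> n2 M (f i) + n2 M (\<lambda>x. \<Sum>i\<in>I. f i x)"
    by (intro n2_triangle sqint_sum) auto
  with insert show ?case by simp
qed simp

text \<open>
  By Fatou's lemma, a uniform \<open>L\<^sup>2\<close> bound passes to an almost everywhere limit even where the
  convergence is not in \<open>L\<^sup>2\<close>.
\<close>

lemma fatou_sqint:
  assumes "\<And>j::nat. sqint M (f j)" "\<And>j. n2 M (f j) \<le> c" "v \<in> borel_measurable M"
    and "AE x in M. (\<lambda>j. f j x) \<longlonglongrightarrow> v x"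
  shows "sqint M v" "n2 M v \<le> c"
proof -
  have [measurable]: "f j \<in> borel_measurable M" for j using assms(1) by (simp add: sqint_def)
  have c: "0 \<le> c" using assms(2)[of 0] n2_nonneg order_trans by blast
  have "(\<integral>\<^sup>+x. ennreal ((norm (v x))\<^sup>2) \<partial>M) = (\<integral>\<^sup>+x. liminf (\<lambda>j. ennreal ((norm (f j x))\<^sup>2)) \<partial>M)"
  proof (rule nn_integral_cong_AE)
    show "AE x in M. ennreal ((norm (v x))\<^sup>2) = liminf (\<lambda>j. ennreal ((norm (f j x))\<^sup>2))"
      using assms(4)
    proof (eventually_elim)
      case (elim x)
      then have "(\<lambda>j. ennreal ((norm (f j x))\<^sup>2)) \<longlonglongrightarrow> ennreal ((norm (v x))\<^sup>2)"
        by (intro tendsto_intros)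
      then show ?case
        by (rule lim_imp_Liminf[symmetric, rotated]) simp
    qed
  qed
  also have "\<dots> \<le> liminf (\<lambda>j. \<integral>\<^sup>+x. ennreal ((norm (f j x))\<^sup>2) \<partial>M)"
    by (intro nn_integral_liminf) auto
  also have "\<dots> \<le> ennreal (c\<^sup>2)"
  proof -
    have "liminf (\<lambda>j. \<integral>\<^sup>+x. ennreal ((norm (f j x))\<^sup>2) \<partial>M) \<le> liminf (\<lambda>j::nat. ennreal (c\<^sup>2))"
      using assms(1,2) by (intro Liminf_mono always_eventually) (auto simp: nn_n2 intro!: ennreal_leI power_mono)
    then show ?thesis by (simp add: Liminf_const)
  qed
  finally show "sqint M v" "n2 M v \<le> c"
    using sqintI_nn[OF assms(3) _ c] by auto
qed

text \<open>
  Along a subsequence with \<open>\<parallel>u\<^sub>r\<^sub>(\<^sub>j\<^sub>+\<^sub>1\<^sub>) - u\<^sub>r\<^sub>(\<^sub>j\<^sub>)\<parallel> \<le> 2\<^sup>-\<^sup>j\<close> the sum of the absolute increments has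
  norm at most \<open>2\<close>, so it is finite almost everywhere and the subsequence converges pointwise;
  Fatou's lemma upgrades this to convergence of the whole sequence in \<open>L\<^sup>2\<close> (Riesz and Fischer).
\<close>

lemma sqint_complete:
  fixes u :: "nat \<Rightarrow> 'a \<Rightarrow> 'b::euclidean_space"
  assumes u: "\<And>k. sqint M (u k)"
    and Cauchy: "\<And>e. e > 0 \<Longrightarrow> \<exists>N. \<forall>m\<ge>N. \<forall>n\<ge>N. n2 M (\<lambda>x. u m x - u n x) < e"
  shows "\<exists>v. sqint M v \<and> (\<lambda>k. n2 M (\<lambda>x. u k x - v x)) \<longlonglongrightarrow> 0"
proof -
  have "\<forall>j. \<exists>N. \<forall>m\<ge>N. \<forall>n\<ge>N. n2 M (\<lambda>x. u m x - u n x) < (1/2)^j"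
    by (intro allI Cauchy) simp
  then obtain N where N: "\<And>j m n. m \<ge> N j \<Longrightarrow> n \<ge> N j \<Longrightarrow> n2 M (\<lambda>x. u m x - u n x) < (1/2)^j"
    unfolding choice_iff by auto
  \<comment> \<open>The indices \<open>r j \<ge> N j\<close> increase, which makes the increments \<open>d j\<close> summable in norm.\<close>
  define r where "r = (\<lambda>j. (\<Sum>i\<le>j. N i) + j)"
  have rN: "r j \<ge> N j" for j
    unfolding r_def by (simp add: member_le_sum trans_le_add1)
  have rmono: "r j \<le> r (Suc j)" for j unfolding r_def by simp
  have r_ge: "r j \<ge> j" for j unfolding r_def by simp
  define d where "d = (\<lambda>j x. u (r (Suc j)) x - u (r j) x)"
  have [measurable]: "u k \<in> borel_measurable M" for k using u by (simp add: sqint_def)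
  have [measurable]: "d k \<in> borel_measurable M" for k unfolding d_def by measurable
  have sd: "sqint M (d j)" for j unfolding d_def by (intro sqint_diff u)
  have nd: "n2 M (d j) \<le> (1/2)^j" for j
    unfolding d_def using N[of j "r (Suc j)" "r j"] rN[of j] rmono[of j] by (force intro: less_imp_le)
  define G where "G = (\<lambda>J x. \<Sum>j<J. norm (d j x))"
  have [measurable]: "G J \<in> borel_measurable M" for J unfolding G_def by measurable
  have sG: "sqint M (G J)" for J unfolding G_def by (intro sqint_sum sqint_norm sd) auto
  have nG: "n2 M (G J) \<le> 2" for J
  proof -
    have "n2 M (G J) \<le> (\<Sum>j<J. n2 M (\<lambda>x. norm (d j x)))"
      unfolding G_def by (intro n2_sum sqint_norm sd) auto
    also have "\<dots> \<le> (\<Sum>j<J. (1/2)^j)"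
      by (intro sum_mono) (simp add: n2_norm nd)
    also have "\<dots> \<le> (\<Sum>j. (1/2)^j)"
      by (intro sum_le_suminf) auto
    finally show ?thesis by (simp add: suminf_geometric)
  qed
  have Ginc: "incseq (\<lambda>J. ennreal ((norm (G J x))\<^sup>2))" for x
    by (intro incseq_SucI ennreal_leI power_mono) (auto simp: G_def sum_nonneg)
  have "(\<integral>\<^sup>+x. (SUP J. ennreal ((norm (G J x))\<^sup>2)) \<partial>M) = (SUP J. \<integral>\<^sup>+x. ennreal ((norm (G J x))\<^sup>2) \<partial>M)"
    by (intro nn_integral_monotone_convergence_SUP) (use Ginc in \<open>auto simp: incseq_def le_fun_def\<close>)
  also have "\<dots> \<le> ennreal (2\<^sup>2)"
    by (intro SUP_least) (auto simp only: nn_n2[OF sG] intro!: ennreal_leI power_mono nG n2_nonneg)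
  also have "\<dots> < \<infinity>" by simp
  finally have "AE x in M. (SUP J. ennreal ((norm (G J x))\<^sup>2)) \<noteq> \<infinity>"
    by (intro nn_integral_noteq_infinite) auto
  then have conv: "AE x in M. convergent (\<lambda>j. u (r j) x)"
  proof (eventually_elim)
    case (elim x)
    then obtain B where B: "(SUP J. ennreal ((norm (G J x))\<^sup>2)) = ennreal B" "B \<ge> 0"
      by (metis ennreal_cases infinity_ennreal_def)
    have "(G J x)\<^sup>2 \<le> B" for J
    proof -
      have "ennreal ((norm (G J x))\<^sup>2) \<le> ennreal B"
        unfolding B(1)[symmetric] by (intro SUP_upper) auto
      then show ?thesis using B(2) by simp
    qed
    then have "G J x \<le> sqrt B" for J by (simp add: real_le_rsqrt)
    then have "summable (\<lambda>j. norm (d j x))"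
      unfolding G_def by (intro summableI_nonneg_bounded[where x="sqrt B"]) auto
    then have "summable (\<lambda>j. d j x)" by (rule summable_norm_cancel)
    then have "convergent (\<lambda>n. u (r 0) x + (\<Sum>j<n. d j x))"
      by (intro convergent_add convergent_const) (simp add: summable_iff_convergent)
    moreover have "u (r 0) x + (\<Sum>j<n. d j x) = u (r n) x" for n
      unfolding d_def by (subst sum_lessThan_telescope) simp
    ultimately show ?case by simp
  qed
  define v where "v = (\<lambda>x. lim (\<lambda>j. u (r j) x))"
  have [measurable]: "v \<in> borel_measurable M"
    unfolding v_def by (rule borel_measurable_lim_metric) measurable
  have lim: "AE x in M. (\<lambda>j. u (r j) x) \<longlonglongrightarrow> v x"
    using conv by (eventually_elim) (simp add: v_def convergent_LIMSEQ_iff)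
  have est: "sqint M (\<lambda>x. u k x - v x) \<and> n2 M (\<lambda>x. u k x - v x) \<le> (1/2)^i" if k: "k \<ge> N i" for k i
  proof -
    have *: "r (j + N i) \<ge> N i" for j using r_ge[of "j + N i"] by simp
    have "AE x in M. (\<lambda>j. u k x - u (r (j + N i)) x) \<longlonglongrightarrow> u k x - v x"
      using lim by eventually_elim (intro tendsto_intros LIMSEQ_ignore_initial_segment[where k="N i"])
    from fatou_sqint[where f="\<lambda>j x. u k x - u (r (j + N i)) x", OF _ _ _ this, of "(1/2)^i"]
    show ?thesis
      using N[OF k *] by (auto intro: sqint_diff u less_imp_le)
  qed
  have sv: "sqint M v"
    using sqint_diff[OF u[of "N 0"] conjunct1[OF est[of 0 "N 0"]]] by simp
  have "(\<lambda>k. n2 M (\<lambda>x. u k x - v x)) \<longlonglongrightarrow> 0"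
  proof (rule LIMSEQ_I)
    fix e :: real assume "e > 0"
    then obtain i where i: "(1/2)^i < e" using real_arch_pow_inv[of e "1/2"] by auto
    show "\<exists>no. \<forall>k\<ge>no. norm (n2 M (\<lambda>x. u k x - v x) - 0) < e"
      using est[of i] i by (intro exI[of _ "N i"]) (auto intro: order_le_less_trans)
  qed
  with sv show ?thesis by blast
qed

section \<open>Quadratic minimisation over closed convex sets\<close>

text \<open>
  Up to a constant, the squared distance of \<open>v\<close> to \<open>b/q\<close> in the \<open>L\<^sup>2\<close> norm with weight \<open>q\<close>.
\<close>

definition quad :: "'a measure \<Rightarrow> ('a \<Rightarrow> real) \<Rightarrow> ('a \<Rightarrow> 'b::euclidean_space) \<Rightarrow> ('a \<Rightarrow> 'b) \<Rightarrow> real" where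
  "quad M q b v = ip M (\<lambda>x. q x *\<^sub>R v x) v - 2 * ip M b v"

text \<open>
  Segments are written through increments, the form in which the variational inequality uses them.
\<close>

definition L2_convex :: "('a \<Rightarrow> 'b::real_vector) set \<Rightarrow> bool" where
  "L2_convex U \<longleftrightarrow> (\<forall>u\<in>U. \<forall>v\<in>U. \<forall>t\<in>{0..1}. (\<lambda>x. u x + t *\<^sub>R (v x - u x)) \<in> U)"

definition L2_seq_closed :: "'a measure \<Rightarrow> ('a \<Rightarrow> 'b::euclidean_space) set \<Rightarrow> bool" where
  "L2_seq_closed M U \<longleftrightarrow> (\<forall>u v. (\<forall>k::nat. u k \<in> U) \<longrightarrow> sqint M v \<longrightarrow>
     (\<lambda>k. n2 M (\<lambda>x. u k x - v x)) \<longlonglongrightarrow> 0 \<longrightarrow> v \<in> U)"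

locale L2_weight =
  fixes M :: "'a measure" and q :: "'a \<Rightarrow> real" and a Q :: real and b :: "'a \<Rightarrow> 'b::euclidean_space"
  assumes q_meas [measurable]: "q \<in> borel_measurable M"
    and a_pos: "a > 0"
    and q_lower: "\<And>x. x \<in> space M \<Longrightarrow> a \<le> q x"
    and q_upper: "\<And>x. x \<in> space M \<Longrightarrow> q x \<le> Q"
    and b_sqint: "sqint M b"
begin

lemma q_abs: "x \<in> space M \<Longrightarrow> \<bar>q x\<bar> \<le> Q"
  using q_lower[of x] q_upper[of x] a_pos by simp

lemma sqint_weighted: "sqint M v \<Longrightarrow> sqint M (\<lambda>x. q x *\<^sub>R v x)"
  by (rule sqint_scale[where c=Q and f=v])
    (auto simp: sqint_def intro!: AE_I2 mult_right_mono q_abs)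

lemma n2_weighted: "sqint M v \<Longrightarrow> 0 \<le> Q \<Longrightarrow> n2 M (\<lambda>x. q x *\<^sub>R v x) \<le> Q * n2 M v"
  by (rule n2_scale) (auto simp: sqint_def intro!: AE_I2 mult_right_mono q_abs)

lemma weighted_lower:
  assumes "sqint M v"
  shows "a * (n2 M v)\<^sup>2 \<le> ip M (\<lambda>x. q x *\<^sub>R v x) v"
proof -
  have "ip M (\<lambda>x. a *\<^sub>R v x) v \<le> ip M (\<lambda>x. q x *\<^sub>R v x) v"
    unfolding ip_def
    by (intro integral_mono sqint_inner sqint_weighted sqint_scaleR assms)
      (auto intro: mult_right_mono q_lower)
  then show ?thesis by (simp add: ip_scaleR n2_sq_ip)
qed

lemma weighted_sym:
  "ip M (\<lambda>x. q x *\<^sub>R v x) w = ip M (\<lambda>x. q x *\<^sub>R w x) v"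
  by (simp add: ip_def inner_commute)

text \<open>
  The second-order expansion is exact, and its quadratic term is coercive; existence,
  uniqueness and stability of minimisers are all read off from it.
\<close>

lemma quad_expand:
  assumes "sqint M v" "sqint M d"
  shows "quad M q b (\<lambda>x. v x + d x) =
    quad M q b v + 2 * ip M (\<lambda>x. q x *\<^sub>R v x - b x) d + ip M (\<lambda>x. q x *\<^sub>R d x) d"
  using assms sqint_weighted[OF assms(1)] sqint_weighted[OF assms(2)] b_sqint
  by (simp add: quad_def scaleR_add_right ip_add ip_diff sqint_add weighted_sym[of d v])

lemma quad_expand_diff:
  assumes "sqint M v" "sqint M w"
  shows "quad M q b w = quad M q b v + 2 * ip M (\<lambda>x. q x *\<^sub>R v x - b x) (\<lambda>x. w x - v x)
           + ip M (\<lambda>x. q x *\<^sub>R (w x - v x)) (\<lambda>x. w x - v x)"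
  using quad_expand[OF assms(1) sqint_diff[OF assms(2,1)]] by simp

lemma quad_lower:
  assumes "sqint M v"
  shows "- (n2 M b)\<^sup>2 / a \<le> quad M q b v"
proof -
  have "0 \<le> (a * n2 M v - n2 M b)\<^sup>2" by simp
  then have "- (n2 M b)\<^sup>2 / a \<le> a * (n2 M v)\<^sup>2 - 2 * (n2 M b * n2 M v)"
    using a_pos by (simp add: field_simps power2_eq_square)
  also have "\<dots> \<le> quad M q b v"
    using weighted_lower[OF assms] CS_ip[OF b_sqint assms] unfolding quad_def by simp
  finally show ?thesis .
qed

lemma quad_upper:
  assumes "sqint M v" "0 \<le> Q"
  shows "quad M q b v \<le> Q * (n2 M v)\<^sup>2 + 2 * (n2 M b * n2 M v)"
proof -
  have "ip M (\<lambda>x. q x *\<^sub>R v x) v \<le> n2 M (\<lambda>x. q x *\<^sub>R v x) * n2 M v"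
    using CS_ip[OF sqint_weighted[OF assms(1)] assms(1)] by simp
  also have "\<dots> \<le> (Q * n2 M v) * n2 M v"
    by (intro mult_right_mono n2_weighted assms) simp
  finally show ?thesis
    using CS_ip[OF b_sqint assms(1)] unfolding quad_def power2_eq_square by simp
qed

text \<open>
  Moving from the minimiser towards \<open>w\<close> by \<open>t\<close> changes the value by \<open>2 t I + O(t\<^sup>2)\<close>, which must not
  be negative for small \<open>t\<close>.
\<close>

lemma minimizer_variational:
  assumes U: "U \<subseteq> Collect (sqint M)" "L2_convex U"
    and v: "v \<in> U" "\<And>w. w \<in> U \<Longrightarrow> quad M q b v \<le> quad M q b w" and w: "w \<in> U"
  shows "0 \<le> ip M (\<lambda>x. q x *\<^sub>R v x - b x) (\<lambda>x. w x - v x)" (is "0 \<le> ?I")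
proof -
  let ?d = "\<lambda>x. w x - v x"
  let ?J = "ip M (\<lambda>x. q x *\<^sub>R ?d x) ?d"
  have s: "sqint M v" "sqint M w" "sqint M ?d" using U v w by (auto intro: sqint_diff)
  have "0 \<le> 2 * ?I + t * ?J" if t: "0 < t" "t \<le> 1" for t
  proof -
    have "(\<lambda>x. v x + t *\<^sub>R ?d x) \<in> U"
      using U(2) v(1) w t unfolding L2_convex_def by simp
    from v(2)[OF this] have "0 \<le> 2 * (t * ?I) + t * (t * ?J)"
      unfolding quad_expand[OF s(1) sqint_scaleR[OF s(3)]] scaleR_left_commute[of "q _"]
      unfolding ip_scaleR by simp
    also have "\<dots> = t * (2 * ?I + t * ?J)" by (simp add: algebra_simps)
    finally show ?thesis using t by (simp add: zero_le_mult_iff)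
  qed
  then have "eventually (\<lambda>t. 0 \<le> 2 * ?I + t * ?J) (at_right 0)"
    unfolding eventually_at_right_field by (intro exI[of _ 1]) auto
  moreover have "((\<lambda>t. 2 * ?I + t * ?J) \<longlongrightarrow> 2 * ?I + 0 * ?J) (at_right 0)"
    by (intro tendsto_intros)
  ultimately have "0 \<le> 2 * ?I + 0 * ?J"
    by (intro tendsto_lowerbound[where F="at_right 0"]) auto
  then show ?thesis by simp
qed

lemma minimizer_gap:
  assumes U: "U \<subseteq> Collect (sqint M)" "L2_convex U"
    and v: "v \<in> U" "\<And>w. w \<in> U \<Longrightarrow> quad M q b v \<le> quad M q b w" and w: "w \<in> U"
  shows "a * (n2 M (\<lambda>x. w x - v x))\<^sup>2 \<le> quad M q b w - quad M q b v"
proof -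
  have s: "sqint M v" "sqint M w" using U v w by auto
  show ?thesis
    using minimizer_variational[OF assms] weighted_lower[OF sqint_diff[OF s(2,1)]]
      quad_expand_diff[OF s] by simp
qed

lemma minimizer_unique:
  assumes U: "U \<subseteq> Collect (sqint M)" "L2_convex U"
    and v: "v \<in> U" "\<And>w. w \<in> U \<Longrightarrow> quad M q b v \<le> quad M q b w"
    and w: "w \<in> U" "quad M q b w \<le> quad M q b v"
  shows "AE x in M. w x = v x"
proof -
  have s: "sqint M v" "sqint M w" using U v w by auto
  have "a * (n2 M (\<lambda>x. w x - v x))\<^sup>2 \<le> 0"
    using minimizer_gap[OF assms(1-5)] w(2) by simp
  then have "n2 M (\<lambda>x. w x - v x) = 0"
    using a_pos by (simp add: mult_le_0_iff)
  then show ?thesis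
    using n2_eq_0[OF sqint_diff[OF s(2,1)]] by simp
qed

text \<open>
  The midpoint of two almost minimising functions cannot be much better than either, so coercivity
  of the quadratic term makes a minimising sequence Cauchy.
\<close>

lemma minimizer_exists:
  assumes U: "U \<subseteq> Collect (sqint M)" "L2_convex U" "L2_seq_closed M U" "U \<noteq> {}"
  shows "\<exists>v\<in>U. \<forall>w\<in>U. quad M q b v \<le> quad M q b w"
proof -
  let ?G = "quad M q b"
  define I where "I = Inf (?G ` U)"
  have bdd: "bdd_below (?G ` U)"
    using U(1) quad_lower by (intro bdd_belowI2[where m="- (n2 M b)\<^sup>2 / a"]) auto
  have I_le: "I \<le> ?G w" if "w \<in> U" for w
    unfolding I_def using bdd that by (simp add: cInf_lower)
  have "\<exists>u\<in>U. ?G u < I + 1 / real (Suc k)" for k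
  proof -
    have "Inf (?G ` U) < I + 1 / real (Suc k)" unfolding I_def by simp
    then show ?thesis using cInf_lessD[of "?G ` U"] U(4) by auto
  qed
  then obtain u where u: "\<And>k. u k \<in> U" "\<And>k. ?G (u k) < I + 1 / real (Suc k)" by metis
  have su: "sqint M (u k)" for k using u(1) U(1) by auto
  have near: "(a / 2) * (n2 M (\<lambda>x. u m x - u n x))\<^sup>2 \<le> 1 / real (Suc m) + 1 / real (Suc n)" for m n
  proof -
    \<comment> \<open>The two functions are \<open>c + d\<close> and \<open>c - d\<close> with the admissible midpoint \<open>c\<close>, so the first-order terms cancel.\<close>
    define d where "d = (\<lambda>x. (1/2) *\<^sub>R (u n x - u m x))"
    have sd: "sqint M d" unfolding d_def by (intro sqint_scaleR sqint_diff su)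
    define c where "c = (\<lambda>x. u m x + (1/2) *\<^sub>R (u n x - u m x))"
    have c: "c \<in> U"
      using U(2) u(1)[of m] u(1)[of n] unfolding L2_convex_def c_def by auto
    have sc: "sqint M c" using c U(1) by auto
    have e1: "u n = (\<lambda>x. c x + d x)"
      by (auto simp: c_def d_def fun_eq_iff algebra_simps simp flip: scaleR_add_left)
    have e2: "u m = (\<lambda>x. c x + - d x)"
      by (auto simp: c_def d_def)
    have "?G (u n) + ?G (u m) = 2 * ?G c + 2 * ip M (\<lambda>x. q x *\<^sub>R d x) d"
      unfolding e1 quad_expand[OF sc sd]
      unfolding e2 quad_expand[OF sc sqint_uminus[OF sd]]
      by (simp add: ip_def)
    moreover have "a * (n2 M d)\<^sup>2 \<le> ip M (\<lambda>x. q x *\<^sub>R d x) d"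
      by (rule weighted_lower[OF sd])
    moreover have "(n2 M d)\<^sup>2 = (1/4) * (n2 M (\<lambda>x. u m x - u n x))\<^sup>2"
      unfolding d_def n2_scaleR n2_minus_commute[of M "u n"] by (simp add: power2_eq_square)
    ultimately show ?thesis
      using u(2)[of m] u(2)[of n] I_le[OF c] by (simp add: algebra_simps)
  qed
  have Cauchy: "\<exists>N. \<forall>m\<ge>N. \<forall>n\<ge>N. n2 M (\<lambda>x. u m x - u n x) < e" if e: "e > 0" for e
  proof -
    have "a / 2 * e\<^sup>2 / 2 > 0" using e a_pos by simp
    then obtain N where N: "1 / real (Suc N) < a / 2 * e\<^sup>2 / 2"
      using reals_Archimedean by (metis inverse_eq_divide)
    have "n2 M (\<lambda>x. u m x - u n x) < e" if mn: "m \<ge> N" "n \<ge> N" for m n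
    proof -
      have "1 / real (Suc m) \<le> 1 / real (Suc N)" "1 / real (Suc n) \<le> 1 / real (Suc N)"
        using mn by (auto intro!: divide_left_mono)
      then have "(a / 2) * (n2 M (\<lambda>x. u m x - u n x))\<^sup>2 < (a / 2) * e\<^sup>2"
        using near[of m n] N by linarith
      then have "(n2 M (\<lambda>x. u m x - u n x))\<^sup>2 < e\<^sup>2"
        using a_pos by (subst (asm) mult_less_cancel_left_pos) auto
      then show ?thesis using e by (simp add: power2_less_imp_less)
    qed
    then show ?thesis by blast
  qed
  obtain v where v: "sqint M v" "(\<lambda>k. n2 M (\<lambda>x. u k x - v x)) \<longlonglongrightarrow> 0"
    using sqint_complete[where u=u, OF su Cauchy] by auto
  have vU: "v \<in> U" using U(3) u(1) v unfolding L2_seq_closed_def by blast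
  have "?G v \<le> I"
  proof (rule LIMSEQ_le)
    let ?n = "\<lambda>k. n2 M (\<lambda>x. u k x - v x)"
    show "(\<lambda>k. ?G v - 2 * (n2 M (\<lambda>x. q x *\<^sub>R v x - b x) * ?n k)) \<longlonglongrightarrow> ?G v"
      by (rule tendsto_eq_intros v(2) refl | simp)+
    show "(\<lambda>k. I + 1 / real (Suc k)) \<longlonglongrightarrow> I"
      using tendsto_add[OF tendsto_const LIMSEQ_Suc[OF lim_1_over_n], of I] by simp
    show "\<exists>N. \<forall>k\<ge>N. ?G v - 2 * (n2 M (\<lambda>x. q x *\<^sub>R v x - b x) * ?n k) \<le> I + 1 / real (Suc k)"
    proof (intro exI allI impI)
      fix k :: nat assume "k \<ge> 0"
      have sd: "sqint M (\<lambda>x. u k x - v x)" by (intro sqint_diff su v)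
      have "0 \<le> a * (?n k)\<^sup>2" using a_pos by simp
      with weighted_lower[OF sd] have "0 \<le> ip M (\<lambda>x. q x *\<^sub>R (u k x - v x)) (\<lambda>x. u k x - v x)"
        by linarith
      moreover have "\<bar>ip M (\<lambda>x. q x *\<^sub>R v x - b x) (\<lambda>x. u k x - v x)\<bar>
          \<le> n2 M (\<lambda>x. q x *\<^sub>R v x - b x) * ?n k"
        by (intro CS_ip sd sqint_diff sqint_weighted v b_sqint)
      ultimately show "?G v - 2 * (n2 M (\<lambda>x. q x *\<^sub>R v x - b x) * ?n k) \<le> I + 1 / real (Suc k)"
        using quad_expand_diff[OF v(1) su[of k]] u(2)[of k] by linarith
    qed
  qed
  then show ?thesis using vU I_le order_trans by blast
qed

text \<open>
  The value gap to a competitor \<open>w\<close> controls the distance to \<open>w\<close>. The bound involves \<open>q\<close> and \<open>b\<close>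
  only through the bounds \<open>a\<close>, \<open>Q\<close> and the norm of \<open>b\<close>, hence is uniform over families of functionals.
\<close>

lemma minimizer_bound:
  assumes U: "U \<subseteq> Collect (sqint M)" "L2_convex U"
    and v: "v \<in> U" "\<And>w. w \<in> U \<Longrightarrow> quad M q b v \<le> quad M q b w"
    and w: "w \<in> U" and bn: "n2 M b \<le> B" "n2 M w \<le> W" "0 \<le> Q"
  shows "n2 M v \<le> W + sqrt ((Q * W\<^sup>2 + 2 * (B * W) + B\<^sup>2 / a) / a)"
proof -
  have s: "sqint M v" "sqint M w" using U v w by auto
  have BW: "0 \<le> B" "0 \<le> W" using bn n2_nonneg order_trans by blast+
  have "a * (n2 M (\<lambda>x. w x - v x))\<^sup>2 \<le> quad M q b w - quad M q b v"
    by (rule minimizer_gap[OF assms(1-5)])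
  also have "\<dots> \<le> Q * (n2 M w)\<^sup>2 + 2 * (n2 M b * n2 M w) + (n2 M b)\<^sup>2 / a"
    using quad_upper[OF s(2) bn(3)] quad_lower[OF s(1)] by simp
  also have "\<dots> \<le> Q * W\<^sup>2 + 2 * (B * W) + B\<^sup>2 / a"
    using a_pos bn BW by (intro add_mono mult_left_mono mult_mono divide_right_mono power_mono) auto
  finally have "(n2 M (\<lambda>x. w x - v x))\<^sup>2 \<le> (Q * W\<^sup>2 + 2 * (B * W) + B\<^sup>2 / a) / a"
    using a_pos by (simp add: field_simps)
  then have *: "n2 M (\<lambda>x. w x - v x) \<le> sqrt ((Q * W\<^sup>2 + 2 * (B * W) + B\<^sup>2 / a) / a)"
    by (rule real_le_rsqrt)
  have "n2 M v \<le> n2 M w + n2 M (\<lambda>x. w x - v x)"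
    using n2_triangle_diff[OF s(2) sqint_diff[OF s(2,1)]] by simp
  with * bn(2) show ?thesis by linarith
qed

end

text \<open>
  Each variational inequality is tested with the other minimiser. In the sum the terms
  \<open>q\<^sub>1 v\<^sub>1 - b\<^sub>1\<close> and \<open>q\<^sub>2 v\<^sub>2 - b\<^sub>2\<close> are compared after writing
  \<open>q\<^sub>1 v\<^sub>1 - q\<^sub>2 v\<^sub>2 = - q\<^sub>1 (v\<^sub>2 - v\<^sub>1) + (q\<^sub>1 - q\<^sub>2) v\<^sub>2\<close>, so that only the second minimiser enters the bound.
\<close>

lemma minimizer_stability:
  fixes b1 b2 :: "'a \<Rightarrow> 'b::euclidean_space"
  assumes "L2_weight M q1 a Q1 b1" "L2_weight M q2 a Q2 b2"
    and U: "U \<subseteq> Collect (sqint M)" "L2_convex U"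
    and v1: "v1 \<in> U" "\<And>w. w \<in> U \<Longrightarrow> quad M q1 b1 v1 \<le> quad M q1 b1 w"
    and v2: "v2 \<in> U" "\<And>w. w \<in> U \<Longrightarrow> quad M q2 b2 v2 \<le> quad M q2 b2 w"
    and q: "AE x in M. \<bar>q1 x - q2 x\<bar> \<le> s" and b: "n2 M (\<lambda>x. b1 x - b2 x) \<le> \<beta>" and s: "0 \<le> s"
  shows "a * n2 M (\<lambda>x. v1 x - v2 x) \<le> s * n2 M v2 + \<beta>"
proof -
  interpret W1: L2_weight M q1 a Q1 b1 by fact
  interpret W2: L2_weight M q2 a Q2 b2 by fact
  have sv: "sqint M v1" "sqint M v2" using U v1 v2 by auto
  let ?d = "\<lambda>x. v2 x - v1 x"
  have sd: "sqint M ?d" by (intro sqint_diff sv)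
  have i1: "0 \<le> ip M (\<lambda>x. q1 x *\<^sub>R v1 x - b1 x) ?d"
    by (rule W1.minimizer_variational[OF U v1 v2(1)])
  have "0 \<le> ip M (\<lambda>x. q2 x *\<^sub>R v2 x - b2 x) (\<lambda>x. v1 x - v2 x)"
    by (rule W2.minimizer_variational[OF U v2 v1(1)])
  then have i2: "ip M (\<lambda>x. q2 x *\<^sub>R v2 x - b2 x) ?d \<le> 0"
    by (simp add: ip_diff sv W2.sqint_weighted W2.b_sqint sqint_diff)
  define r where "r = (\<lambda>x. (q1 x - q2 x) *\<^sub>R v2 x)"
  have [measurable]: "v2 \<in> borel_measurable M" using sv by (simp add: sqint_def)
  have rm: "r \<in> borel_measurable M" unfolding r_def by measurable
  have rb: "AE x in M. norm (r x) \<le> s * norm (v2 x)"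
    using q by eventually_elim (auto simp: r_def intro: mult_right_mono)
  have sr: "sqint M r" by (rule sqint_scale[OF sv(2) rm rb])
  have nr: "n2 M r \<le> s * n2 M v2" by (rule n2_scale[OF sv(2) rm rb s])
  have e: "(\<lambda>x. q1 x *\<^sub>R ?d x) =
      (\<lambda>x. (r x - (b1 x - b2 x)) - ((q1 x *\<^sub>R v1 x - b1 x) - (q2 x *\<^sub>R v2 x - b2 x)))"
    by (auto simp: r_def algebra_simps)
  have sb: "sqint M (\<lambda>x. b1 x - b2 x)" by (intro sqint_diff W1.b_sqint W2.b_sqint)
  have "a * (n2 M ?d)\<^sup>2 \<le> ip M (\<lambda>x. q1 x *\<^sub>R ?d x) ?d"
    by (rule W1.weighted_lower[OF sd])
  also have "\<dots> = ip M (\<lambda>x. r x - (b1 x - b2 x)) ?d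
      - (ip M (\<lambda>x. q1 x *\<^sub>R v1 x - b1 x) ?d - ip M (\<lambda>x. q2 x *\<^sub>R v2 x - b2 x) ?d)"
    unfolding e
    by (subst ip_diff(2), (intro sqint_diff sv sr sb W1.sqint_weighted W2.sqint_weighted W1.b_sqint W2.b_sqint)+)
      (subst ip_diff(2)[of _ _ "\<lambda>x. q1 x *\<^sub>R v1 x - b1 x"],
        (intro sqint_diff sv sr sb W1.sqint_weighted W2.sqint_weighted W1.b_sqint W2.b_sqint refl)+)
  also have "\<dots> \<le> ip M (\<lambda>x. r x - (b1 x - b2 x)) ?d" using i1 i2 by simp
  also have "\<dots> \<le> n2 M (\<lambda>x. r x - (b1 x - b2 x)) * n2 M ?d"
    using CS_ip[OF sqint_diff[OF sr sb] sd] by simp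
  also have "\<dots> \<le> (s * n2 M v2 + \<beta>) * n2 M ?d"
    using n2_triangle_diff[OF sr sb] nr b by (intro mult_right_mono) auto
  finally have main: "a * (n2 M ?d)\<^sup>2 \<le> (s * n2 M v2 + \<beta>) * n2 M ?d" .
  have "0 \<le> s * n2 M v2 + \<beta>"
    using s order_trans[OF n2_nonneg b] by simp
  then have "a * n2 M ?d \<le> s * n2 M v2 + \<beta>"
    using main n2_nonneg[of M ?d] by (cases "n2 M ?d = 0") (auto simp: power2_eq_square)
  then show ?thesis by (simp only: n2_minus_commute[of M v1])
qed

section \<open>The cost as a quadratic functional\<close>

text \<open>
  Membership in \<open>L2 S\<close> is membership of the extension by zero, for any \<open>S\<close>; over a measurable \<open>S\<close> it
  can also be expressed by the restricted measure.
\<close>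

lemma L2_iff_sqint:
  fixes u :: "'a::euclidean_space \<Rightarrow> 'b::euclidean_space"
  shows "u \<in> L2 S \<longleftrightarrow> sqint lebesgue (\<lambda>x. indicat_real S x *\<^sub>R u x)"
proof -
  have e: "(norm (indicat_real S x *\<^sub>R u x))\<^sup>2 = indicat_real S x *\<^sub>R (norm (u x))\<^sup>2" for x
    by (simp add: indicator_def)
  show ?thesis
    unfolding sqint_def L2_def set_borel_measurable_def set_integrable_def e by simp
qed

lemma L2norm_eq_n2:
  fixes u :: "'a::euclidean_space \<Rightarrow> 'b::euclidean_space"
  shows "L2norm S u = n2 lebesgue (\<lambda>x. indicat_real S x *\<^sub>R u x)"
proof -
  have e: "(norm (indicat_real S x *\<^sub>R u x))\<^sup>2 = indicat_real S x *\<^sub>R (norm (u x))\<^sup>2" for x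
    by (simp add: indicator_def)
  show ?thesis
    unfolding L2norm_def n2_def set_lebesgue_integral_def e ..
qed

lemma L2_iff_sqint_on:
  fixes u :: "'a::euclidean_space \<Rightarrow> 'b::euclidean_space"
  assumes "S \<in> sets lebesgue"
  shows "u \<in> L2 S \<longleftrightarrow> sqint (lebesgue_on S) u"
  using assms
  by (simp add: L2_def sqint_def set_borel_measurable_def set_integrable_def
      borel_measurable_restrict_space_iff integrable_restrict_space)

lemma L2norm_eq_n2_on:
  fixes u :: "'a::euclidean_space \<Rightarrow> 'b::euclidean_space"
  assumes "S \<in> sets lebesgue"
  shows "L2norm S u = n2 (lebesgue_on S) u"
  using assms by (simp add: L2norm_def n2_def set_lebesgue_integral_def integral_restrict_space)

text \<open>
  The coefficient of \<open>|v|\<^sup>2\<close> in the density of the cost.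
\<close>

definition cost_weight :: "real \<Rightarrow> real \<Rightarrow> real \<Rightarrow> ('a \<Rightarrow> real) \<Rightarrow> 'a \<Rightarrow> real" where
  "cost_weight \<mu>1 \<mu>2 \<kappa> L \<eta> =
     \<mu>1 / 2 * inverse (1 + L \<eta>) + \<mu>2 / 2 * (inverse (1 + L \<eta>))\<^sup>2 + \<kappa> / 2"

text \<open>
  Minus one half of the gradient at \<open>v = 0\<close> of the density of the cost.
\<close>

definition cost_load ::
  "real \<Rightarrow> real \<Rightarrow> ('a \<Rightarrow> complex) \<Rightarrow> ('a \<Rightarrow> complex) \<Rightarrow> ('a \<Rightarrow> complex) \<Rightarrow> ('a \<Rightarrow> real) \<Rightarrow> 'a \<Rightarrow> complex" where
  "cost_load \<mu>1 \<mu>2 F y1 y2 L \<eta> =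
     (\<mu>1 / 2) *\<^sub>R (y1 \<eta> - inverse (1 + L \<eta>) *\<^sub>R F \<eta>) +
     (\<mu>2 / 2) *\<^sub>R (inverse (1 + L \<eta>) *\<^sub>R y2 \<eta> - (inverse (1 + L \<eta>))\<^sup>2 *\<^sub>R F \<eta>)"

lemma cost_density:
  fixes F v y1 y2 :: complex
  assumes "D > 0"
  shows "\<mu>1 / 2 * ((cmod ((F + v) / complex_of_real D - y1))\<^sup>2 * D) +
     \<mu>2 / 2 * (cmod ((F + v) / complex_of_real D - y2))\<^sup>2 + \<kappa> / 2 * (cmod v)\<^sup>2 =
     (\<mu>1 / 2 * inverse D + \<mu>2 / 2 * (inverse D)\<^sup>2 + \<kappa> / 2) * (v \<bullet> v)
     - 2 * (((\<mu>1 / 2) *\<^sub>R (y1 - inverse D *\<^sub>R F) +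
             (\<mu>2 / 2) *\<^sub>R (inverse D *\<^sub>R y2 - (inverse D)\<^sup>2 *\<^sub>R F)) \<bullet> v)
     + (\<mu>1 / 2 * ((cmod (F / complex_of_real D - y1))\<^sup>2 * D) + \<mu>2 / 2 * (cmod (F / complex_of_real D - y2))\<^sup>2)"
proof -
  have *: "(cmod ((F + v) / complex_of_real D - y))\<^sup>2 =
     (cmod (F / complex_of_real D - y))\<^sup>2 + 2 * inverse D * ((inverse D *\<^sub>R F - y) \<bullet> v) + (inverse D)\<^sup>2 * (v \<bullet> v)" for y
  proof -
    define w where "w = F / complex_of_real D - y"
    have a1: "(F + v) / complex_of_real D - y = (F / complex_of_real D - y) + inverse D *\<^sub>R v"
      by (simp add: scaleR_conv_of_real divide_inverse algebra_simps)
    have a2: "inverse D *\<^sub>R F = F / complex_of_real D"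
      by (simp add: scaleR_conv_of_real field_simps)
    show ?thesis
      unfolding power2_norm_eq_inner a1 a2 w_def[symmetric]
      by (simp add: inner_add_left inner_add_right inner_commute power2_eq_square)
  qed
  have "inverse D * D = 1" using assms by simp
  then show ?thesis
    unfolding * power2_norm_eq_inner[of v]
    using assms
    by (simp add: inner_add_left inner_diff_left field_simps power2_eq_square)
qed

context
  fixes M :: "'a measure" and \<mu>1 \<mu>2 \<kappa> :: real and F y1 y2 :: "'a \<Rightarrow> complex"
  assumes mu: "\<mu>1 \<ge> 0" "\<mu>2 \<ge> 0" "\<kappa> > 0"
    and sq: "sqint M F" "sqint M y1" "sqint M y2"
begin

text \<open>
  As \<open>1/(1+L) \<le> 1\<close>, the load is bounded by the data alone. This is what makes the constants
  independent of \<open>\<epsilon>\<close>.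
\<close>

lemma cost_load_norm:
  assumes "L \<eta> \<ge> 0"
  shows "norm (cost_load \<mu>1 \<mu>2 F y1 y2 L \<eta>)
     \<le> norm (\<mu>1 / 2 * (cmod (y1 \<eta>) + cmod (F \<eta>)) + \<mu>2 / 2 * (cmod (y2 \<eta>) + cmod (F \<eta>)))"
proof -
  define r where "r = inverse (1 + L \<eta>)"
  have r: "0 \<le> r" "r \<le> 1" using assms by (auto simp: r_def field_simps)
  then have r2: "r\<^sup>2 \<le> 1" by (simp add: power_le_one)
  have "norm (cost_load \<mu>1 \<mu>2 F y1 y2 L \<eta>)
      \<le> \<mu>1 / 2 * norm (y1 \<eta> - r *\<^sub>R F \<eta>) + \<mu>2 / 2 * norm (r *\<^sub>R y2 \<eta> - r\<^sup>2 *\<^sub>R F \<eta>)"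
    unfolding cost_load_def r_def[symmetric]
    by (rule order_trans[OF norm_triangle_ineq]) (use mu in simp)
  also have "\<dots> \<le> \<mu>1 / 2 * (cmod (y1 \<eta>) + cmod (F \<eta>)) + \<mu>2 / 2 * (cmod (y2 \<eta>) + cmod (F \<eta>))"
  proof (intro add_mono mult_left_mono)
    show "norm (y1 \<eta> - r *\<^sub>R F \<eta>) \<le> cmod (y1 \<eta>) + cmod (F \<eta>)"
      by (rule order_trans[OF norm_triangle_ineq4]) (use r in \<open>simp add: mult_left_le_one_le\<close>)
    show "norm (r *\<^sub>R y2 \<eta> - r\<^sup>2 *\<^sub>R F \<eta>) \<le> cmod (y2 \<eta>) + cmod (F \<eta>)"
      by (rule order_trans[OF norm_triangle_ineq4])
        (use r r2 in \<open>auto intro!: add_mono simp: mult_left_le_one_le\<close>)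
  qed (use mu in auto)
  finally show ?thesis by simp
qed

lemma sqint_cost_load_majorant:
  "sqint M (\<lambda>\<eta>. \<mu>1 / 2 * (cmod (y1 \<eta>) + cmod (F \<eta>)) + \<mu>2 / 2 * (cmod (y2 \<eta>) + cmod (F \<eta>)))"
  using sqint_add[OF sqint_scaleR[OF sqint_add[OF sqint_norm[OF sq(2)] sqint_norm[OF sq(1)]], of "\<mu>1 / 2"]
      sqint_scaleR[OF sqint_add[OF sqint_norm[OF sq(3)] sqint_norm[OF sq(1)]], of "\<mu>2 / 2"]]
  by simp

context
  fixes L :: "'a \<Rightarrow> real"
  assumes L: "L \<in> borel_measurable M" "\<And>x. x \<in> space M \<Longrightarrow> 0 \<le> L x"
begin

lemma cost_load_measurable: "cost_load \<mu>1 \<mu>2 F y1 y2 L \<in> borel_measurable M"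
  unfolding cost_load_def[abs_def] using sq L by (auto simp: sqint_def)

lemma sqint_cost_load: "sqint M (cost_load \<mu>1 \<mu>2 F y1 y2 L)"
  by (rule sqint_dominated[OF sqint_cost_load_majorant cost_load_measurable])
    (intro AE_I2 cost_load_norm L)

lemma n2_cost_load:
  "n2 M (cost_load \<mu>1 \<mu>2 F y1 y2 L)
    \<le> n2 M (\<lambda>\<eta>. \<mu>1 / 2 * (cmod (y1 \<eta>) + cmod (F \<eta>)) + \<mu>2 / 2 * (cmod (y2 \<eta>) + cmod (F \<eta>)))"
  by (rule n2_mono[OF sqint_cost_load_majorant cost_load_measurable])
    (intro AE_I2 cost_load_norm L)

lemma cost_weight_L2_weight:
  "L2_weight M (cost_weight \<mu>1 \<mu>2 \<kappa> L) (\<kappa> / 2) (\<mu>1 / 2 + \<mu>2 / 2 + \<kappa> / 2) (cost_load \<mu>1 \<mu>2 F y1 y2 L)"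
proof
  show "cost_weight \<mu>1 \<mu>2 \<kappa> L \<in> borel_measurable M"
    unfolding cost_weight_def[abs_def] using L by auto
  fix x assume x: "x \<in> space M"
  define r where "r = inverse (1 + L x)"
  have r: "0 \<le> r" "r \<le> 1" using L(2)[OF x] by (auto simp: r_def field_simps)
  then have r2: "0 \<le> r\<^sup>2" "r\<^sup>2 \<le> 1" by (auto simp add: power_le_one)
  show "\<kappa> / 2 \<le> cost_weight \<mu>1 \<mu>2 \<kappa> L x"
    unfolding cost_weight_def r_def[symmetric] using mu r by simp
  have "\<mu>1 / 2 * r \<le> \<mu>1 / 2 * 1" "\<mu>2 / 2 * r\<^sup>2 \<le> \<mu>2 / 2 * 1"
    using mu r r2 by (auto intro!: mult_left_mono simp del: mult_1_right mult.right_neutral)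
  then show "cost_weight \<mu>1 \<mu>2 \<kappa> L x \<le> \<mu>1 / 2 + \<mu>2 / 2 + \<kappa> / 2"
    unfolding cost_weight_def r_def[symmetric] by simp
qed (use mu sqint_cost_load in auto)

end

text \<open>
  The map \<open>t \<mapsto> 1/(1+t)\<close> is Lipschitz on \<open>[0,\<infinity>)\<close> with constant \<open>1\<close>, and its square with constant \<open>2\<close>.
\<close>

lemma cost_weight_diff:
  assumes "0 \<le> La x" "0 \<le> Lb x" "\<bar>La x - Lb x\<bar> \<le> s"
  shows "\<bar>inverse (1 + La x) - inverse (1 + Lb x)\<bar> \<le> s"
    "\<bar>(inverse (1 + La x))\<^sup>2 - (inverse (1 + Lb x))\<^sup>2\<bar> \<le> 2 * s"
    "\<bar>cost_weight \<mu>1 \<mu>2 \<kappa> La x - cost_weight \<mu>1 \<mu>2 \<kappa> Lb x\<bar> \<le> (\<mu>1 / 2 + \<mu>2) * s"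
proof -
  define r1 r2 where "r1 = inverse (1 + La x)" and "r2 = inverse (1 + Lb x)"
  have r: "0 \<le> r1" "r1 \<le> 1" "0 \<le> r2" "r2 \<le> 1"
    using assms by (auto simp: r1_def r2_def field_simps)
  have "r1 - r2 = (Lb x - La x) * (r1 * r2)"
    using assms unfolding r1_def r2_def by (simp add: field_simps)
  then have "\<bar>r1 - r2\<bar> = \<bar>La x - Lb x\<bar> * (r1 * r2)"
    using r by (simp add: abs_mult abs_minus_commute)
  also have "\<dots> \<le> s * 1"
    using assms r by (intro mult_mono) (auto simp: mult_le_one)
  finally have d1: "\<bar>r1 - r2\<bar> \<le> s" by simp
  have "\<bar>r1\<^sup>2 - r2\<^sup>2\<bar> = (r1 + r2) * \<bar>r1 - r2\<bar>"
    using r by (simp add: power2_eq_square square_diff_square_factored abs_mult)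
  also have "\<dots> \<le> 2 * s"
    using d1 r by (intro mult_mono) auto
  finally have d2: "\<bar>r1\<^sup>2 - r2\<^sup>2\<bar> \<le> 2 * s" .
  show "\<bar>inverse (1 + La x) - inverse (1 + Lb x)\<bar> \<le> s"
    "\<bar>(inverse (1 + La x))\<^sup>2 - (inverse (1 + Lb x))\<^sup>2\<bar> \<le> 2 * s"
    using d1 d2 by (simp_all add: r1_def r2_def)
  have "cost_weight \<mu>1 \<mu>2 \<kappa> La x - cost_weight \<mu>1 \<mu>2 \<kappa> Lb x
      = \<mu>1 / 2 * (r1 - r2) + \<mu>2 / 2 * (r1\<^sup>2 - r2\<^sup>2)"
    by (simp add: cost_weight_def r1_def r2_def algebra_simps)
  also have "\<bar>\<dots>\<bar> \<le> \<mu>1 / 2 * \<bar>r1 - r2\<bar> + \<mu>2 / 2 * \<bar>r1\<^sup>2 - r2\<^sup>2\<bar>"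
    by (rule order_trans[OF abs_triangle_ineq]) (use mu in \<open>simp add: abs_mult\<close>)
  also have "\<dots> \<le> \<mu>1 / 2 * s + \<mu>2 / 2 * (2 * s)"
    using mu d1 d2 by (intro add_mono mult_left_mono) auto
  finally show "\<bar>cost_weight \<mu>1 \<mu>2 \<kappa> La x - cost_weight \<mu>1 \<mu>2 \<kappa> Lb x\<bar> \<le> (\<mu>1 / 2 + \<mu>2) * s"
    by (simp add: algebra_simps)
qed

lemma cost_load_diff:
  assumes "0 \<le> La x" "0 \<le> Lb x" "\<bar>La x - Lb x\<bar> \<le> s"
  shows "norm (cost_load \<mu>1 \<mu>2 F y1 y2 La x - cost_load \<mu>1 \<mu>2 F y1 y2 Lb x)
    \<le> s * norm (\<mu>1 / 2 * cmod (F x) + \<mu>2 / 2 * (cmod (y2 x) + 2 * cmod (F x)))"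
proof -
  define r1 r2 where "r1 = inverse (1 + La x)" and "r2 = inverse (1 + Lb x)"
  have d: "\<bar>r1 - r2\<bar> \<le> s" "\<bar>r1\<^sup>2 - r2\<^sup>2\<bar> \<le> 2 * s"
    using cost_weight_diff(1,2)[where La=La and Lb=Lb and x=x and s=s, OF assms] by (simp_all add: r1_def r2_def)
  have "cost_load \<mu>1 \<mu>2 F y1 y2 La x - cost_load \<mu>1 \<mu>2 F y1 y2 Lb x =
     - ((\<mu>1 / 2 * (r1 - r2)) *\<^sub>R F x) + ((\<mu>2 / 2) *\<^sub>R ((r1 - r2) *\<^sub>R y2 x - (r1\<^sup>2 - r2\<^sup>2) *\<^sub>R F x))"
    by (simp add: cost_load_def r1_def r2_def algebra_simps)
  also have "norm \<dots> \<le> \<mu>1 / 2 * (\<bar>r1 - r2\<bar> * cmod (F x)) +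
      \<mu>2 / 2 * norm ((r1 - r2) *\<^sub>R y2 x - (r1\<^sup>2 - r2\<^sup>2) *\<^sub>R F x)"
    by (rule order_trans[OF norm_triangle_ineq]) (use mu in \<open>simp add: abs_mult\<close>)
  also have "\<dots> \<le> \<mu>1 / 2 * (s * cmod (F x)) + \<mu>2 / 2 * (s * cmod (y2 x) + (2 * s) * cmod (F x))"
  proof (intro add_mono mult_left_mono mult_right_mono d)
    have "norm ((r1 - r2) *\<^sub>R y2 x - (r1\<^sup>2 - r2\<^sup>2) *\<^sub>R F x)
        \<le> \<bar>r1 - r2\<bar> * cmod (y2 x) + \<bar>r1\<^sup>2 - r2\<^sup>2\<bar> * cmod (F x)"
      by (rule order_trans[OF norm_triangle_ineq4]) simp
    also have "\<dots> \<le> s * cmod (y2 x) + (2 * s) * cmod (F x)"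
      by (intro add_mono mult_right_mono d) auto
    finally show "norm ((r1 - r2) *\<^sub>R y2 x - (r1\<^sup>2 - r2\<^sup>2) *\<^sub>R F x) \<le> \<dots>" .
  qed (use mu in auto)
  also have "\<dots> = s * (\<mu>1 / 2 * cmod (F x) + \<mu>2 / 2 * (cmod (y2 x) + 2 * cmod (F x)))"
    by (simp add: algebra_simps)
  finally show ?thesis using mu by simp
qed

lemma sqint_load_diff_majorant:
  "sqint M (\<lambda>x. \<mu>1 / 2 * cmod (F x) + \<mu>2 / 2 * (cmod (y2 x) + 2 * cmod (F x)))"
  using sqint_add[OF sqint_scaleR[OF sqint_norm[OF sq(1)], of "\<mu>1 / 2"]
      sqint_scaleR[OF sqint_add[OF sqint_norm[OF sq(3)] sqint_scaleR[OF sqint_norm[OF sq(1)], of 2]], of "\<mu>2 / 2"]]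
  by simp

end

text \<open>
  The additive constant is the cost at \<open>v = 0\<close>; it is finite because \<open>L\<close> is bounded on \<open>K\<close>.
\<close>

lemma cost_eq_quad:
  fixes K :: "(real^'n) set"
  assumes mu: "\<mu>1 \<ge> 0" "\<mu>2 \<ge> 0" "\<kappa> > 0" and K: "K \<in> sets lebesgue"
    and sq: "sqint (lebesgue_on K) F" "sqint (lebesgue_on K) y1" "sqint (lebesgue_on K) y2"
    and L: "L \<in> borel_measurable (lebesgue_on K)" "\<And>x. x \<in> K \<Longrightarrow> 0 \<le> L x" "\<And>x. x \<in> K \<Longrightarrow> L x \<le> B"
  shows "\<exists>c. \<forall>v. sqint (lebesgue_on K) v \<longrightarrow>
    cost \<mu>1 \<mu>2 \<kappa> K F y1 y2 L v =
      quad (lebesgue_on K) (cost_weight \<mu>1 \<mu>2 \<kappa> L) (cost_load \<mu>1 \<mu>2 F y1 y2 L) v + c"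
proof -
  let ?M = "lebesgue_on K"
  have sp: "space ?M = K" by simp
  interpret W: L2_weight ?M "cost_weight \<mu>1 \<mu>2 \<kappa> L" "\<kappa> / 2" "\<mu>1 / 2 + \<mu>2 / 2 + \<kappa> / 2" "cost_load \<mu>1 \<mu>2 F y1 y2 L"
    by (rule cost_weight_L2_weight[OF mu sq L(1)]) (use L(2) in simp)
  have [measurable]: "F \<in> borel_measurable ?M" "y1 \<in> borel_measurable ?M" "y2 \<in> borel_measurable ?M"
    "L \<in> borel_measurable ?M"
    using sq L by (auto simp: sqint_def)
  define e where "e = (\<lambda>y v \<eta>. (F \<eta> + v \<eta>) / complex_of_real (1 + L \<eta>) - y \<eta>)"
  have se: "sqint ?M (e y v)" if v: "sqint ?M v" and y: "sqint ?M y" for v y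
    unfolding e_def
  proof (intro sqint_diff y)
    have s: "sqint ?M (\<lambda>\<eta>. F \<eta> + v \<eta>)" by (intro sqint_add sq v)
    have [measurable]: "v \<in> borel_measurable ?M" using v by (simp add: sqint_def)
    show "sqint ?M (\<lambda>\<eta>. (F \<eta> + v \<eta>) / complex_of_real (1 + L \<eta>))"
    proof (rule sqint_dominated[OF s])
      show "AE \<eta> in ?M. norm ((F \<eta> + v \<eta>) / complex_of_real (1 + L \<eta>)) \<le> norm (F \<eta> + v \<eta>)"
      proof (intro AE_I2)
        fix \<eta> assume "\<eta> \<in> space ?M"
        then have "0 \<le> L \<eta>" using L(2) by simp
        then show "norm ((F \<eta> + v \<eta>) / complex_of_real (1 + L \<eta>)) \<le> norm (F \<eta> + v \<eta>)"
          by (simp add: norm_divide divide_le_eq mult_left_le_one_le mult_le_cancel_left1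
              norm_of_real del: of_real_add)
      qed
    qed measurable
  qed
  have ie: "integrable ?M (\<lambda>\<eta>. (cmod (e y v \<eta>))\<^sup>2)" if "sqint ?M v" "sqint ?M y" for v y
    using se[OF that] by (simp add: sqint_def)
  have ieD: "integrable ?M (\<lambda>\<eta>. (cmod (e y v \<eta>))\<^sup>2 * (1 + L \<eta>))" if "sqint ?M v" "sqint ?M y" for v y
  proof (rule Bochner_Integration.integrable_bound)
    show "integrable ?M (\<lambda>\<eta>. (cmod (e y v \<eta>))\<^sup>2 * (1 + B))" using ie[OF that] by simp
    have [measurable]: "e y v \<in> borel_measurable ?M" using se[OF that] by (simp add: sqint_def)
    show "(\<lambda>\<eta>. (cmod (e y v \<eta>))\<^sup>2 * (1 + L \<eta>)) \<in> borel_measurable ?M" by measurable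
    show "AE \<eta> in ?M. norm ((cmod (e y v \<eta>))\<^sup>2 * (1 + L \<eta>)) \<le> norm ((cmod (e y v \<eta>))\<^sup>2 * (1 + B))"
    proof (intro AE_I2)
      fix \<eta> assume "\<eta> \<in> space ?M"
      then have "0 \<le> L \<eta>" "L \<eta> \<le> B" using L by auto
      then show "norm ((cmod (e y v \<eta>))\<^sup>2 * (1 + L \<eta>)) \<le> norm ((cmod (e y v \<eta>))\<^sup>2 * (1 + B))"
        by (auto simp: abs_mult intro!: mult_left_mono)
    qed
  qed
  have set_int: "(LINT \<eta>:K|lebesgue. g \<eta>) = integral\<^sup>L ?M g" for g :: "_ \<Rightarrow> real"
    using K by (simp add: set_lebesgue_integral_def integral_restrict_space)
  let ?d0 = "\<lambda>\<eta>. \<mu>1 / 2 * ((cmod (e y1 (\<lambda>_. 0) \<eta>))\<^sup>2 * (1 + L \<eta>)) + \<mu>2 / 2 * (cmod (e y2 (\<lambda>_. 0) \<eta>))\<^sup>2"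
  have "cost \<mu>1 \<mu>2 \<kappa> K F y1 y2 L v =
      quad ?M (cost_weight \<mu>1 \<mu>2 \<kappa> L) (cost_load \<mu>1 \<mu>2 F y1 y2 L) v + integral\<^sup>L ?M ?d0"
    if v: "sqint ?M v" for v
  proof -
    have iv: "integrable ?M (\<lambda>\<eta>. (cmod (v \<eta>))\<^sup>2)" using v by (simp add: sqint_def)
    have id0: "integrable ?M ?d0"
      by (intro Bochner_Integration.integrable_add integrable_mult_right ie ieD sq) simp_all
    have iq: "integrable ?M (\<lambda>\<eta>. (cost_weight \<mu>1 \<mu>2 \<kappa> L \<eta> *\<^sub>R v \<eta>) \<bullet> v \<eta>)"
      by (intro sqint_inner W.sqint_weighted v)
    have ib: "integrable ?M (\<lambda>\<eta>. cost_load \<mu>1 \<mu>2 F y1 y2 L \<eta> \<bullet> v \<eta>)"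
      by (intro sqint_inner W.b_sqint v)
    have "cost \<mu>1 \<mu>2 \<kappa> K F y1 y2 L v =
        \<mu>1 / 2 * (\<integral>\<eta>. (cmod (e y1 v \<eta>))\<^sup>2 * (1 + L \<eta>) \<partial>?M) +
        \<mu>2 / 2 * (\<integral>\<eta>. (cmod (e y2 v \<eta>))\<^sup>2 \<partial>?M) + \<kappa> / 2 * (\<integral>\<eta>. (cmod (v \<eta>))\<^sup>2 \<partial>?M)"
      unfolding cost_def set_int e_def ..
    also have "\<dots> = (\<integral>\<eta>. \<mu>1 / 2 * ((cmod (e y1 v \<eta>))\<^sup>2 * (1 + L \<eta>)) +
       \<mu>2 / 2 * (cmod (e y2 v \<eta>))\<^sup>2 + \<kappa> / 2 * (cmod (v \<eta>))\<^sup>2 \<partial>?M)"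
      using ieD[OF v sq(2)] ie[OF v sq(3)] iv by simp
    also have "\<dots> = (\<integral>\<eta>. (cost_weight \<mu>1 \<mu>2 \<kappa> L \<eta> *\<^sub>R v \<eta>) \<bullet> v \<eta>
        - 2 * (cost_load \<mu>1 \<mu>2 F y1 y2 L \<eta> \<bullet> v \<eta>) + ?d0 \<eta> \<partial>?M)"
    proof (rule Bochner_Integration.integral_cong[OF refl])
      fix \<eta> assume "\<eta> \<in> space ?M"
      then have "1 + L \<eta> > 0" using L(2)[of \<eta>] by simp
      from cost_density[OF this, of \<mu>1 "F \<eta>" "v \<eta>" "y1 \<eta>" \<mu>2 "y2 \<eta>" \<kappa>]
      show "\<mu>1 / 2 * ((cmod (e y1 v \<eta>))\<^sup>2 * (1 + L \<eta>)) +
       \<mu>2 / 2 * (cmod (e y2 v \<eta>))\<^sup>2 + \<kappa> / 2 * (cmod (v \<eta>))\<^sup>2 = (cost_weight \<mu>1 \<mu>2 \<kappa> L \<eta> *\<^sub>R v \<eta>) \<bullet> v \<eta>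
        - 2 * (cost_load \<mu>1 \<mu>2 F y1 y2 L \<eta> \<bullet> v \<eta>) + ?d0 \<eta>"
        unfolding e_def cost_weight_def cost_load_def inner_scaleR_left add_0_right .
    qed
    also have "\<dots> = quad ?M (cost_weight \<mu>1 \<mu>2 \<kappa> L) (cost_load \<mu>1 \<mu>2 F y1 y2 L) v + integral\<^sup>L ?M ?d0"
      unfolding quad_def ip_def
      by (subst Bochner_Integration.integral_add[OF _ id0])
        (use iq ib in \<open>auto simp del: inner_scaleR_left\<close>)
    finally show ?thesis .
  qed
  then show ?thesis by blast
qed

section \<open>Lattice, unit cells and characters\<close>

definition lattice :: "(real^'n) set" where
  "lattice = {k. \<forall>i. k $ i \<in> \<int>}"

definition unit_cell :: "real^'n \<Rightarrow> (real^'n) set" where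
  "unit_cell t = {y. \<forall>i. t $ i \<le> y $ i \<and> y $ i < t $ i + 1}"

lemma vec_nth_borel [measurable]: "(\<lambda>x::real^'n. x $ i) \<in> borel_measurable borel"
  by (intro borel_measurable_continuous_onI continuous_intros)

lemma countable_lattice: "countable (lattice :: (real^'n) set)"
proof -
  have eq: "(lattice :: (real^'n) set) = (\<lambda>f::'n \<Rightarrow> int. (\<chi> i. real_of_int (f i))) ` UNIV" (is "_ = ?g ` _")
  proof (intro set_eqI iffI)
    fix k :: "real^'n" assume "k \<in> lattice"
    then have "k = ?g (\<lambda>i. \<lfloor>k $ i\<rfloor>)" by (simp add: lattice_def vec_eq_iff)
    then show "k \<in> ?g ` UNIV" by (intro image_eqI[where x="\<lambda>i. \<lfloor>k $ i\<rfloor>"]) auto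
  qed (auto simp: lattice_def)
  show ?thesis unfolding eq by (rule countable_image) (rule countableI_type)
qed

lemma lattice_diff: "k \<in> lattice \<Longrightarrow> l \<in> lattice \<Longrightarrow> k - l \<in> lattice"
  by (simp add: lattice_def)

lemma lattice_add: "k \<in> lattice \<Longrightarrow> l \<in> lattice \<Longrightarrow> k + l \<in> lattice"
  by (simp add: lattice_def)

lemma lattice_uminus: "k \<in> lattice \<Longrightarrow> - k \<in> lattice"
  by (simp add: lattice_def)

lemma zero_lattice: "0 \<in> lattice"
  by (simp add: lattice_def)

lemma unit_cell_borel [measurable]: "unit_cell t \<in> sets borel"
proof -
  have "unit_cell t = (\<Inter>i\<in>UNIV. {y. t $ i \<le> y $ i \<and> y $ i < t $ i + 1})"
    by (auto simp: unit_cell_def)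
  also have "\<dots> \<in> sets borel"
    by (intro sets.finite_INT) auto
  finally show ?thesis .
qed

lemma lattice_translate_unique: "\<exists>!k. k \<in> lattice \<and> x + k \<in> unit_cell t"
proof
  let ?k = "\<chi> i. - real_of_int \<lfloor>x $ i - t $ i\<rfloor>"
  show "?k \<in> lattice \<and> x + ?k \<in> unit_cell t"
    unfolding lattice_def unit_cell_def
    by (auto simp: algebra_simps) (linarith+)
  fix k assume k: "k \<in> lattice \<and> x + k \<in> unit_cell t"
  have "k $ i = - real_of_int \<lfloor>x $ i - t $ i\<rfloor>" for i
  proof -
    obtain m where m: "k $ i = real_of_int m" using k by (auto simp: lattice_def elim: Ints_cases)
    have "t $ i \<le> x $ i + m" "x $ i + m < t $ i + 1" using k unfolding m[symmetric] by (simp_all add: unit_cell_def)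
    then have "\<lfloor>x $ i - t $ i\<rfloor> = - m" by linarith
    then show ?thesis using m by simp
  qed
  then show "k = ?k" by (simp add: vec_eq_iff)
qed

lemma lattice_partition:
  "(\<integral>\<^sup>+k. indicator (unit_cell t) (x + k) \<partial>count_space lattice) = (1::ennreal)"
proof -
  obtain k0 where k0: "k0 \<in> lattice" "x + k0 \<in> unit_cell t" using lattice_translate_unique by blast
  have "(\<integral>\<^sup>+k. indicator (unit_cell t) (x + k) \<partial>count_space lattice) =
      (\<integral>\<^sup>+k. indicator {k0} k \<partial>count_space lattice)"
    using lattice_translate_unique[of x t] k0 by (intro nn_integral_cong) (auto simp: indicator_def)
  also have "\<dots> = 1" using k0 by simp
  finally show ?thesis .
qed

lemma nn_integral_translate:
  assumes [measurable]: "F \<in> borel_measurable borel"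
  shows "(\<integral>\<^sup>+x. F (x + k) \<partial>lborel) = (\<integral>\<^sup>+x. F (x::'a::euclidean_space) \<partial>lborel)"
proof -
  have "(\<integral>\<^sup>+x. F x \<partial>lborel) = (\<integral>\<^sup>+x. F x \<partial>distr lborel borel ((+) k))"
    by (simp add: lborel_distr_plus)
  also have "\<dots> = (\<integral>\<^sup>+x. F (k + x) \<partial>lborel)"
    by (intro nn_integral_distr) auto
  finally show ?thesis by (simp add: add.commute)
qed

text \<open>
  Every point has exactly one lattice translate in the cell, so the indicators of the translated
  cells form a partition of unity that can be inserted under the integral.
\<close>

lemma nn_integral_unfold:
  fixes F :: "real^'n \<Rightarrow> ennreal"
  assumes [measurable]: "F \<in> borel_measurable borel"
  shows "(\<integral>\<^sup>+x. F x \<partial>lborel) =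
    (\<integral>\<^sup>+k. (\<integral>\<^sup>+y. F (y - k) * indicator (unit_cell t) y \<partial>lborel) \<partial>count_space lattice)"
proof -
  have "(\<integral>\<^sup>+x. F x \<partial>lborel) =
      (\<integral>\<^sup>+x. (\<integral>\<^sup>+k. F x * indicator (unit_cell t) (x + k) \<partial>count_space lattice) \<partial>lborel)"
    by (subst nn_integral_cmult) (simp_all add: lattice_partition)
  also have "\<dots> = (\<integral>\<^sup>+k. (\<integral>\<^sup>+x. F x * indicator (unit_cell t) (x + k) \<partial>lborel) \<partial>count_space lattice)"
    by (intro nn_integral_count_space_nn_integral countable_lattice) measurable
  also have "\<dots> = (\<integral>\<^sup>+k. (\<integral>\<^sup>+y. F (y - k) * indicator (unit_cell t) y \<partial>lborel) \<partial>count_space lattice)"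
  proof (rule nn_integral_cong)
    fix k :: "real^'n"
    show "(\<integral>\<^sup>+x. F x * indicator (unit_cell t) (x + k) \<partial>lborel)
        = (\<integral>\<^sup>+y. F (y - k) * indicator (unit_cell t) y \<partial>lborel)"
      by (subst nn_integral_translate[where k=k, symmetric]) auto
  qed
  finally show ?thesis .
qed

text \<open>
  Unfolding \<open>F\<close> restricted to the cell at \<open>s\<close> over the cell at \<open>t\<close> recovers each value of \<open>F\<close> once.
\<close>

lemma periodic_nn_integral_cell:
  fixes F :: "real^'n \<Rightarrow> ennreal"
  assumes [measurable]: "F \<in> borel_measurable borel" and per: "\<And>k y. k \<in> lattice \<Longrightarrow> F (y + k) = F y"
  shows "(\<integral>\<^sup>+x. F x * indicator (unit_cell s) x \<partial>lborel) = (\<integral>\<^sup>+x. F x * indicator (unit_cell t) x \<partial>lborel)"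
proof -
  have "(\<integral>\<^sup>+x. F x * indicator (unit_cell s) x \<partial>lborel) = (\<integral>\<^sup>+k. (\<integral>\<^sup>+y. F (y - k) *
      indicator (unit_cell s) (y - k) * indicator (unit_cell t) y \<partial>lborel) \<partial>count_space lattice)"
    by (subst nn_integral_unfold[where t=t]) auto
  also have "\<dots> = (\<integral>\<^sup>+k. (\<integral>\<^sup>+y. F y *
      indicator (unit_cell s) (y - k) * indicator (unit_cell t) y \<partial>lborel) \<partial>count_space lattice)"
    using per[OF lattice_uminus] by (intro nn_integral_cong) auto
  also have "\<dots> = (\<integral>\<^sup>+y. (\<integral>\<^sup>+k. F y * indicator (unit_cell t) y *
      indicator (unit_cell s) (y - k) \<partial>count_space lattice) \<partial>lborel)"
    by (subst nn_integral_count_space_nn_integral[OF countable_lattice]) (auto simp: ac_simps)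
  also have "\<dots> = (\<integral>\<^sup>+y. F y * indicator (unit_cell t) y *
      (\<integral>\<^sup>+k. indicator (unit_cell s) (y - k) \<partial>count_space lattice) \<partial>lborel)"
    by (subst nn_integral_cmult) auto
  also have "(\<lambda>y::real^'n. \<integral>\<^sup>+k. indicator (unit_cell s) (y - k) \<partial>count_space lattice) = (\<lambda>_. 1::ennreal)"
  proof -
    have b: "bij_betw uminus lattice (lattice :: (real^'n) set)"
      by (rule bij_betwI[where g=uminus]) (auto simp: lattice_uminus)
    show ?thesis
      using nn_integral_bij_count_space[OF b, of "\<lambda>k. indicator (unit_cell s) (y + k)" for y]
      by (simp add: lattice_partition fun_eq_iff)
  qed
  finally show ?thesis by simp
qed

lemma unit_cell_box: "box t (\<chi> i. t $ i + 1) \<subseteq> unit_cell t" "unit_cell t \<subseteq> cbox t (\<chi> i. t $ i + 1)"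
  by (auto simp: unit_cell_def mem_box_cart less_imp_le)

lemma emeasure_unit_box:
  fixes t :: "real^'n"
  shows "emeasure lborel (cbox t (\<chi> i. t $ i + 1)) = 1" "emeasure lborel (box t (\<chi> i. t $ i + 1)) = 1"
proof -
  have b: "((\<chi> i. t $ i + 1) - t) \<bullet> b = 1" if "b \<in> Basis" for b :: "real^'n"
    using that by (auto simp: Basis_vec_def inner_axis)
  then have "t \<bullet> b \<le> (\<chi> i. t $ i + 1) \<bullet> b" if "b \<in> Basis" for b :: "real^'n"
    using that by (simp add: inner_diff_left algebra_simps)
  then show "emeasure lborel (cbox t (\<chi> i. t $ i + 1)) = 1" "emeasure lborel (box t (\<chi> i. t $ i + 1)) = 1"
    by (simp_all add: emeasure_lborel_cbox emeasure_lborel_box b)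
qed

lemma emeasure_unit_cell [simp]: "emeasure lborel (unit_cell t) = 1"
proof (rule antisym)
  show "emeasure lborel (unit_cell t) \<le> 1"
    using emeasure_mono[OF unit_cell_box(2), of t lborel] by (simp add: emeasure_unit_box)
  show "1 \<le> emeasure lborel (unit_cell t)"
    using emeasure_mono[OF unit_cell_box(1), of t lborel] by (simp add: emeasure_unit_box)
qed

lemma Zcell_unit_cell: "Zcell = unit_cell (\<chi> i. - 1/2)"
  by (auto simp: Zcell_def unit_cell_def)

lemma AE_unit_cell_interior:
  fixes t :: "real^'n"
  shows "AE x in lborel. x \<in> cbox t (\<chi> i. t $ i + 1) \<longrightarrow> x \<in> box t (\<chi> i. t $ i + 1)"
proof -
  have "emeasure lborel (cbox t (\<chi> i. t $ i + 1) - box t (\<chi> i. t $ i + 1)) = 0"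
    by (subst emeasure_Diff) (auto simp: emeasure_unit_box box_subset_cbox)
  then have "AE x in lborel. x \<notin> cbox t (\<chi> i. t $ i + 1) - box t (\<chi> i. t $ i + 1)"
    by (intro AE_not_in) (auto simp: null_sets_def)
  then show ?thesis by (auto elim: eventually_mono)
qed

lemma Ycell_cbox: "Ycell = cbox 0 (\<chi> i. (0::real^'n) $ i + 1)"
  by (auto simp: Ycell_def mem_box_cart)

lemma AE_Ycell: "AE x in lborel. x \<in> (Ycell :: (real^'n) set) \<longleftrightarrow> x \<in> unit_cell 0"
  using AE_unit_cell_interior[of "0::real^'n"] unit_cell_box[of "0::real^'n"]
  unfolding Ycell_cbox by (auto elim: eventually_mono)

definition char :: "real^'n \<Rightarrow> real^'n \<Rightarrow> complex" where
  "char k \<eta> = cis (2 * pi * (\<eta> \<bullet> k))"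

lemma char_mult: "char k \<eta> * char l \<eta> = char (k + l) \<eta>"
  by (simp add: char_def cis_mult inner_add_right distrib_left)

lemma cnj_char: "cnj (char k \<eta>) = char (- k) \<eta>"
  by (simp add: char_def cis_cnj)

lemma norm_char [simp]: "cmod (char k \<eta>) = 1"
  by (simp add: char_def)

lemma char_measurable [measurable]: "char k \<in> borel_measurable borel"
  unfolding char_def[abs_def] by (intro borel_measurable_continuous_onI continuous_intros)

lemma char_0 [simp]: "char 0 \<eta> = 1"
  by (simp add: char_def)

lemma lattice_inner_Ints: "k \<in> lattice \<Longrightarrow> l \<in> lattice \<Longrightarrow> k \<bullet> l \<in> \<int>"
  by (auto simp: lattice_def inner_vec_def)

lemma char_periodic: "k \<in> lattice \<Longrightarrow> l \<in> lattice \<Longrightarrow> char k (\<eta> + l) = char k \<eta>"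
proof -
  assume a: "k \<in> lattice" "l \<in> lattice"
  then obtain m where "l \<bullet> k = of_int m" using lattice_inner_Ints Ints_cases by metis
  then show ?thesis
    by (simp add: char_def inner_add_left distrib_left flip: cis_mult)
qed

abbreviation Zmeas :: "(real^'n) measure" where
  "Zmeas \<equiv> restrict_space lborel Zcell"

lemma Zcell_borel [measurable]: "Zcell \<in> sets borel"
  by (simp add: Zcell_unit_cell)

lemma emeasure_Zmeas: "emeasure Zmeas Zcell = 1"
  by (simp add: Zcell_unit_cell emeasure_restrict_space space_restrict_space)

lemma finite_measure_Zmeas: "finite_measure Zmeas"
  by (rule finite_measureI) (simp add: emeasure_Zmeas space_restrict_space)

lemma integrable_char [simp]: "integrable Zmeas (char k)"
  by (rule finite_measure.integrable_const_bound[OF finite_measure_Zmeas, where B=1])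
     (auto intro: measurable_restrict_space1)

text \<open>
  Translation by \<open>s = k/(2|k|\<^sup>2)\<close> flips the sign of the character, but moves the cell to another unit
  cell and so preserves the integral. Invariance is available for nonnegative functions, whence the
  detour through \<open>1 \<plusminus> Re\<close> and \<open>1 \<plusminus> Im\<close>.
\<close>

lemma integral_char:
  fixes k :: "real^'n"
  assumes k: "k \<in> lattice"
  shows "(\<integral>\<eta>. char k \<eta> \<partial>Zmeas) = (if k = 0 then 1 else 0)"
proof (cases "k = 0")
  case True
  have "measure Zmeas (Zcell :: (real^'n) set) = 1" by (simp add: measure_def emeasure_Zmeas)
  with True show ?thesis by (simp add: space_restrict_space)
next
  case False
  \<comment> \<open>Half a period in the direction of \<open>k\<close>.\<close>
  define s where "s = (1 / (2 * (k \<bullet> k))) *\<^sub>R k"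
  have sk: "s \<bullet> k = 1/2" using False by (simp add: s_def)
  have flip: "char k (\<eta> + s) = - char k \<eta>" for \<eta>
  proof -
    have "2 * pi * ((\<eta> + s) \<bullet> k) = 2 * pi * (\<eta> \<bullet> k) + pi"
      using sk by (simp add: inner_add_left algebra_simps)
    then show ?thesis unfolding char_def by (simp add: minus_cis)
  qed
  have key: "(\<integral>\<eta>. f (char k \<eta>) \<partial>Zmeas) = 0"
    if f: "f = Re \<or> f = Im" for f
  proof -
    have fl: "f (- z) = - f z" "\<bar>f z\<bar> \<le> cmod z" for z
      using f by (auto simp: abs_Re_le_cmod abs_Im_le_cmod)
    have [measurable]: "f \<in> borel_measurable borel" using f by auto
    have int: "integrable Zmeas (\<lambda>\<eta>. f (char k \<eta>))"
      using f integrable_Re[OF integrable_char] integrable_Im[OF integrable_char] by auto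
    have one: "integrable Zmeas (\<lambda>_. 1::real)"
      by (rule finite_measure.integrable_const[OF finite_measure_Zmeas])
    have nn: "(\<integral>\<^sup>+\<eta>. ennreal (1 + c * f (char k \<eta>)) * indicator (unit_cell t) \<eta> \<partial>lborel)
        = ennreal (\<integral>\<eta>. 1 + c * f (char k \<eta>) \<partial>Zmeas)" if c: "\<bar>c\<bar> = 1" and t: "t = (\<chi> i. - 1/2)" for c t
    proof -
      have "0 \<le> 1 + c * f (char k \<eta>)" for \<eta>
        using fl(2)[of "char k \<eta>"] c by (cases "c \<ge> 0") auto
      then have "ennreal (\<integral>\<eta>. 1 + c * f (char k \<eta>) \<partial>Zmeas) = (\<integral>\<^sup>+\<eta>. ennreal (1 + c * f (char k \<eta>)) \<partial>Zmeas)"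
        using int one by (intro nn_integral_eq_integral[symmetric]) auto
      also have "\<dots> = (\<integral>\<^sup>+\<eta>. ennreal (1 + c * f (char k \<eta>)) * indicator (unit_cell t) \<eta> \<partial>lborel)"
        by (subst nn_integral_restrict_space) (auto simp: t Zcell_unit_cell)
      finally show ?thesis by simp
    qed
    define t :: "real^'n" where "t = (\<chi> i. - 1/2)"
    have "(\<integral>\<^sup>+\<eta>. ennreal (1 + 1 * f (char k \<eta>)) * indicator (unit_cell t) \<eta> \<partial>lborel)
        = (\<integral>\<^sup>+\<eta>. ennreal (1 + 1 * f (char k \<eta>)) * indicator (unit_cell (t + s)) \<eta> \<partial>lborel)"
      by (intro periodic_nn_integral_cell) (auto simp: char_periodic k)
    also have "\<dots> = (\<integral>\<^sup>+\<eta>. ennreal (1 + 1 * f (char k (\<eta> + s))) * indicator (unit_cell (t + s)) (\<eta> + s) \<partial>lborel)"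
      by (subst nn_integral_translate[where k=s, symmetric]) auto
    also have "\<dots> = (\<integral>\<^sup>+\<eta>. ennreal (1 + (-1) * f (char k \<eta>)) * indicator (unit_cell t) \<eta> \<partial>lborel)"
      by (intro nn_integral_cong) (auto simp: flip fl unit_cell_def indicator_def)
    finally have "ennreal (\<integral>\<eta>. 1 + 1 * f (char k \<eta>) \<partial>Zmeas) = ennreal (\<integral>\<eta>. 1 + (-1) * f (char k \<eta>) \<partial>Zmeas)"
      using nn[of 1 t, OF _ t_def] nn[of "-1" t, OF _ t_def] by simp
    moreover have "0 \<le> (\<integral>\<eta>. 1 + c * f (char k \<eta>) \<partial>Zmeas)" if "\<bar>c\<bar> = 1" for c
    proof (rule Bochner_Integration.integral_nonneg)
      fix \<eta>
      show "0 \<le> 1 + c * f (char k \<eta>)"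
        using fl(2)[of "char k \<eta>"] that by (cases "c \<ge> 0") auto
    qed
    from this[of 1] this[of "-1"] have "0 \<le> (\<integral>\<eta>. 1 + 1 * f (char k \<eta>) \<partial>Zmeas)"
      "0 \<le> (\<integral>\<eta>. 1 + (-1) * f (char k \<eta>) \<partial>Zmeas)" by auto
    ultimately have "(\<integral>\<eta>. 1 + 1 * f (char k \<eta>) \<partial>Zmeas) = (\<integral>\<eta>. 1 + (-1) * f (char k \<eta>) \<partial>Zmeas)"
      by simp
    then show ?thesis
      using Bochner_Integration.integral_add[OF one int] Bochner_Integration.integral_diff[OF one int] by simp
  qed
  have "Re (\<integral>\<eta>. char k \<eta> \<partial>Zmeas) = 0" "Im (\<integral>\<eta>. char k \<eta> \<partial>Zmeas) = 0"
    using key[of Re] key[of Im] by (simp_all add: integral_Re integral_Im)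
  then show ?thesis using False by (simp add: complex_eq_iff)
qed

section \<open>Fourier series on the cube\<close>

lemma n2_dominated_tendsto:
  assumes f: "\<And>j::nat. f j \<in> borel_measurable M" and v: "v \<in> borel_measurable M"
    and lim: "AE x in M. (\<lambda>j. f j x) \<longlonglongrightarrow> v x"
    and g: "sqint M g" and dom: "\<And>j. AE x in M. norm (f j x - v x) \<le> norm (g x)"
  shows "(\<lambda>j. n2 M (\<lambda>x. f j x - v x)) \<longlonglongrightarrow> 0"
proof -
  have "(\<lambda>j. \<integral>x. (norm (f j x - v x))\<^sup>2 \<partial>M) \<longlonglongrightarrow> (\<integral>x. 0 \<partial>M)"
  proof (rule integral_dominated_convergence)
    show "integrable M (\<lambda>x. (norm (g x))\<^sup>2)" using g by (simp add: sqint_def)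
    show "AE x in M. (\<lambda>j. (norm (f j x - v x))\<^sup>2) \<longlonglongrightarrow> 0"
      using lim
    proof eventually_elim
      case (elim x)
      then have "(\<lambda>j. (norm (f j x - v x))\<^sup>2) \<longlonglongrightarrow> (norm (v x - v x))\<^sup>2"
        by (intro tendsto_intros)
      then show ?case by simp
    qed
    show "AE x in M. norm ((norm (f j x - v x))\<^sup>2) \<le> (norm (g x))\<^sup>2" for j
      using dom[of j] by eventually_elim (simp add: power_mono)
  qed (use f v in auto)
  then have "(\<lambda>j. sqrt (\<integral>x. (norm (f j x - v x))\<^sup>2 \<partial>M)) \<longlonglongrightarrow> sqrt 0"
    by (intro tendsto_intros) simp
  then show ?thesis by (simp add: n2_def)
qed

lemma space_Zmeas [simp]: "space Zmeas = Zcell"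
  by (simp add: space_restrict_space)

lemma AE_Zmeas_iff: "(AE x in Zmeas. P x) \<longleftrightarrow> (AE x in lborel. x \<in> Zcell \<longrightarrow> P x)"
  by (rule AE_restrict_space_iff) auto

lemma n2_Zmeas_le:
  fixes f :: "real^'n \<Rightarrow> 'b::euclidean_space"
  assumes "f \<in> borel_measurable Zmeas" "\<And>x. x \<in> Zcell \<Longrightarrow> norm (f x) \<le> c" "0 \<le> c"
  shows "sqint Zmeas f" "n2 Zmeas f \<le> c"
proof -
  have "(\<integral>\<^sup>+x. ennreal ((norm (f x))\<^sup>2) \<partial>Zmeas) \<le> (\<integral>\<^sup>+x. ennreal (c\<^sup>2) \<partial>(Zmeas :: (real^'n) measure))"
    using assms by (intro nn_integral_mono ennreal_leI power_mono) auto
  also have "\<dots> = ennreal (c\<^sup>2)" by (simp add: emeasure_Zmeas)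
  finally show "sqint Zmeas f" "n2 Zmeas f \<le> c"
    using sqintI_nn[OF assms(1) _ assms(3)] by auto
qed

lemma sqint_continuous_Zmeas:
  fixes \<psi> :: "real^'n \<Rightarrow> complex"
  assumes \<psi>: "continuous_on UNIV \<psi>"
  shows "sqint Zmeas \<psi>"
proof -
  have "compact (cbox (\<chi> i. - 1/2) (\<chi> i. 1/2) :: (real^'n) set)" by (rule compact_cbox)
  then have "bounded (\<psi> ` cbox (\<chi> i. - 1/2) (\<chi> i. 1/2))"
    using \<psi> by (intro compact_imp_bounded compact_continuous_image) (auto intro: continuous_on_subset)
  then obtain b where b: "\<And>x. x \<in> cbox (\<chi> i. - 1/2) (\<chi> i. 1/2) \<Longrightarrow> norm (\<psi> x) \<le> b"
    unfolding bounded_iff by blast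
  have sub: "Zcell \<subseteq> (cbox (\<chi> i. - 1/2) (\<chi> i. 1/2) :: (real^'n) set)"
    by (auto simp: Zcell_def mem_box_cart less_imp_le)
  show ?thesis
  proof (rule n2_Zmeas_le[where c="\<bar>b\<bar>"])
    show "norm (\<psi> x) \<le> \<bar>b\<bar>" if "x \<in> Zcell" for x
      using b[of x] sub that by (meson abs_ge_self order_trans subsetD)
    show "\<psi> \<in> borel_measurable Zmeas"
      using borel_measurable_continuous_onI[OF \<psi>] by (intro measurable_restrict_space1) auto
  qed simp
qed

subsection \<open>Density of continuous functions vanishing near the boundary\<close>

text \<open>
  A measurable function is an almost everywhere limit of continuous ones. Projecting their values
  onto the ball of radius \<open>B\<close> and multiplying by cutoffs that increase to the indicator of the open
  cube keeps continuity and the limit, and makes dominated convergence applicable.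
\<close>

lemma continuous_dense_bounded:
  fixes f :: "real^'n \<Rightarrow> complex"
  assumes f: "f \<in> borel_measurable Zmeas" and B: "\<And>x. x \<in> Zcell \<Longrightarrow> norm (f x) \<le> B" "0 \<le> B"
    and e: "e > 0"
  shows "\<exists>\<psi>. continuous_on UNIV \<psi> \<and> (\<forall>x. x \<notin> box (\<chi> i. - 1/2) (\<chi> i. 1/2) \<longrightarrow> \<psi> x = 0)
           \<and> n2 Zmeas (\<lambda>x. \<psi> x - f x) < e"
proof -
  let ?O = "box (\<chi> i. - 1/2) (\<chi> i. 1/2) :: (real^'n) set"
  have "(\<lambda>x. indicator Zcell x *\<^sub>R f x) \<in> borel_measurable lborel"
    using f by (subst (asm) borel_measurable_restrict_space_iff) auto
  then have "(\<lambda>x. indicator Zcell x *\<^sub>R f x) \<in> borel_measurable (lebesgue_on UNIV)"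
    by (simp add: measurable_completion lebesgue_on_UNIV_eq)
  then have "(\<lambda>x. indicator Zcell x *\<^sub>R f x) measurable_on UNIV"
    by (subst measurable_on_iff_borel_measurable) auto
  then obtain N g where N: "negligible N" and g: "\<And>n::nat. continuous_on UNIV (g n)"
    and lim: "\<And>x. x \<notin> N \<Longrightarrow> (\<lambda>n. g n x) \<longlonglongrightarrow> indicator Zcell x *\<^sub>R f x"
    unfolding measurable_on_def by auto
  \<comment> \<open>Values are projected onto the ball, which is a continuous operation fixing the values of \<open>f\<close>.\<close>
  define c where "c = closest_point (cball (0::complex) B)"
  have cball: "convex (cball (0::complex) B)" "closed (cball (0::complex) B)" "cball (0::complex) B \<noteq> {}"
    using B(2) by auto
  have ccont: "continuous_on UNIV c"
    unfolding c_def using cball by (intro continuous_on_closest_point)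
  have cB: "norm (c z) \<le> B" for z
    using closest_point_in_set[OF cball(2,3), of z] by (simp add: c_def)
  have cid: "c z = z" if "norm z \<le> B" for z
    using that unfolding c_def by (intro closest_point_self) simp
  define ch where "ch = (\<lambda>n x. min 1 (real n * infdist x (- ?O)))"
  have cne: "- ?O \<noteq> {}" using bounded_box[of "\<chi> i. - 1/2" "(\<chi> i. 1/2) :: real^'n"]
    by (metis Compl_empty_eq compl_bot_eq double_complement not_bounded_UNIV)
  define \<psi> where "\<psi> = (\<lambda>n x. ch n x *\<^sub>R c (g n x))"
  have \<psi>cont: "continuous_on UNIV (\<psi> n)" for n
    unfolding \<psi>_def ch_def
    by (intro continuous_intros continuous_on_compose2[OF ccont] g) auto
  have \<psi>0: "\<psi> n x = 0" if "x \<notin> ?O" for n x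
    using that by (simp add: \<psi>_def ch_def)
  have ch_bds: "0 \<le> ch n x" "ch n x \<le> 1" for n x by (auto simp: ch_def infdist_nonneg)
  have \<psi>B: "norm (\<psi> n x) \<le> B" for n x
  proof -
    have "ch n x * norm (c (g n x)) \<le> 1 * B" using ch_bds cB by (intro mult_mono) auto
    then show ?thesis using ch_bds by (simp add: \<psi>_def)
  qed
  have \<psi>m: "\<psi> n \<in> borel_measurable Zmeas" for n
    using borel_measurable_continuous_onI[OF \<psi>cont] by (intro measurable_restrict_space1) auto
  have \<psi>lim: "(\<lambda>n. \<psi> n x) \<longlonglongrightarrow> f x" if x: "x \<in> ?O" "x \<in> Zcell" "x \<notin> N" for x
  proof -
    have "infdist x (- ?O) > 0"
      using x(1) cne infdist_pos_not_in_closed[of "- ?O" x] by (simp add: open_box closed_Compl)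
    then obtain n0 where "1 < real n0 * infdist x (- ?O)" using ex_less_of_nat_mult by blast
    then have "1 \<le> real n * infdist x (- ?O)" if "n \<ge> n0" for n
      using that mult_right_mono[of "real n0" "real n" "infdist x (- ?O)"] infdist_nonneg[of x "- ?O"] by simp
    then have "eventually (\<lambda>n. ch n x = 1) sequentially"
      unfolding eventually_sequentially ch_def by (intro exI[of _ n0]) auto
    then have 1: "(\<lambda>n. ch n x) \<longlonglongrightarrow> 1" by (rule tendsto_eventually)
    have "(\<lambda>n. c (g n x)) \<longlonglongrightarrow> c (f x)"
      using lim[OF x(3)] x(2) continuous_on_tendsto_compose[OF ccont] by simp
    then have "(\<lambda>n. c (g n x)) \<longlonglongrightarrow> f x" using cid B(1)[OF x(2)] by simp
    from tendsto_scaleR[OF 1 this] show ?thesis by (simp add: \<psi>_def)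
  qed
  have "AE x in lborel. x \<in> Zcell \<longrightarrow> x \<in> ?O"
    using AE_unit_cell_interior[of "\<chi> i. - 1/2 :: real^'n"]
      unit_cell_box(2)[of "\<chi> i. - 1/2 :: real^'n"]
    by (auto simp: Zcell_unit_cell elim!: eventually_mono)
  moreover have "AE x in lborel. x \<notin> N"
  proof -
    have "AE x in lebesgue. x \<notin> N" using N by (intro AE_not_in) (simp add: negligible_iff_null_sets)
    then show ?thesis by (simp add: AE_completion_iff)
  qed
  ultimately have "AE x in Zmeas. (\<lambda>n. \<psi> n x) \<longlonglongrightarrow> f x"
    unfolding AE_Zmeas_iff by eventually_elim (use \<psi>lim in auto)
  then have "(\<lambda>n. n2 Zmeas (\<lambda>x. \<psi> n x - f x)) \<longlonglongrightarrow> 0"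
  proof (rule n2_dominated_tendsto[OF \<psi>m f])
    show "sqint Zmeas (\<lambda>x::real^'n. 2 * B)" using B(2) by (intro n2_Zmeas_le[where c="2 * B"]) auto
    show "AE x in Zmeas. norm (\<psi> j x - f x) \<le> norm (2 * B)" for j
    proof (rule AE_I2)
      fix x :: "real^'n" assume "x \<in> space Zmeas"
      then have "norm (f x) \<le> B" using B by simp
      then show "norm (\<psi> j x - f x) \<le> norm (2 * B)"
        using norm_triangle_ineq4[of "\<psi> j x" "f x"] \<psi>B[of j x] B(2) by simp
    qed
  qed
  then have "eventually (\<lambda>n. n2 Zmeas (\<lambda>x. \<psi> n x - f x) < e) sequentially"
    using e by (rule order_tendstoD)
  then obtain n where "n2 Zmeas (\<lambda>x. \<psi> n x - f x) < e"
    by (auto simp: eventually_sequentially)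
  then show ?thesis using \<psi>cont[of n] \<psi>0 by blast
qed

lemma continuous_dense:
  fixes f :: "real^'n \<Rightarrow> complex"
  assumes f: "sqint Zmeas f" and e: "e > 0"
  shows "\<exists>\<psi>. continuous_on UNIV \<psi> \<and> (\<forall>x. x \<notin> box (\<chi> i. - 1/2) (\<chi> i. 1/2) \<longrightarrow> \<psi> x = 0)
           \<and> n2 Zmeas (\<lambda>x. \<psi> x - f x) < e"
proof -
  have [measurable]: "f \<in> borel_measurable Zmeas" using f by (simp add: sqint_def)
  define t where "t = (\<lambda>j x. if norm (f x) \<le> real j then f x else 0)"
  have [measurable]: "t j \<in> borel_measurable Zmeas" for j unfolding t_def by measurable
  have tle: "norm (t j x) \<le> real j" for j x by (simp add: t_def)
  have "(\<lambda>j. n2 Zmeas (\<lambda>x. t j x - f x)) \<longlonglongrightarrow> 0"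
  proof (rule n2_dominated_tendsto[OF _ _ _ f])
    show "AE x in Zmeas. (\<lambda>j. t j x) \<longlonglongrightarrow> f x"
    proof (rule AE_I2)
      fix x
      obtain j0 :: nat where "norm (f x) \<le> real j0" using real_arch_simple by blast
      then have "eventually (\<lambda>j. t j x = f x) sequentially"
        unfolding eventually_sequentially t_def by (intro exI[of _ j0]) auto
      then show "(\<lambda>j. t j x) \<longlonglongrightarrow> f x" by (rule tendsto_eventually)
    qed
  qed (auto simp: t_def)
  then have "eventually (\<lambda>j. n2 Zmeas (\<lambda>x. t j x - f x) < e / 2) sequentially"
    using e by (intro order_tendstoD) auto
  then obtain j where j: "n2 Zmeas (\<lambda>x. t j x - f x) < e / 2"
    by (auto simp: eventually_sequentially)
  have st: "sqint Zmeas (t j)" by (intro n2_Zmeas_le[where c="real j"]) (use tle in auto)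
  obtain \<psi> where \<psi>: "continuous_on UNIV \<psi>" "\<forall>x. x \<notin> box (\<chi> i. - 1/2) (\<chi> i. 1/2) \<longrightarrow> \<psi> x = 0"
    "n2 Zmeas (\<lambda>x. \<psi> x - t j x) < e / 2"
    using continuous_dense_bounded[of "t j" "real j" "e/2"] tle e by auto
  from n2_triangle3[OF sqint_continuous_Zmeas[OF \<psi>(1)] st f] \<psi>(3) j have "n2 Zmeas (\<lambda>x. \<psi> x - f x) < e" by simp
  with \<psi> show ?thesis by blast
qed

subsection \<open>Trigonometric polynomials\<close>

inductive trig_poly :: "(real^'n \<Rightarrow> complex) \<Rightarrow> bool" where
  char: "k \<in> lattice \<Longrightarrow> trig_poly (char k)"
| add: "trig_poly p \<Longrightarrow> trig_poly q \<Longrightarrow> trig_poly (\<lambda>\<eta>. p \<eta> + q \<eta>)"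
| scale: "trig_poly p \<Longrightarrow> trig_poly (\<lambda>\<eta>. c * p \<eta>)"

lemma trig_poly_mult:
  assumes "trig_poly p" "trig_poly q"
  shows "trig_poly (\<lambda>\<eta>. p \<eta> * q \<eta>)"
  using assms(1)
proof induction
  case (char k)
  show ?case
    using assms(2)
  proof induction
    case (char l)
    then show ?case using trig_poly.char[OF lattice_add[OF \<open>k \<in> lattice\<close> char]] by (simp add: char_mult)
  next
    case (add p q)
    then show ?case using trig_poly.add[OF add.IH] by (simp add: distrib_left)
  next
    case (scale p c)
    then show ?case using trig_poly.scale[OF scale.IH, of c] by (simp add: mult.left_commute)
  qed
next
  case (add p q)
  then show ?case using trig_poly.add[OF add.IH] by (simp add: distrib_right)
next
  case (scale p c)
  then show ?case using trig_poly.scale[OF scale.IH, of c] by (simp add: mult.assoc)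
qed

lemma trig_poly_const: "trig_poly (\<lambda>\<eta>. c)"
  using trig_poly.scale[OF trig_poly.char[OF zero_lattice], of c] by simp

lemma trig_poly_sum: "finite I \<Longrightarrow> (\<And>i. i \<in> I \<Longrightarrow> trig_poly (p i)) \<Longrightarrow> trig_poly (\<lambda>\<eta>. \<Sum>i\<in>I. p i \<eta>)"
  by (induction I rule: finite_induct) (auto intro: trig_poly.add trig_poly_const)

definition torus_map :: "real^'n \<Rightarrow> complex^'n" where
  "torus_map \<eta> = (\<chi> i. cis (2 * pi * \<eta> $ i))"

lemma continuous_torus_map: "continuous_on S torus_map"
  unfolding torus_map_def by (intro continuous_intros)

lemma char_axis: "char (axis i 1) \<eta> = cis (2 * pi * \<eta> $ i)"
  by (simp add: char_def inner_axis)

lemma axis_lattice: "axis i 1 \<in> lattice"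
  by (auto simp: lattice_def axis_def)

lemma trig_poly_torus:
  "trig_poly (\<lambda>\<eta>. complex_of_real (Re (torus_map \<eta> $ i)))"
  "trig_poly (\<lambda>\<eta>. complex_of_real (Im (torus_map \<eta> $ i)))"
proof -
  have 1: "trig_poly (char (axis i 1))" "trig_poly (char (- axis i 1))"
    by (auto intro!: trig_poly.char lattice_uminus axis_lattice)
  have r: "complex_of_real (Re (torus_map \<eta> $ i)) = (1/2) * char (axis i 1) \<eta> + (1/2) * char (- axis i 1) \<eta>" for \<eta>
    by (simp add: torus_map_def char_axis complex_eq_iff flip: cnj_char)
  have im: "complex_of_real (Im (torus_map \<eta> $ i)) = (-\<i>/2) * char (axis i 1) \<eta> + (\<i>/2) * char (- axis i 1) \<eta>" for \<eta>
    by (simp add: torus_map_def char_axis complex_eq_iff flip: cnj_char)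
  show "trig_poly (\<lambda>\<eta>. complex_of_real (Re (torus_map \<eta> $ i)))"
    "trig_poly (\<lambda>\<eta>. complex_of_real (Im (torus_map \<eta> $ i)))"
    unfolding r im by (intro trig_poly.add trig_poly.scale 1)+
qed

text \<open>
  A real linear functional of \<open>torus_map \<eta>\<close> is a combination of the cosines and sines of the
  coordinates, so polynomials in it are trigonometric polynomials.
\<close>

lemma trig_poly_real_polynomial:
  "real_polynomial_function p \<Longrightarrow> trig_poly (\<lambda>\<eta>. complex_of_real (p (torus_map \<eta>)))"
proof (induction p rule: real_polynomial_function.induct)
  case (linear f)
  interpret bounded_linear f by fact
  have e: "torus_map \<eta> = (\<Sum>i\<in>UNIV. Re (torus_map \<eta> $ i) *\<^sub>R axis i 1 + Im (torus_map \<eta> $ i) *\<^sub>R axis i \<i>)" for \<eta> :: "real^'a"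
    by (simp add: vec_eq_iff axis_def if_distrib[of "\<lambda>x. _ *\<^sub>R x"] sum.distrib complex_eq_iff cong: if_cong)
  have "f (torus_map \<eta>) = (\<Sum>i\<in>UNIV. Re (torus_map \<eta> $ i) * f (axis i 1) + Im (torus_map \<eta> $ i) * f (axis i \<i>))" for \<eta>
    by (subst e) (simp add: sum add scaleR)
  then have "complex_of_real (f (torus_map \<eta>)) = (\<Sum>i\<in>UNIV. of_real (f (axis i 1)) * of_real (Re (torus_map \<eta> $ i))
      + of_real (f (axis i \<i>)) * of_real (Im (torus_map \<eta> $ i)))" for \<eta>
    by (simp add: mult.commute)
  then show ?case
    by (simp only:) (intro trig_poly_sum trig_poly.add trig_poly.scale trig_poly_torus finite)
next
  case (const c)
  show ?case by (rule trig_poly_const)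
next
  case (add f g)
  then show ?case using trig_poly.add[OF add.IH] by simp
next
  case (mult f g)
  then show ?case using trig_poly_mult[OF mult.IH] by simp
qed

text \<open>
  On a compact set a continuous map is closed, so a continuous function that is constant on its
  fibres descends to a continuous function on the image.
\<close>

lemma continuous_factor_compact:
  fixes E :: "'a::metric_space \<Rightarrow> 'b::metric_space" and \<psi> :: "'a \<Rightarrow> 'c::metric_space"
  assumes S: "compact S" and E: "continuous_on S E" and \<psi>: "continuous_on S \<psi>"
    and eq: "\<And>x y. x \<in> S \<Longrightarrow> y \<in> S \<Longrightarrow> E x = E y \<Longrightarrow> \<psi> x = \<psi> y"
  shows "\<exists>\<phi>. continuous_on (E ` S) \<phi> \<and> (\<forall>x\<in>S. \<phi> (E x) = \<psi> x)"
proof -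
  define \<phi> where "\<phi> = (\<lambda>z. \<psi> (SOME x. x \<in> S \<and> E x = z))"
  have \<phi>: "\<phi> (E x) = \<psi> x" if "x \<in> S" for x
  proof -
    have "(SOME y. y \<in> S \<and> E y = E x) \<in> S \<and> E (SOME y. y \<in> S \<and> E y = E x) = E x"
      by (rule someI[of "\<lambda>y. y \<in> S \<and> E y = E x" x]) (simp add: that)
    then show ?thesis unfolding \<phi>_def using eq[OF _ that] by simp
  qed
  have "continuous_on (E ` S) \<phi>"
  proof (subst continuous_on_closed_invariant, intro allI impI)
    fix B :: "'c set" assume "closed B"
    then have "closedin (top_of_set S) (S \<inter> \<psi> -` B)"
      using \<psi> by (intro continuous_closedin_preimage)
    then have "compact (S \<inter> \<psi> -` B)"
      using S by (rule closedin_compact[rotated])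
    then have "compact (E ` (S \<inter> \<psi> -` B))"
      using E by (intro compact_continuous_image) (auto intro: continuous_on_subset)
    then have "closed (E ` (S \<inter> \<psi> -` B))" by (rule compact_imp_closed)
    moreover have "E ` (S \<inter> \<psi> -` B) \<inter> E ` S = \<phi> -` B \<inter> E ` S"
      using \<phi> by auto
    ultimately show "\<exists>A. closed A \<and> A \<inter> E ` S = \<phi> -` B \<inter> E ` S" by blast
  qed
  with \<phi> show ?thesis by blast
qed

text \<open>
  Points of the closed cube with the same image differ by an integer in each coordinate, hence lie on
  opposite faces if they are distinct.
\<close>

lemma torus_map_eq:
  assumes "\<eta> \<in> cbox (\<chi> i. - 1/2) (\<chi> i. 1/2)" "\<zeta> \<in> cbox (\<chi> i. - 1/2) (\<chi> i. 1/2)"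
    "torus_map \<eta> = torus_map \<zeta>" "\<eta> \<noteq> \<zeta>"
  shows "\<eta> \<notin> box (\<chi> i. - 1/2) (\<chi> i. 1/2) \<and> \<zeta> \<notin> box (\<chi> i. - 1/2) (\<chi> i. 1/2)"
proof -
  obtain i where i: "\<eta> $ i \<noteq> \<zeta> $ i" using assms(4) by (auto simp: vec_eq_iff)
  have "cis (2 * pi * \<eta> $ i) = cis (2 * pi * \<zeta> $ i)"
    using assms(3) by (simp add: torus_map_def vec_eq_iff)
  then have "cis (2 * pi * \<eta> $ i) / cis (2 * pi * \<zeta> $ i) = 1" by simp
  then have "cis (2 * pi * (\<eta> $ i - \<zeta> $ i)) = 1" by (simp add: cis_divide algebra_simps)
  then have "cos (2 * pi * (\<eta> $ i - \<zeta> $ i)) = 1" by (metis cis.simps(1) one_complex.simps(1))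
  then obtain m :: int where "2 * pi * (\<eta> $ i - \<zeta> $ i) = of_int m * 2 * pi"
    by (auto simp: cos_one_2pi_int)
  then have m: "\<eta> $ i - \<zeta> $ i = of_int m" by simp
  have b: "-1/2 \<le> \<eta> $ i" "\<eta> $ i \<le> 1/2" "-1/2 \<le> \<zeta> $ i" "\<zeta> $ i \<le> 1/2"
    using assms(1,2) by (auto simp: mem_box_cart dest: spec[of _ i])
  have "real_of_int m \<le> 1" "real_of_int m \<ge> -1" "real_of_int m \<noteq> 0"
    using m i b by linarith+
  then have "m = 1 \<or> m = -1" by linarith
  with m b have "\<eta> $ i \<in> {-1/2, 1/2}" "\<zeta> $ i \<in> {-1/2, 1/2}" by auto
  then have "\<not> (- 1/2 < \<eta> $ i \<and> \<eta> $ i < 1/2)" "\<not> (- 1/2 < \<zeta> $ i \<and> \<zeta> $ i < 1/2)" by auto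
  then show ?thesis unfolding mem_box_cart by auto
qed

text \<open>
  A function vanishing on the boundary of the cube descends to the torus, where the theorem of Stone
  and Weierstrass applies.
\<close>

lemma trig_poly_uniform:
  fixes \<psi> :: "real^'n \<Rightarrow> complex"
  assumes \<psi>: "continuous_on UNIV \<psi>" "\<forall>x. x \<notin> box (\<chi> i. - 1/2) (\<chi> i. 1/2) \<longrightarrow> \<psi> x = 0" and e: "e > 0"
  shows "\<exists>p. trig_poly p \<and> (\<forall>x\<in>Zcell. norm (\<psi> x - p x) \<le> e)"
proof -
  let ?S = "cbox (\<chi> i. - 1/2) (\<chi> i. 1/2) :: (real^'n) set"
  have "\<exists>\<phi>. continuous_on (torus_map ` ?S) \<phi> \<and> (\<forall>x\<in>?S. \<phi> (torus_map x) = \<psi> x)"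
  proof (rule continuous_factor_compact)
    show "continuous_on ?S \<psi>" using \<psi>(1) by (rule continuous_on_subset) auto
    show "\<psi> x = \<psi> y" if "x \<in> ?S" "y \<in> ?S" "torus_map x = torus_map y" for x y
      using torus_map_eq[OF that] \<psi>(2) by (cases "x = y") auto
  qed (auto simp: continuous_torus_map compact_cbox)
  then obtain \<phi> where \<phi>: "continuous_on (torus_map ` ?S) \<phi>" "\<And>x. x \<in> ?S \<Longrightarrow> \<phi> (torus_map x) = \<psi> x"
    by blast
  have "compact (torus_map ` ?S)"
    by (intro compact_continuous_image continuous_torus_map compact_cbox)
  from Stone_Weierstrass_polynomial_function[OF this \<phi>(1) e] obtain g where
    g: "polynomial_function g" "\<And>z. z \<in> torus_map ` ?S \<Longrightarrow> norm (\<phi> z - g z) < e" by blast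
  define p where "p = (\<lambda>\<eta>. g (torus_map \<eta>))"
  have "real_polynomial_function (Re \<circ> g)" "real_polynomial_function (Im \<circ> g)"
    using g(1) bounded_linear_Re bounded_linear_Im unfolding polynomial_function_def by auto
  then have 1: "trig_poly (\<lambda>\<eta>. complex_of_real (Re (g (torus_map \<eta>))))"
    "trig_poly (\<lambda>\<eta>. complex_of_real (Im (g (torus_map \<eta>))))"
    by (auto dest: trig_poly_real_polynomial)
  have "p \<eta> = complex_of_real (Re (g (torus_map \<eta>))) + \<i> * complex_of_real (Im (g (torus_map \<eta>)))" for \<eta>
    unfolding p_def by (rule complex_eq)
  then have "p = (\<lambda>\<eta>. complex_of_real (Re (g (torus_map \<eta>))) + \<i> * complex_of_real (Im (g (torus_map \<eta>))))" ..
  then have "trig_poly p" by (simp only:) (intro trig_poly.add trig_poly.scale 1)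
  moreover have "norm (\<psi> x - p x) \<le> e" if "x \<in> Zcell" for x
  proof -
    have "x \<in> ?S" using that by (auto simp: Zcell_def mem_box_cart less_imp_le)
    then show ?thesis using g(2)[of "torus_map x"] \<phi>(2)[of x] by (auto simp: p_def)
  qed
  ultimately show ?thesis by blast
qed

lemma trig_poly_measurable: "trig_poly p \<Longrightarrow> p \<in> borel_measurable borel"
  by (induction rule: trig_poly.induct) auto

lemma trig_poly_dense:
  fixes f :: "real^'n \<Rightarrow> complex"
  assumes f: "sqint Zmeas f" and e: "e > 0"
  shows "\<exists>p. trig_poly p \<and> n2 Zmeas (\<lambda>x. p x - f x) < e"
proof -
  obtain \<psi> where \<psi>: "continuous_on UNIV \<psi>" "\<forall>x. x \<notin> box (\<chi> i. - 1/2) (\<chi> i. 1/2) \<longrightarrow> \<psi> x = 0"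
    "n2 Zmeas (\<lambda>x. \<psi> x - f x) < e / 2"
    using continuous_dense[OF f, of "e/2"] e by auto
  obtain p where p: "trig_poly p" "\<And>x. x \<in> Zcell \<Longrightarrow> norm (\<psi> x - p x) \<le> e / 2"
    using trig_poly_uniform[OF \<psi>(1,2), of "e/2"] e by auto
  have [measurable]: "\<psi> \<in> borel_measurable Zmeas" "p \<in> borel_measurable Zmeas" "f \<in> borel_measurable Zmeas"
    using borel_measurable_continuous_onI[OF \<psi>(1)] trig_poly_measurable[OF p(1)] f
    by (auto simp: sqint_def intro: measurable_restrict_space1)
  have 1: "sqint Zmeas (\<lambda>x. p x - \<psi> x)" "n2 Zmeas (\<lambda>x. p x - \<psi> x) \<le> e / 2"
    using p(2) e by (auto intro!: n2_Zmeas_le[where c="e/2"] simp: norm_minus_commute[of "p _"] simp del: le_divide_eq_numeral1)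
  have 2: "n2 Zmeas (\<lambda>x. (p x - \<psi> x) - (f x - \<psi> x)) \<le> n2 Zmeas (\<lambda>x. p x - \<psi> x) + n2 Zmeas (\<lambda>x. f x - \<psi> x)"
    by (intro n2_triangle_diff 1(1) sqint_diff f sqint_continuous_Zmeas \<psi>(1))
  have "n2 Zmeas (\<lambda>x. p x - f x) < e"
    using 1(2) 2 \<psi>(3) by (simp add: n2_minus_commute[of Zmeas f])
  with p(1) show ?thesis by blast
qed

subsection \<open>Parseval's identity\<close>

definition fcoeff :: "(real^'n \<Rightarrow> complex) \<Rightarrow> real^'n \<Rightarrow> complex" where
  "fcoeff f k = (\<integral>\<eta>. f \<eta> * cnj (char k \<eta>) \<partial>Zmeas)"

lemma sqint_char [simp]: "sqint Zmeas (char k)"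
  by (rule n2_Zmeas_le[where c=1]) (auto intro: measurable_restrict_space1)

lemma sqint_mult_integrable:
  fixes f g :: "'a \<Rightarrow> complex"
  assumes "sqint M f" "sqint M g"
  shows "integrable M (\<lambda>x. f x * cnj (g x))" "integrable M (\<lambda>x. f x * g x)"
proof -
  have [measurable]: "f \<in> borel_measurable M" "g \<in> borel_measurable M"
    using assms by (auto simp: sqint_def)
  have [measurable]: "cnj \<in> borel_measurable borel"
    by (intro borel_measurable_continuous_onI continuous_intros)
  show "integrable M (\<lambda>x. f x * cnj (g x))" "integrable M (\<lambda>x. f x * g x)"
    by (auto intro!: Bochner_Integration.integrable_bound[OF sqint_norm_mult[OF assms]] simp: norm_mult)
qed

lemma ip_scaled_char:
  assumes "sqint Zmeas g"
  shows "ip Zmeas (\<lambda>\<eta>. c * char k \<eta>) g = Re (c * cnj (fcoeff g k))"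
proof -
  have i: "integrable Zmeas (\<lambda>\<eta>. g \<eta> * cnj (char k \<eta>))"
    by (intro sqint_mult_integrable assms sqint_char)
  have "ip Zmeas (\<lambda>\<eta>. c * char k \<eta>) g = (\<integral>\<eta>. Re (cnj c * (g \<eta> * cnj (char k \<eta>))) \<partial>Zmeas)"
    unfolding ip_def by (intro Bochner_Integration.integral_cong) (auto simp: inner_complex_def algebra_simps)
  also have "\<dots> = Re (cnj c * fcoeff g k)"
    unfolding fcoeff_def using i by (subst integral_Re) auto
  also have "\<dots> = Re (c * cnj (fcoeff g k))"
    by (simp add: algebra_simps)
  finally show ?thesis .
qed

lemma ip_trig_sum:
  assumes "finite F" "sqint Zmeas g"
  shows "ip Zmeas (\<lambda>\<eta>. \<Sum>k\<in>F. c k * char k \<eta>) g = (\<Sum>k\<in>F. Re (c k * cnj (fcoeff g k)))"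
  using assms(1)
proof (induction F rule: finite_induct)
  case empty
  then show ?case by (simp add: ip_def)
next
  case (insert k F)
  then have "ip Zmeas (\<lambda>\<eta>. c k * char k \<eta> + (\<Sum>k\<in>F. c k * char k \<eta>)) g =
     ip Zmeas (\<lambda>\<eta>. c k * char k \<eta>) g + ip Zmeas (\<lambda>\<eta>. \<Sum>k\<in>F. c k * char k \<eta>) g"
    by (intro ip_add(2) assms sqint_sum sqint_cmult sqint_char) auto
  with insert show ?case by (simp add: ip_scaled_char[OF assms(2)])
qed

lemma fcoeff_trig_sum:
  assumes "finite F" "F \<subseteq> lattice" "l \<in> lattice"
  shows "fcoeff (\<lambda>\<eta>. \<Sum>k\<in>F. c k * char k \<eta>) l = (if l \<in> F then c l else 0)"
proof -
  have "fcoeff (\<lambda>\<eta>. \<Sum>k\<in>F. c k * char k \<eta>) l = (\<integral>\<eta>. (\<Sum>k\<in>F. c k * char (k - l) \<eta>) \<partial>Zmeas)"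
    unfolding fcoeff_def by (simp add: sum_distrib_right mult.assoc cnj_char char_mult)
  also have "\<dots> = (\<Sum>k\<in>F. c k * (\<integral>\<eta>. char (k - l) \<eta> \<partial>Zmeas))"
    by (subst Bochner_Integration.integral_sum) auto
  also have "\<dots> = (\<Sum>k\<in>F. if l = k then c k else 0)"
    using assms by (intro sum.cong refl, subst integral_char) (auto intro!: lattice_diff)
  also have "\<dots> = (if l \<in> F then c l else 0)" using assms(1) by simp
  finally show ?thesis .
qed

text \<open>
  Pythagoras for the orthonormal characters: the best coefficients are the Fourier coefficients.
  Choosing them gives Bessel's inequality, and an approximation with any other coefficients bounds
  the deficit.
\<close>

lemma n2_trig_approx:
  assumes f: "sqint Zmeas f" and F: "finite F" "F \<subseteq> lattice"
  shows "(n2 Zmeas (\<lambda>\<eta>. (\<Sum>k\<in>F. c k * char k \<eta>) - f \<eta>))\<^sup>2 =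
    (n2 Zmeas f)\<^sup>2 - (\<Sum>k\<in>F. (cmod (fcoeff f k))\<^sup>2) + (\<Sum>k\<in>F. (cmod (c k - fcoeff f k))\<^sup>2)"
proof -
  let ?T = "\<lambda>\<eta>. \<Sum>k\<in>F. c k * char k \<eta>"
  have T: "sqint Zmeas ?T" using F by (intro sqint_sum sqint_cmult sqint_char)
  have "(n2 Zmeas ?T)\<^sup>2 = (\<Sum>k\<in>F. Re (c k * cnj (c k)))"
    unfolding n2_sq_ip ip_trig_sum[OF F(1) T]
    using F by (intro sum.cong) (auto simp: fcoeff_trig_sum subset_iff)
  then have "(n2 Zmeas (\<lambda>\<eta>. ?T \<eta> - f \<eta>))\<^sup>2 = (n2 Zmeas f)\<^sup>2 +
      (\<Sum>k\<in>F. Re (c k * cnj (c k)) - 2 * Re (c k * cnj (fcoeff f k)))"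
    unfolding n2_diff_sq[OF T f] ip_trig_sum[OF F(1) f] sum_subtractf sum_distrib_left by simp
  also have "\<dots> = (n2 Zmeas f)\<^sup>2 + (\<Sum>k\<in>F. (cmod (c k - fcoeff f k))\<^sup>2 - (cmod (fcoeff f k))\<^sup>2)"
    by (intro arg_cong2[where f="(+)"] sum.cong refl)
      (simp add: cmod_power2, simp add: power2_eq_square algebra_simps)
  finally show ?thesis by (simp add: sum_subtractf)
qed

lemma trig_poly_sum_form:
  "trig_poly p \<Longrightarrow> \<exists>F c. finite F \<and> F \<subseteq> lattice \<and> p = (\<lambda>\<eta>. \<Sum>k\<in>F. c k * char k \<eta>)"
proof (induction rule: trig_poly.induct)
  case (char k)
  then show ?case by (intro exI[of _ "{k}"] exI[of _ "\<lambda>_. 1"]) auto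
next
  case (add p q)
  then obtain F c G d where F: "finite F" "F \<subseteq> lattice" "p = (\<lambda>\<eta>. \<Sum>k\<in>F. c k * char k \<eta>)"
    and G: "finite G" "G \<subseteq> lattice" "q = (\<lambda>\<eta>. \<Sum>k\<in>G. d k * char k \<eta>)" by blast
  have "p = (\<lambda>\<eta>. \<Sum>k\<in>F \<union> G. (if k \<in> F then c k else 0) * char k \<eta>)"
    unfolding F(3) using F G by (intro ext sum.mono_neutral_cong_left) auto
  moreover have "q = (\<lambda>\<eta>. \<Sum>k\<in>F \<union> G. (if k \<in> G then d k else 0) * char k \<eta>)"
    unfolding G(3) using F G by (intro ext sum.mono_neutral_cong_left) auto
  ultimately have "(\<lambda>\<eta>. p \<eta> + q \<eta>) =
      (\<lambda>\<eta>. \<Sum>k\<in>F \<union> G. ((if k \<in> F then c k else 0) + (if k \<in> G then d k else 0)) * char k \<eta>)"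
    by (simp add: sum.distrib distrib_right del: Un_iff)
  moreover have "finite (F \<union> G)" "F \<union> G \<subseteq> lattice" using F G by auto
  ultimately show ?case by (intro exI conjI)
next
  case (scale p c)
  then obtain F d where F: "finite F" "F \<subseteq> lattice" "p = (\<lambda>\<eta>. \<Sum>k\<in>F. d k * char k \<eta>)" by blast
  then have "(\<lambda>\<eta>. c * p \<eta>) = (\<lambda>\<eta>. \<Sum>k\<in>F. (c * d k) * char k \<eta>)"
    by (simp add: sum_distrib_left mult.assoc)
  with F(1,2) show ?case by (intro exI[of _ F] exI[of _ "\<lambda>k. c * d k"] conjI)
qed

text \<open>
  The upper bound is Bessel's inequality exhausted over finite sets of frequencies; the lower bound
  holds up to \<open>e\<close> by density of trigonometric polynomials.
\<close>

lemma parseval: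
  fixes f :: "real^'n \<Rightarrow> complex"
  assumes f: "sqint Zmeas f"
  shows "(\<integral>\<^sup>+k. ennreal ((cmod (fcoeff f k))\<^sup>2) \<partial>count_space lattice) = ennreal ((n2 Zmeas f)\<^sup>2)"
proof (rule antisym)
  have bessel: "(\<Sum>k\<in>F. (cmod (fcoeff f k))\<^sup>2) \<le> (n2 Zmeas f)\<^sup>2" if "finite F" "F \<subseteq> lattice" for F
    using n2_trig_approx[OF f that, of "fcoeff f"] zero_le_power2[of "n2 Zmeas (\<lambda>\<eta>. (\<Sum>k\<in>F. fcoeff f k * char k \<eta>) - f \<eta>)"]
    by simp
  let ?g = "\<lambda>k. ennreal ((cmod (fcoeff f k))\<^sup>2)"
  define G :: "nat \<Rightarrow> (real^'n) set" where "G = (\<lambda>j. from_nat_into lattice ` {..<j})"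
  have G: "finite (G j)" "G j \<subseteq> lattice" for j
    using from_nat_into[of "lattice :: (real^'n) set"] zero_lattice by (auto simp: G_def)
  have Gsum: "(\<integral>\<^sup>+k. ?g k * indicator F k \<partial>count_space lattice) = ennreal (\<Sum>k\<in>F. (cmod (fcoeff f k))\<^sup>2)"
    if "finite F" "F \<subseteq> lattice" for F
  proof -
    have "(\<integral>\<^sup>+k. ?g k * indicator F k \<partial>count_space lattice) = (\<integral>\<^sup>+k. ?g k \<partial>count_space F)"
      using that(2) by (subst (1 2) nn_integral_count_space_indicator)
        (auto intro!: nn_integral_cong simp: indicator_def)
    also have "\<dots> = (\<Sum>k\<in>F. ?g k)" using that(1) by (rule nn_integral_count_space_finite)
    finally show ?thesis by simp
  qed
  have sup: "(SUP j. ?g k * indicator (G j) k) = ?g k" if "k \<in> lattice" for k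
  proof (rule antisym)
    show "(SUP j. ?g k * indicator (G j) k) \<le> ?g k"
      by (intro SUP_least) (auto simp: indicator_def)
    from from_nat_into_surj[OF countable_lattice that]
    obtain m where "from_nat_into lattice m = k" ..
    then have "k \<in> G (Suc m)" unfolding G_def by auto
    then show "?g k \<le> (SUP j. ?g k * indicator (G j) k)"
      using SUP_upper[of "Suc m" UNIV "\<lambda>j. ?g k * indicator (G j) k"] by simp
  qed
  have "(\<integral>\<^sup>+k. ?g k \<partial>count_space lattice) = (\<integral>\<^sup>+k. (SUP j. ?g k * indicator (G j) k) \<partial>count_space lattice)"
    using sup by (intro nn_integral_cong) auto
  also have "\<dots> = (SUP j. \<integral>\<^sup>+k. ?g k * indicator (G j) k \<partial>count_space lattice)"
    by (intro nn_integral_monotone_convergence_SUP)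
      (auto simp: incseq_def le_fun_def G_def indicator_def intro: less_le_trans)
  also have "\<dots> \<le> ennreal ((n2 Zmeas f)\<^sup>2)"
    unfolding Gsum[OF G] using bessel[OF G] by (intro SUP_least ennreal_leI)
  finally show "(\<integral>\<^sup>+k. ?g k \<partial>count_space lattice) \<le> ennreal ((n2 Zmeas f)\<^sup>2)" .
  show "ennreal ((n2 Zmeas f)\<^sup>2) \<le> (\<integral>\<^sup>+k. ?g k \<partial>count_space lattice)"
  proof (rule ennreal_le_epsilon)
    fix e :: real assume e: "e > 0"
    obtain p where p: "trig_poly p" "n2 Zmeas (\<lambda>x. p x - f x) < sqrt e"
      using trig_poly_dense[OF f, of "sqrt e"] e by auto
    obtain F c where F: "finite F" "F \<subseteq> lattice" "p = (\<lambda>\<eta>. \<Sum>k\<in>F. c k * char k \<eta>)"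
      using trig_poly_sum_form[OF p(1)] by blast
    have "(n2 Zmeas (\<lambda>x. p x - f x))\<^sup>2 < (sqrt e)\<^sup>2"
      using p(2) by (intro power_strict_mono) auto
    then have "(n2 Zmeas f)\<^sup>2 \<le> (\<Sum>k\<in>F. (cmod (fcoeff f k))\<^sup>2) + e"
      using n2_trig_approx[OF f F(1,2), of c] e sum_nonneg[of F "\<lambda>k. (cmod (c k - fcoeff f k))\<^sup>2"]
      unfolding F(3) by simp
    then have "ennreal ((n2 Zmeas f)\<^sup>2) \<le> ennreal (\<Sum>k\<in>F. (cmod (fcoeff f k))\<^sup>2) + ennreal e"
      using e by (subst ennreal_plus[symmetric]) (auto intro!: ennreal_leI sum_nonneg simp del: ennreal_plus)
    also have "\<dots> \<le> (\<integral>\<^sup>+k. ?g k \<partial>count_space lattice) + ennreal e"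
      unfolding Gsum[OF F(1,2), symmetric]
      by (intro add_mono nn_integral_mono) (auto simp: indicator_def)
    finally show "ennreal ((n2 Zmeas f)\<^sup>2) \<le> (\<integral>\<^sup>+k. ?g k \<partial>count_space lattice) + ennreal e" .
  qed
qed

section \<open>Superpositions of modulated periodic profiles\<close>

lemma nn_integral_scale:
  fixes F :: "'a::euclidean_space \<Rightarrow> ennreal"
  assumes [measurable]: "F \<in> borel_measurable borel" and c: "c \<noteq> 0"
  shows "(\<integral>\<^sup>+x. F x \<partial>lborel) = ennreal (\<bar>c\<bar> ^ DIM('a)) * (\<integral>\<^sup>+x. F (c *\<^sub>R x) \<partial>lborel)"
  by (subst lborel_affine[OF c, of 0])
    (simp add: nn_integral_density nn_integral_distr nn_integral_cmult ennreal_power)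

lemma integral_scale:
  fixes f :: "'a::euclidean_space \<Rightarrow> 'b::{banach, second_countable_topology}"
  assumes [measurable]: "f \<in> borel_measurable borel" and c: "c \<noteq> 0"
  shows "(\<integral>x. f x \<partial>lborel) = (\<bar>c\<bar> ^ DIM('a)) *\<^sub>R (\<integral>x. f (c *\<^sub>R x) \<partial>lborel)"
  by (subst lborel_affine[OF c, of 0])
    (simp add: integral_density integral_distr)

lemma AE_scale:
  fixes Q :: "'a::euclidean_space \<Rightarrow> bool"
  assumes "AE x in lborel. Q x" and c: "c \<noteq> 0"
  shows "AE x in lborel. Q (c *\<^sub>R x)"
proof -
  obtain N where N: "{x. \<not> Q x} \<subseteq> N" "N \<in> null_sets lborel"
    using assms(1) by (auto elim!: AE_E simp: null_sets_def)
  then have [measurable]: "N \<in> sets borel" by auto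
  have "ennreal (\<bar>c\<bar> ^ DIM('a)) * (\<integral>\<^sup>+x. indicator N (c *\<^sub>R x) \<partial>lborel) = (\<integral>\<^sup>+x. indicator N x \<partial>lborel)"
    by (rule nn_integral_scale[symmetric, OF _ c]) measurable
  also have "\<dots> = 0" using N(2) by (simp add: null_sets_def)
  finally have "(\<integral>\<^sup>+x. indicator N (c *\<^sub>R x) \<partial>lborel) = 0"
  proof -
    assume z: "ennreal (\<bar>c\<bar> ^ DIM('a)) * (\<integral>\<^sup>+x. indicator N (c *\<^sub>R x) \<partial>lborel) = 0"
    have "0 < \<bar>c\<bar> ^ DIM('a)" using c by (intro zero_less_power) simp
    then have "ennreal (\<bar>c\<bar> ^ DIM('a)) \<noteq> 0" by (simp only: ennreal_eq_0_iff not_le)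
    with z show ?thesis unfolding mult_eq_0_iff by blast
  qed
  then have "AE x in lborel. (indicator N (c *\<^sub>R x) :: ennreal) = 0"
    by (subst (asm) nn_integral_0_iff_AE) auto
  then show ?thesis
    by eventually_elim (use N(1) in \<open>auto simp: indicator_def split: if_splits\<close>)
qed

lemma finite_lattice_ball: "finite (lattice \<inter> cball 0 r :: (real^'n) set)"
proof -
  let ?I = "{- \<lceil>\<bar>r\<bar>\<rceil> .. \<lceil>\<bar>r\<bar>\<rceil>}"
  have "lattice \<inter> cball 0 r \<subseteq> (\<lambda>f::'n \<Rightarrow> int. (\<chi> i. real_of_int (f i))) ` (PiE UNIV (\<lambda>_. ?I))"
  proof
    fix k :: "real^'n" assume k: "k \<in> lattice \<inter> cball 0 r"
    have "\<lfloor>k $ i\<rfloor> \<in> ?I" for i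
    proof -
      have "\<bar>k $ i\<bar> \<le> \<bar>r\<bar>" using k component_le_norm_cart[of k i] by auto
      then show ?thesis by (auto simp: floor_le_iff le_floor_iff) linarith+
    qed
    moreover have "k = (\<chi> i. real_of_int \<lfloor>k $ i\<rfloor>)" using k by (simp add: lattice_def vec_eq_iff)
    ultimately show "k \<in> (\<lambda>f::'n \<Rightarrow> int. (\<chi> i. real_of_int (f i))) ` (PiE UNIV (\<lambda>_. ?I))"
      by (intro image_eqI[where x="\<lambda>i. \<lfloor>k $ i\<rfloor>"]) auto
  qed
  then show ?thesis by (rule finite_subset) (intro finite_imageI finite_PiE, auto)
qed

lemma Zscaled_borel [measurable]: "Zscaled \<epsilon> \<in> sets borel"
proof -
  have "Zscaled \<epsilon> = (\<lambda>\<eta>. \<epsilon> *\<^sub>R \<eta>) -` Zcell \<inter> space borel" by (auto simp: Zscaled_def)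
  also have "\<dots> \<in> sets borel" by (rule measurable_sets[OF _ Zcell_borel]) measurable
  finally show ?thesis .
qed

lemma Zcell_norm: "\<eta> \<in> Zcell \<Longrightarrow> norm (\<eta>::real^'n) \<le> real CARD('n)"
proof -
  assume a: "\<eta> \<in> Zcell"
  have "norm \<eta> \<le> (\<Sum>i\<in>UNIV. \<bar>\<eta> $ i\<bar>)" by (rule norm_le_l1_cart)
  also have "\<dots> \<le> (\<Sum>i\<in>(UNIV::'n set). 1)"
  proof (intro sum_mono)
    fix i
    have "- 1/2 \<le> \<eta> $ i \<and> \<eta> $ i < 1/2" using a by (simp add: Zcell_def)
    then show "\<bar>\<eta> $ i\<bar> \<le> 1" by linarith
  qed
  finally show ?thesis by simp
qed

lemma Zscaled_finite:
  assumes "\<epsilon> > 0"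
  shows "emeasure lborel (Zscaled \<epsilon> :: (real^'n) set) < \<infinity>"
proof -
  have "bounded (Zscaled \<epsilon> :: (real^'n) set)"
  proof (rule boundedI)
    fix \<eta> :: "real^'n" assume "\<eta> \<in> Zscaled \<epsilon>"
    then have "norm (\<epsilon> *\<^sub>R \<eta>) \<le> real CARD('n)" unfolding Zscaled_def by (intro Zcell_norm) simp
    then show "norm \<eta> \<le> real CARD('n) / \<epsilon>" using assms by (simp add: field_simps)
  qed
  then show ?thesis using emeasure_bounded_finite by simp
qed

lemma sqint_lborel_restrict:
  assumes [measurable]: "S \<in> sets borel" and "h \<in> borel_measurable borel" "\<And>x. x \<notin> S \<Longrightarrow> h x = 0"
  shows "sqint (restrict_space lborel S) h \<longleftrightarrow> sqint lborel h" "n2 (restrict_space lborel S) h = n2 lborel h"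
    "integral\<^sup>L (restrict_space lborel S) h = integral\<^sup>L lborel h"
proof -
  have e: "(\<lambda>x. indicat_real S x *\<^sub>R h x) = h" "(\<lambda>x. indicat_real S x *\<^sub>R (norm (h x))\<^sup>2) = (\<lambda>x. (norm (h x))\<^sup>2)"
    using assms(3) by (auto simp: fun_eq_iff indicator_def)
  have e3: "(\<lambda>x. indicat_real S x * (norm (h x))\<^sup>2) = (\<lambda>x. (norm (h x))\<^sup>2)"
    using e(2) by simp
  show "sqint (restrict_space lborel S) h \<longleftrightarrow> sqint lborel h"
    using assms by (simp add: sqint_def integrable_restrict_space borel_measurable_restrict_space_iff e(1) e3)
  show "n2 (restrict_space lborel S) h = n2 lborel h"
    by (simp add: n2_def integral_restrict_space e del: real_scaleR_def)
  show "integral\<^sup>L (restrict_space lborel S) h = integral\<^sup>L lborel h"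
    by (simp add: integral_restrict_space e)
qed

lemma cball_borel [measurable]: "cball (x::'a::euclidean_space) r \<in> sets borel"
  by (intro borel_closed closed_cball)

text \<open>
  What the argument uses of the lowest Bloch eigenfunctions: joint Borel measurability, periodicity
  and unit mass on the cell. Extending the profile by zero outside \<open>Z\<close> lets all integrals run over
  the whole space.
\<close>

locale bloch_profile =
  fixes P :: "real^'n \<Rightarrow> real^'n \<Rightarrow> complex"
  assumes meas: "(\<lambda>z. P (fst z) (snd z)) \<in> borel_measurable (borel \<Otimes>\<^sub>M borel)"
    and zero: "\<And>\<eta> y. \<eta> \<notin> Zcell \<Longrightarrow> P \<eta> y = 0"
    and normal: "AE \<eta> in lborel. \<eta> \<in> Zcell \<longrightarrow>
      (\<integral>\<^sup>+y. ennreal ((cmod (P \<eta> y))\<^sup>2) * indicator (unit_cell 0) y \<partial>lborel) = 1"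
    and periodic: "\<And>k. k \<in> lattice \<Longrightarrow> AE \<eta> in lborel. AE y in lborel. P \<eta> (y + k) = P \<eta> y"
begin

lemma P_meas [measurable (raw)]:
  assumes [measurable]: "f \<in> M \<rightarrow>\<^sub>M borel" "g \<in> M \<rightarrow>\<^sub>M borel"
  shows "(\<lambda>x. P (f x) (g x)) \<in> borel_measurable M"
proof -
  have "(\<lambda>x. (f x, g x)) \<in> M \<rightarrow>\<^sub>M borel \<Otimes>\<^sub>M borel" by measurable
  from measurable_compose[OF this meas] show ?thesis by simp
qed

lemma periodic_all: "AE \<eta> in lborel. \<forall>k\<in>lattice. AE y in lborel. P \<eta> (y - k) = P \<eta> y"
proof -
  have "AE \<eta> in lborel. \<forall>k\<in>lattice. AE y in lborel. P \<eta> (y + k) = P \<eta> y"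
    using periodic by (subst AE_ball_countable[OF countable_lattice]) auto
  then show ?thesis
  proof eventually_elim
    case (elim \<eta>)
    show ?case
    proof
      fix k :: "real^'n" assume "k \<in> lattice"
      then show "AE y in lborel. P \<eta> (y - k) = P \<eta> y"
        using elim lattice_uminus[of k] by force
    qed
  qed
qed

lemma periodic_swapped: "AE y in lborel. AE \<eta> in lborel. \<forall>k\<in>lattice. P \<eta> (y - k) = P \<eta> y"
proof -
  have "AE \<eta> in lborel. AE y in lborel. \<forall>k\<in>lattice. P \<eta> (y - k) = P \<eta> y"
    using periodic_all by (simp add: AE_ball_countable[OF countable_lattice])
  moreover have "{z \<in> space (lborel \<Otimes>\<^sub>M lborel). \<forall>k\<in>lattice. P (fst z) (snd z - k) = P (fst z) (snd z)}
      \<in> sets (lborel \<Otimes>\<^sub>M lborel)"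
  proof -
    have "(\<Inter>k\<in>lattice. {z \<in> space (lborel \<Otimes>\<^sub>M lborel). P (fst z) (snd z - k) = P (fst z) (snd z)})
        \<in> sets (lborel \<Otimes>\<^sub>M lborel)"
    proof (rule sets.countable_INT')
      show "(\<lambda>k. {z \<in> space (lborel \<Otimes>\<^sub>M lborel). P (fst z) (snd z - k) = P (fst z) (snd z)}) ` lattice
          \<subseteq> sets (lborel \<Otimes>\<^sub>M lborel)"
        by (intro image_subsetI) measurable
    qed (use countable_lattice zero_lattice in auto)
    also have "(\<Inter>k\<in>lattice. {z \<in> space (lborel \<Otimes>\<^sub>M lborel). P (fst z) (snd z - k) = P (fst z) (snd z)}) =
        {z \<in> space (lborel \<Otimes>\<^sub>M lborel). \<forall>k\<in>lattice. P (fst z) (snd z - k) = P (fst z) (snd z)}"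
      using zero_lattice by auto
    finally show ?thesis .
  qed
  ultimately show ?thesis
    by (subst (asm) lborel_pair.AE_commute) auto
qed

text \<open>
  A ball meets only finitely many lattice translates of the cell, and each carries unit mass.
\<close>

lemma local_bound:
  "\<exists>C. AE \<eta> in lborel. (\<integral>\<^sup>+y. ennreal ((cmod (P \<eta> y))\<^sup>2) * indicator (cball 0 R) y \<partial>lborel) \<le> ennreal C"
proof -
  \<comment> \<open>Points of the cell have norm at most \<open>CARD('n)\<close>; only translates by \<open>k\<close> with \<open>|k| \<le> c\<close> can meet the ball.\<close>
  define c where "c = R + 2 * real CARD('n)"
  define L where "L = (lattice \<inter> cball 0 c :: (real^'n) set)"
  have fin: "finite L" unfolding L_def by (rule finite_lattice_ball)
  have "AE \<eta> in lborel. (\<integral>\<^sup>+y. ennreal ((cmod (P \<eta> y))\<^sup>2) * indicator (cball 0 R) y \<partial>lborel) \<le> ennreal (card L)"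
    using normal periodic_all
  proof eventually_elim
    case (elim \<eta>)
    let ?F = "\<lambda>y. ennreal ((cmod (P \<eta> y))\<^sup>2)"
    let ?Y = "unit_cell 0 :: (real^'n) set"
    have cell: "(\<integral>\<^sup>+y. ?F y * indicator ?Y y \<partial>lborel) \<le> 1"
      using elim(1) zero[of \<eta>] by (cases "\<eta> \<in> Zcell") auto
    have "(\<integral>\<^sup>+y. ?F y * indicator (cball 0 R) y \<partial>lborel) = (\<integral>\<^sup>+k. (\<integral>\<^sup>+y. ?F (y - k) *
        indicator (cball 0 R) (y - k) * indicator ?Y y \<partial>lborel) \<partial>count_space lattice)"
      by (subst nn_integral_unfold[where t=0]) auto
    also have "\<dots> \<le> (\<integral>\<^sup>+k. indicator L k \<partial>count_space lattice)"
    proof (rule nn_integral_mono)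
      fix k :: "real^'n" assume "k \<in> space (count_space lattice)"
      then have k: "k \<in> lattice" by simp
      show "(\<integral>\<^sup>+y. ?F (y - k) * indicator (cball 0 R) (y - k) * indicator ?Y y \<partial>lborel) \<le> indicator L k"
      proof (cases "k \<in> L")
        case True
        have "(\<integral>\<^sup>+y. ?F (y - k) * indicator (cball 0 R) (y - k) * indicator ?Y y \<partial>lborel)
            \<le> (\<integral>\<^sup>+y. ?F (y - k) * indicator ?Y y \<partial>lborel)"
          by (intro nn_integral_mono) (auto simp: indicator_def)
        also have "\<dots> = (\<integral>\<^sup>+y. ?F y * indicator ?Y y \<partial>lborel)"
          using elim(2) k by (intro nn_integral_cong_AE) (auto elim!: eventually_mono)
        finally show ?thesis using cell True by simp
      next
        case False
        have "y - k \<notin> cball 0 R" if y: "y \<in> ?Y" for y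
        proof
          assume "y - k \<in> cball 0 R"
          then have "norm k \<le> R + norm y" using norm_triangle_ineq4[of y "y - k"] by simp
          moreover have "norm y \<le> (\<Sum>i\<in>UNIV. \<bar>y $ i\<bar>)" by (rule norm_le_l1_cart)
          moreover have "(\<Sum>i\<in>UNIV. \<bar>y $ i\<bar>) \<le> (\<Sum>i\<in>(UNIV::'n set). 1)"
          proof (intro sum_mono)
            fix i
            have "0 \<le> y $ i \<and> y $ i < 1" using y by (simp add: unit_cell_def)
            then show "\<bar>y $ i\<bar> \<le> 1" by linarith
          qed
          ultimately show False using False k by (simp add: L_def c_def)
        qed
        then have "(\<integral>\<^sup>+y. ?F (y - k) * indicator (cball 0 R) (y - k) * indicator ?Y y \<partial>lborel) = (\<integral>\<^sup>+y. 0 \<partial>(lborel :: (real^'n) measure))"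
          by (intro nn_integral_cong) (auto simp: indicator_def)
        then show ?thesis by simp
      qed
    qed
    also have "\<dots> = ennreal (card L)"
      using fin by (subst nn_integral_indicator) (auto simp: L_def emeasure_count_space_finite ennreal_of_nat_eq_real_of_nat)
    finally show ?case .
  qed
  then show ?thesis by blast
qed

definition wave :: "real \<Rightarrow> real^'n \<Rightarrow> real^'n \<Rightarrow> complex" where
  "wave \<epsilon> \<eta> x = P (\<epsilon> *\<^sub>R \<eta>) (x /\<^sub>R \<epsilon>) * cis (2 * pi * (\<eta> \<bullet> x))"

text \<open>
  Synthesis of a wave packet from its coefficients; on coefficients living on \<open>Z/\<epsilon>\<close> its adjoint is
  the analysis map \<open>ana\<close>, the integral defining the Bloch coefficients.
\<close>

definition syn :: "real \<Rightarrow> (real^'n \<Rightarrow> complex) \<Rightarrow> real^'n \<Rightarrow> complex" where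
  "syn \<epsilon> g x = (\<integral>\<eta>. g \<eta> * wave \<epsilon> \<eta> x \<partial>lborel)"

definition ana :: "real \<Rightarrow> (real^'n \<Rightarrow> complex) \<Rightarrow> real^'n \<Rightarrow> complex" where
  "ana \<epsilon> w \<eta> = (\<integral>x. w x * cnj (wave \<epsilon> \<eta> x) \<partial>lborel)"

lemma cis_meas [measurable (raw)]: "f \<in> borel_measurable M \<Longrightarrow> (\<lambda>x. cis (f x)) \<in> borel_measurable M"
  by (rule measurable_compose[of f M borel]) (auto intro!: borel_measurable_continuous_onI continuous_intros)

lemma cnj_meas [measurable (raw)]: "f \<in> borel_measurable M \<Longrightarrow> (\<lambda>x. cnj (f x)) \<in> borel_measurable M"
  by (rule measurable_compose[of f M borel]) (auto intro!: borel_measurable_continuous_onI continuous_intros)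

lemma wave_meas [measurable (raw)]:
  assumes [measurable]: "f \<in> M \<rightarrow>\<^sub>M borel" "g \<in> M \<rightarrow>\<^sub>M borel"
  shows "(\<lambda>x. wave \<epsilon> (f x) (g x)) \<in> borel_measurable M"
  unfolding wave_def by measurable

lemma wave_zero: "\<eta> \<notin> Zscaled \<epsilon> \<Longrightarrow> wave \<epsilon> \<eta> x = 0"
  by (simp add: wave_def Zscaled_def zero)

lemma norm_wave: "cmod (wave \<epsilon> \<eta> x) = cmod (P (\<epsilon> *\<^sub>R \<eta>) (x /\<^sub>R \<epsilon>))"
  by (simp add: wave_def norm_mult)

lemma wave_local_bound:
  assumes \<epsilon>: "\<epsilon> > 0"
  shows "\<exists>C\<ge>0. AE \<eta> in lborel. (\<integral>\<^sup>+x. ennreal ((cmod (wave \<epsilon> \<eta> x))\<^sup>2) * indicator (cball 0 R) x \<partial>lborel) \<le> ennreal C"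
proof -
  obtain C where C: "AE \<eta> in lborel. (\<integral>\<^sup>+y. ennreal ((cmod (P \<eta> y))\<^sup>2) * indicator (cball 0 (R / \<epsilon>)) y \<partial>lborel) \<le> ennreal C"
    using local_bound[of "R / \<epsilon>"] by auto
  from AE_scale[OF this, of \<epsilon>] \<epsilon>
  have "AE \<eta> in lborel. (\<integral>\<^sup>+y. ennreal ((cmod (P (\<epsilon> *\<^sub>R \<eta>) y))\<^sup>2) * indicator (cball 0 (R / \<epsilon>)) y \<partial>lborel) \<le> ennreal C"
    by simp
  then have "AE \<eta> in lborel. (\<integral>\<^sup>+x. ennreal ((cmod (wave \<epsilon> \<eta> x))\<^sup>2) * indicator (cball 0 R) x \<partial>lborel)
     \<le> ennreal (\<bar>\<epsilon> ^ DIM(real^'n) * max C 0\<bar>)"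
  proof eventually_elim
    case (elim \<eta>)
    have "(\<integral>\<^sup>+x. ennreal ((cmod (wave \<epsilon> \<eta> x))\<^sup>2) * indicator (cball 0 R) x \<partial>lborel)
      = ennreal (\<bar>\<epsilon>\<bar> ^ DIM(real^'n)) * (\<integral>\<^sup>+y. ennreal ((cmod (wave \<epsilon> \<eta> (\<epsilon> *\<^sub>R y)))\<^sup>2) * indicator (cball 0 R) (\<epsilon> *\<^sub>R y) \<partial>lborel)"
      using \<epsilon> by (intro nn_integral_scale) auto
    also have "(\<integral>\<^sup>+y. ennreal ((cmod (wave \<epsilon> \<eta> (\<epsilon> *\<^sub>R y)))\<^sup>2) * indicator (cball 0 R) (\<epsilon> *\<^sub>R y) \<partial>lborel)
       = (\<integral>\<^sup>+y. ennreal ((cmod (P (\<epsilon> *\<^sub>R \<eta>) y))\<^sup>2) * indicator (cball 0 (R / \<epsilon>)) y \<partial>lborel)"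
      using \<epsilon> by (intro nn_integral_cong) (auto simp: norm_wave indicator_def field_simps)
    also have "ennreal (\<bar>\<epsilon>\<bar> ^ DIM(real^'n)) * \<dots> \<le> ennreal (\<bar>\<epsilon>\<bar> ^ DIM(real^'n)) * ennreal (max C 0)"
      using elim by (intro mult_left_mono) (auto intro: order_trans ennreal_leI)
    also have "\<dots> = ennreal (\<bar>\<epsilon> ^ DIM(real^'n) * max C 0\<bar>)"
      by (simp add: ennreal_mult' abs_mult power_abs)
    finally show ?case .
  qed
  then show ?thesis by (meson abs_ge_zero)
qed

lemma pair_bound:
  assumes \<epsilon>: "\<epsilon> > 0" and g: "sqint lborel g"
  shows "(\<integral>\<^sup>+\<eta>. (\<integral>\<^sup>+x. ennreal ((cmod (g \<eta> * wave \<epsilon> \<eta> x))\<^sup>2) * indicator (cball 0 R) x \<partial>lborel) \<partial>lborel) < \<infinity>"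
proof -
  have [measurable]: "g \<in> borel_measurable borel" using g by (simp add: sqint_def)
  obtain C where C: "C \<ge> 0" "AE \<eta> in lborel. (\<integral>\<^sup>+x. ennreal ((cmod (wave \<epsilon> \<eta> x))\<^sup>2) * indicator (cball 0 R) x \<partial>lborel) \<le> ennreal C"
    using wave_local_bound[OF \<epsilon>] by blast
  have "(\<integral>\<^sup>+\<eta>. (\<integral>\<^sup>+x. ennreal ((cmod (g \<eta> * wave \<epsilon> \<eta> x))\<^sup>2) * indicator (cball 0 R) x \<partial>lborel) \<partial>lborel)
    = (\<integral>\<^sup>+\<eta>. ennreal ((cmod (g \<eta>))\<^sup>2) * (\<integral>\<^sup>+x. ennreal ((cmod (wave \<epsilon> \<eta> x))\<^sup>2) * indicator (cball 0 R) x \<partial>lborel) \<partial>lborel)"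
    by (intro nn_integral_cong) (simp add: nn_integral_cmult[symmetric] norm_mult power_mult_distrib ennreal_mult' mult.assoc)
  also have "\<dots> \<le> (\<integral>\<^sup>+\<eta>. ennreal ((cmod (g \<eta>))\<^sup>2) * ennreal C \<partial>lborel)"
    by (intro nn_integral_mono_AE) (use C(2) in \<open>auto elim!: eventually_mono intro: mult_left_mono\<close>)
  also have "\<dots> = ennreal ((n2 lborel g)\<^sup>2) * ennreal C"
    by (simp add: nn_integral_multc nn_n2[OF g])
  also have "\<dots> < \<infinity>" by (simp add: ennreal_mult_less_top)
  finally show ?thesis .
qed

text \<open>
  By Tonelli's theorem over balls in \<open>x\<close>; as \<open>Z/\<epsilon>\<close> has finite measure, square integrability makes
  the synthesis integral converge absolutely for almost every \<open>x\<close>.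
\<close>

lemma fiber_sqint:
  assumes \<epsilon>: "\<epsilon> > 0" and g: "sqint lborel g"
  shows "AE x in lborel. sqint lborel (\<lambda>\<eta>. g \<eta> * wave \<epsilon> \<eta> x)"
proof -
  have [measurable]: "g \<in> borel_measurable borel" using g by (simp add: sqint_def)
  have "AE x in lborel. \<forall>R::nat. (\<integral>\<^sup>+\<eta>. ennreal ((cmod (g \<eta> * wave \<epsilon> \<eta> x))\<^sup>2) * indicator (cball 0 (real R)) x \<partial>lborel) \<noteq> \<infinity>"
  proof (subst AE_all_countable, intro allI)
    fix R :: nat
    have "(\<integral>\<^sup>+x. (\<integral>\<^sup>+\<eta>. ennreal ((cmod (g \<eta> * wave \<epsilon> \<eta> x))\<^sup>2) * indicator (cball 0 (real R)) x \<partial>lborel) \<partial>lborel)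
       = (\<integral>\<^sup>+\<eta>. (\<integral>\<^sup>+x. ennreal ((cmod (g \<eta> * wave \<epsilon> \<eta> x))\<^sup>2) * indicator (cball 0 (real R)) x \<partial>lborel) \<partial>lborel)"
      by (rule lborel_pair.Fubini') measurable
    then show "AE x in lborel. (\<integral>\<^sup>+\<eta>. ennreal ((cmod (g \<eta> * wave \<epsilon> \<eta> x))\<^sup>2) * indicator (cball 0 (real R)) x \<partial>lborel) \<noteq> \<infinity>"
      using pair_bound[OF \<epsilon> g, of "real R"] by (intro nn_integral_noteq_infinite) auto
  qed
  then show ?thesis
  proof eventually_elim
    case (elim x)
    obtain R :: nat where "norm x \<le> real R" using real_arch_simple by blast
    then have "(\<integral>\<^sup>+\<eta>. ennreal ((cmod (g \<eta> * wave \<epsilon> \<eta> x))\<^sup>2) \<partial>lborel) < \<infinity>"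
      using elim[rule_format, of R] by (simp add: indicator_def less_top)
    then show ?case unfolding sqint_def by (auto intro!: integrableI_bounded)
  qed
qed

lemma sqint_Zscaled_integrable:
  fixes h :: "real^'n \<Rightarrow> complex"
  assumes \<epsilon>: "\<epsilon> > 0" and h: "sqint lborel h" "\<And>\<eta>. \<eta> \<notin> Zscaled \<epsilon> \<Longrightarrow> h \<eta> = 0"
  shows "integrable lborel h"
proof -
  have i: "sqint lborel (\<lambda>\<eta>::real^'n. indicator (Zscaled \<epsilon>) \<eta> :: real)"
  proof -
    have "(\<lambda>\<eta>::real^'n. (norm (indicator (Zscaled \<epsilon>) \<eta> :: real))\<^sup>2) = indicator (Zscaled \<epsilon>)"
      by (auto simp: indicator_def)
    then show ?thesis using Zscaled_finite[OF \<epsilon>] unfolding sqint_def by (simp add: integrable_indicator_iff)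
  qed
  show ?thesis
  proof (rule Bochner_Integration.integrable_bound[OF sqint_norm_mult[OF h(1) i]])
    show "AE \<eta> in lborel. norm (h \<eta>) \<le> norm (norm (h \<eta>) * norm (indicator (Zscaled \<epsilon>) \<eta> :: real))"
      using h(2) by (auto simp: indicator_def)
  qed (use h in \<open>auto simp: sqint_def\<close>)
qed

lemma fiber_integrable:
  assumes \<epsilon>: "\<epsilon> > 0" and g: "sqint lborel g"
  shows "AE x in lborel. integrable lborel (\<lambda>\<eta>. g \<eta> * wave \<epsilon> \<eta> x)"
  using fiber_sqint[OF assms]
  by eventually_elim (rule sqint_Zscaled_integrable[OF \<epsilon>], auto simp: wave_zero)

lemma syn_meas [measurable]:
  assumes [measurable]: "g \<in> borel_measurable borel"
  shows "syn \<epsilon> g \<in> borel_measurable borel"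
proof -
  have "(\<lambda>x. \<integral>\<eta>. g \<eta> * wave \<epsilon> \<eta> x \<partial>lborel) \<in> borel_measurable lborel"
    by (rule lborel.borel_measurable_lebesgue_integral) measurable
  then show ?thesis by (simp add: syn_def[abs_def])
qed

lemma ana_meas [measurable]:
  assumes [measurable]: "w \<in> borel_measurable borel"
  shows "ana \<epsilon> w \<in> borel_measurable borel"
proof -
  have "(\<lambda>\<eta>. \<integral>x. w x * cnj (wave \<epsilon> \<eta> x) \<partial>lborel) \<in> borel_measurable lborel"
    by (rule lborel.borel_measurable_lebesgue_integral) measurable
  then show ?thesis by (simp add: ana_def[abs_def])
qed

text \<open>
  By periodicity, \<open>syn 1 g (y - k)\<close> is the Fourier coefficient at \<open>k\<close> of \<open>h = g \<cdot> wave 1 _ y\<close>. Summing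
  over \<open>k\<close> by Parseval, integrating over \<open>y\<close> in the cell and exchanging the integrals leaves the norm
  of \<open>g\<close>, because the profile has unit mass on the cell.
\<close>

lemma syn_isometry_unit:
  assumes g: "sqint lborel g" and g0: "\<And>\<eta>. \<eta> \<notin> Zcell \<Longrightarrow> g \<eta> = 0"
  shows "(\<integral>\<^sup>+x. ennreal ((cmod (syn 1 g x))\<^sup>2) \<partial>lborel) = ennreal ((n2 lborel g)\<^sup>2)"
proof -
  have [measurable]: "g \<in> borel_measurable borel" using g by (simp add: sqint_def)
  have [measurable]: "syn 1 g \<in> borel_measurable borel" by measurable
  let ?Y = "unit_cell 0 :: (real^'n) set"
  have "(\<integral>\<^sup>+x. ennreal ((cmod (syn 1 g x))\<^sup>2) \<partial>lborel) =
    (\<integral>\<^sup>+k. (\<integral>\<^sup>+y. ennreal ((cmod (syn 1 g (y - k)))\<^sup>2) * indicator ?Y y \<partial>lborel) \<partial>count_space lattice)"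
    by (rule nn_integral_unfold) measurable
  also have "\<dots> = (\<integral>\<^sup>+y. (\<integral>\<^sup>+k. ennreal ((cmod (syn 1 g (y - k)))\<^sup>2) * indicator ?Y y \<partial>count_space lattice) \<partial>lborel)"
    by (intro nn_integral_count_space_nn_integral[symmetric] countable_lattice) measurable
  also have "\<dots> = (\<integral>\<^sup>+y. (\<integral>\<^sup>+\<eta>. ennreal ((cmod (g \<eta>))\<^sup>2) * ennreal ((cmod (P \<eta> y))\<^sup>2) * indicator ?Y y \<partial>lborel) \<partial>lborel)"
  proof (rule nn_integral_cong_AE)
    show "AE y in lborel. (\<integral>\<^sup>+k. ennreal ((cmod (syn 1 g (y - k)))\<^sup>2) * indicator ?Y y \<partial>count_space lattice) =
       (\<integral>\<^sup>+\<eta>. ennreal ((cmod (g \<eta>))\<^sup>2) * ennreal ((cmod (P \<eta> y))\<^sup>2) * indicator ?Y y \<partial>lborel)"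
      using fiber_sqint[OF zero_less_one g] periodic_swapped
    proof eventually_elim
      case (elim y)
      define h where "h = (\<lambda>\<eta>. g \<eta> * wave 1 \<eta> y)"
      have [measurable]: "h \<in> borel_measurable borel" unfolding h_def by measurable
      have h0: "h \<eta> = 0" if "\<eta> \<notin> Zcell" for \<eta> using g0[OF that] by (simp add: h_def)
      have hs: "sqint Zmeas h" "n2 Zmeas h = n2 lborel h"
        using sqint_lborel_restrict[of Zcell h] h0 elim(1) by (auto simp: h_def)
      have "syn 1 g (y - k) = fcoeff h k" if k: "k \<in> lattice" for k
      proof -
        have "fcoeff h k = (\<integral>\<eta>. h \<eta> * cnj (char k \<eta>) \<partial>lborel)"
          unfolding fcoeff_def by (rule sqint_lborel_restrict(3)) (auto simp: h0)
        also have "\<dots> = (\<integral>\<eta>. g \<eta> * wave 1 \<eta> (y - k) \<partial>lborel)"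
        proof (rule integral_cong_AE)
          show "AE \<eta> in lborel. h \<eta> * cnj (char k \<eta>) = g \<eta> * wave 1 \<eta> (y - k)"
            using elim(2)
          proof eventually_elim
            case (elim \<eta>)
            have "cis (2 * pi * (\<eta> \<bullet> (y - k))) = cis (2 * pi * (\<eta> \<bullet> y)) * cis (- (2 * pi * (\<eta> \<bullet> k)))"
              unfolding cis_mult by (simp add: inner_diff_right algebra_simps)
            with elim k show ?case
              by (simp add: h_def wave_def char_def cis_cnj)
          qed
        qed measurable
        finally show ?thesis by (simp add: syn_def)
      qed
      then have "(\<integral>\<^sup>+k. ennreal ((cmod (syn 1 g (y - k)))\<^sup>2) * indicator ?Y y \<partial>count_space lattice) =
          (\<integral>\<^sup>+k. ennreal ((cmod (fcoeff h k))\<^sup>2) * indicator ?Y y \<partial>count_space lattice)"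
        by (intro nn_integral_cong) auto
      also have "\<dots> = (\<integral>\<^sup>+k. ennreal ((cmod (fcoeff h k))\<^sup>2) \<partial>count_space lattice) * indicator ?Y y"
        by (intro nn_integral_multc) auto
      also have "(\<integral>\<^sup>+k. ennreal ((cmod (fcoeff h k))\<^sup>2) \<partial>count_space lattice) = ennreal ((n2 lborel h)\<^sup>2)"
        using parseval[OF hs(1)] hs(2) by simp
      also have "\<dots> = (\<integral>\<^sup>+\<eta>. ennreal ((cmod (h \<eta>))\<^sup>2) \<partial>lborel)"
        using elim(1) by (intro nn_n2[symmetric]) (simp add: h_def)
      also have "\<dots> * indicator ?Y y = (\<integral>\<^sup>+\<eta>. ennreal ((cmod (h \<eta>))\<^sup>2) * indicator ?Y y \<partial>lborel)"
        by (intro nn_integral_multc[symmetric]) auto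
      also have "\<dots> = (\<integral>\<^sup>+\<eta>. ennreal ((cmod (g \<eta>))\<^sup>2) * ennreal ((cmod (P \<eta> y))\<^sup>2) * indicator ?Y y \<partial>lborel)"
        by (intro nn_integral_cong) (simp add: h_def norm_mult norm_wave power_mult_distrib ennreal_mult')
      finally show ?case .
    qed
  qed
  also have "\<dots> = (\<integral>\<^sup>+\<eta>. (\<integral>\<^sup>+y. ennreal ((cmod (g \<eta>))\<^sup>2) * ennreal ((cmod (P \<eta> y))\<^sup>2) * indicator ?Y y \<partial>lborel) \<partial>lborel)"
    by (rule lborel_pair.Fubini') measurable
  also have "\<dots> = (\<integral>\<^sup>+\<eta>. ennreal ((cmod (g \<eta>))\<^sup>2) * (\<integral>\<^sup>+y. ennreal ((cmod (P \<eta> y))\<^sup>2) * indicator ?Y y \<partial>lborel) \<partial>lborel)"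
    by (intro nn_integral_cong) (simp add: nn_integral_cmult[symmetric] mult.assoc)
  also have "\<dots> = (\<integral>\<^sup>+\<eta>. ennreal ((cmod (g \<eta>))\<^sup>2) \<partial>lborel)"
    using normal by (intro nn_integral_cong_AE) (auto elim!: eventually_mono simp: g0)
  also have "\<dots> = ennreal ((n2 lborel g)\<^sup>2)" by (rule nn_n2[OF g])
  finally show ?thesis .
qed

end

section \<open>Isometry and adjoint at scale \<open>\<epsilon>\<close>\<close>

context bloch_profile
begin

lemma syn_scale:
  assumes \<epsilon>: "\<epsilon> > 0" and [measurable]: "g \<in> borel_measurable borel"
  shows "syn \<epsilon> g x = (inverse \<epsilon> ^ DIM(real^'n)) *\<^sub>R syn 1 (\<lambda>\<zeta>. g (inverse \<epsilon> *\<^sub>R \<zeta>)) (inverse \<epsilon> *\<^sub>R x)"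
proof -
  have "syn \<epsilon> g x = (\<bar>inverse \<epsilon>\<bar> ^ DIM(real^'n)) *\<^sub>R
      (\<integral>\<zeta>. g (inverse \<epsilon> *\<^sub>R \<zeta>) * wave \<epsilon> (inverse \<epsilon> *\<^sub>R \<zeta>) x \<partial>lborel)"
    unfolding syn_def using \<epsilon> by (intro integral_scale) auto
  also have "(\<integral>\<zeta>. g (inverse \<epsilon> *\<^sub>R \<zeta>) * wave \<epsilon> (inverse \<epsilon> *\<^sub>R \<zeta>) x \<partial>lborel)
      = syn 1 (\<lambda>\<zeta>. g (inverse \<epsilon> *\<^sub>R \<zeta>)) (inverse \<epsilon> *\<^sub>R x)"
    unfolding syn_def using \<epsilon> by (simp add: wave_def)
  finally show ?thesis using \<epsilon> by simp
qed

lemma syn_isometry: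
  assumes \<epsilon>: "\<epsilon> > 0" and g: "sqint lborel g" and g0: "\<And>\<eta>. \<eta> \<notin> Zscaled \<epsilon> \<Longrightarrow> g \<eta> = 0"
  shows "sqint lborel (syn \<epsilon> g)" "n2 lborel (syn \<epsilon> g) = n2 lborel g"
proof -
  have [measurable]: "g \<in> borel_measurable borel" using g by (simp add: sqint_def)
  let ?d = "DIM(real^'n)"
  let ?r = "inverse \<epsilon>"
  define h where "h = (\<lambda>\<zeta>. g (?r *\<^sub>R \<zeta>))"
  have [measurable]: "h \<in> borel_measurable borel" unfolding h_def by measurable
  have r: "?r > 0" "\<bar>?r\<bar> = ?r" using \<epsilon> by auto
  have h0: "h \<zeta> = 0" if "\<zeta> \<notin> Zcell" for \<zeta>
    unfolding h_def using that \<epsilon> by (intro g0) (simp add: Zscaled_def)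
  have gh: "ennreal ((n2 lborel g)\<^sup>2) = ennreal (?r ^ ?d) * (\<integral>\<^sup>+\<zeta>. ennreal ((cmod (h \<zeta>))\<^sup>2) \<partial>lborel)"
    unfolding nn_n2[OF g, symmetric] h_def
    using nn_integral_scale[of "\<lambda>\<eta>. ennreal ((cmod (g \<eta>))\<^sup>2)" ?r] r by simp
  have rpos: "?r ^ ?d > 0" using r by (intro zero_less_power)
  have "(\<integral>\<^sup>+\<zeta>. ennreal ((cmod (h \<zeta>))\<^sup>2) \<partial>lborel) < \<infinity>"
  proof (rule ccontr)
    assume "\<not> ?thesis"
    then have "(\<integral>\<^sup>+\<zeta>. ennreal ((cmod (h \<zeta>))\<^sup>2) \<partial>lborel) = \<infinity>" by (simp add: not_less top_unique)
    then have "ennreal ((n2 lborel g)\<^sup>2) = \<infinity>"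
      using gh rpos \<epsilon> by (simp add: ennreal_mult_top)
    then show False by simp
  qed
  then have hs: "sqint lborel h" unfolding sqint_def by (auto intro!: integrableI_bounded)
  have "(\<integral>\<^sup>+x. ennreal ((cmod (syn \<epsilon> g x))\<^sup>2) \<partial>lborel)
     = (\<integral>\<^sup>+x. ennreal ((?r ^ ?d)\<^sup>2) * ennreal ((cmod (syn 1 h (?r *\<^sub>R x)))\<^sup>2) \<partial>lborel)"
    by (intro nn_integral_cong)
      (simp add: syn_scale[OF \<epsilon>] h_def[symmetric] power_mult_distrib ennreal_mult' r)
  also have "\<dots> = ennreal ((?r ^ ?d)\<^sup>2) * (\<integral>\<^sup>+x. ennreal ((cmod (syn 1 h (?r *\<^sub>R x)))\<^sup>2) \<partial>lborel)"
    by (rule nn_integral_cmult) measurable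
  also have "\<dots> = ennreal (?r ^ ?d) * (ennreal (?r ^ ?d) * (\<integral>\<^sup>+x. ennreal ((cmod (syn 1 h (?r *\<^sub>R x)))\<^sup>2) \<partial>lborel))"
    unfolding power2_eq_square using rpos by (simp only: ennreal_mult less_imp_le mult.assoc)
  also have "ennreal (?r ^ ?d) * (\<integral>\<^sup>+x. ennreal ((cmod (syn 1 h (?r *\<^sub>R x)))\<^sup>2) \<partial>lborel)
      = (\<integral>\<^sup>+x. ennreal ((cmod (syn 1 h x))\<^sup>2) \<partial>lborel)"
    using nn_integral_scale[of "\<lambda>x. ennreal ((cmod (syn 1 h x))\<^sup>2)" ?r] r by simp
  also have "\<dots> = ennreal ((n2 lborel h)\<^sup>2)" by (rule syn_isometry_unit[OF hs h0])
  also have "ennreal (?r ^ ?d) * ennreal ((n2 lborel h)\<^sup>2) = ennreal ((n2 lborel g)\<^sup>2)"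
    unfolding gh nn_n2[OF hs] ..
  finally have e: "(\<integral>\<^sup>+x. ennreal ((cmod (syn \<epsilon> g x))\<^sup>2) \<partial>lborel) = ennreal ((n2 lborel g)\<^sup>2)" .
  have m: "syn \<epsilon> g \<in> borel_measurable lborel" by simp
  show s: "sqint lborel (syn \<epsilon> g)"
    by (rule sqintI_nn(1)[OF m, of "n2 lborel g"]) (simp_all add: e)
  from e nn_n2[OF s] show "n2 lborel (syn \<epsilon> g) = n2 lborel g"
    by (simp add: power2_eq_iff_nonneg)
qed

lemma syn_add:
  assumes \<epsilon>: "\<epsilon> > 0" and g: "sqint lborel g" "sqint lborel h"
  shows "AE x in lborel. syn \<epsilon> (\<lambda>\<eta>. g \<eta> + h \<eta>) x = syn \<epsilon> g x + syn \<epsilon> h x"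
  using fiber_integrable[OF \<epsilon> g(1)] fiber_integrable[OF \<epsilon> g(2)]
  by eventually_elim (simp add: syn_def distrib_right)

lemma syn_diff:
  assumes \<epsilon>: "\<epsilon> > 0" and g: "sqint lborel g" "sqint lborel h"
  shows "AE x in lborel. syn \<epsilon> (\<lambda>\<eta>. g \<eta> - h \<eta>) x = syn \<epsilon> g x - syn \<epsilon> h x"
  using fiber_integrable[OF \<epsilon> g(1)] fiber_integrable[OF \<epsilon> g(2)]
  by eventually_elim (simp add: syn_def left_diff_distrib)

text \<open>
  Polarisation of the isometry. Synthesis is additive only almost everywhere, where the defining
  integrals converge.
\<close>

lemma syn_ip:
  assumes \<epsilon>: "\<epsilon> > 0" and g: "sqint lborel g" "\<And>\<eta>. \<eta> \<notin> Zscaled \<epsilon> \<Longrightarrow> g \<eta> = 0"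
    and h: "sqint lborel h" "\<And>\<eta>. \<eta> \<notin> Zscaled \<epsilon> \<Longrightarrow> h \<eta> = 0"
  shows "ip lborel (syn \<epsilon> g) (syn \<epsilon> h) = ip lborel g h"
proof -
  have Sg: "sqint lborel (syn \<epsilon> g)" "n2 lborel (syn \<epsilon> g) = n2 lborel g"
    and Sh: "sqint lborel (syn \<epsilon> h)" "n2 lborel (syn \<epsilon> h) = n2 lborel h"
    by (intro syn_isometry \<epsilon> g h; assumption)+
  have gh: "sqint lborel (\<lambda>\<eta>. g \<eta> + h \<eta>)" by (rule sqint_add[OF g(1) h(1)])
  have [measurable]: "g \<in> borel_measurable borel" "h \<in> borel_measurable borel"
    using g h by (auto simp: sqint_def)
  have "n2 lborel (\<lambda>x. syn \<epsilon> g x + syn \<epsilon> h x) = n2 lborel (syn \<epsilon> (\<lambda>\<eta>. g \<eta> + h \<eta>))"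
    using syn_add[OF \<epsilon> g(1) h(1)] by (intro n2_cong_AE) auto
  also have "\<dots> = n2 lborel (\<lambda>\<eta>. g \<eta> + h \<eta>)"
    using g(2) h(2) by (intro syn_isometry(2)[OF \<epsilon> gh]) auto
  finally have "(n2 lborel (\<lambda>x. syn \<epsilon> g x + syn \<epsilon> h x))\<^sup>2 = (n2 lborel (\<lambda>\<eta>. g \<eta> + h \<eta>))\<^sup>2" by simp
  then show ?thesis
    unfolding n2_add_sq[OF Sg(1) Sh(1)] n2_add_sq[OF g(1) h(1)] Sg(2) Sh(2) by simp
qed

text \<open>
  Fubini's theorem applies since \<open>|g \<omega> w| \<le> |g \<omega>|\<^sup>2 + |w|\<^sup>2\<close>, and both terms are integrable once \<open>x\<close> is
  confined to a ball and \<open>\<eta>\<close> to \<open>Z/\<epsilon>\<close>.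
\<close>

lemma adjoint:
  assumes \<epsilon>: "\<epsilon> > 0" and g: "sqint lborel g"
    and w: "sqint lborel w" "\<And>x. x \<notin> cball 0 R \<Longrightarrow> w x = 0" and g0: "\<And>\<eta>. \<eta> \<notin> Zscaled \<epsilon> \<Longrightarrow> g \<eta> = 0"
  shows "ip lborel (syn \<epsilon> g) w = ip lborel g (ana \<epsilon> w)"
proof -
  have [measurable]: "g \<in> borel_measurable borel" "w \<in> borel_measurable borel"
    using g w by (auto simp: sqint_def)
  let ?f = "\<lambda>\<eta> x. g \<eta> * wave \<epsilon> \<eta> x * cnj (w x)"
  let ?B = "indicator (cball 0 R) :: real^'n \<Rightarrow> ennreal"
  let ?Z = "indicator (Zscaled \<epsilon>) :: real^'n \<Rightarrow> ennreal"
  have bound: "ennreal (cmod (?f \<eta> x)) \<le> ennreal ((cmod (g \<eta> * wave \<epsilon> \<eta> x))\<^sup>2) * ?B x + ennreal ((cmod (w x))\<^sup>2) * ?Z \<eta>" for \<eta> x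
  proof (cases "x \<in> cball 0 R \<and> \<eta> \<in> Zscaled \<epsilon>")
    case True
    let ?a = "cmod (g \<eta> * wave \<epsilon> \<eta> x)" and ?b = "cmod (w x)"
    have "0 \<le> (?a - ?b)\<^sup>2" "0 \<le> ?a * ?b" by simp_all
    then have "?a * ?b \<le> ?a\<^sup>2 + ?b\<^sup>2" unfolding power2_diff by linarith
    then have "ennreal (cmod (?f \<eta> x)) \<le> ennreal (?a\<^sup>2 + ?b\<^sup>2)"
      by (intro ennreal_leI) (simp add: norm_mult)
    then show ?thesis using True by simp
  next
    case False
    then have "?f \<eta> x = 0" using w(2)[of x] g0[of \<eta>] by auto
    then show ?thesis by (simp only: norm_zero ennreal_0 zero_le)
  qed
  have fin: "(\<integral>\<^sup>+\<eta>. (\<integral>\<^sup>+x. ennreal (cmod (?f \<eta> x)) \<partial>lborel) \<partial>lborel) < \<infinity>"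
  proof -
    have "(\<integral>\<^sup>+\<eta>. (\<integral>\<^sup>+x. ennreal (cmod (?f \<eta> x)) \<partial>lborel) \<partial>lborel) \<le>
       (\<integral>\<^sup>+\<eta>. (\<integral>\<^sup>+x. ennreal ((cmod (g \<eta> * wave \<epsilon> \<eta> x))\<^sup>2) * ?B x + ennreal ((cmod (w x))\<^sup>2) * ?Z \<eta> \<partial>lborel) \<partial>lborel)"
      by (intro nn_integral_mono bound)
    also have "\<dots> = (\<integral>\<^sup>+\<eta>. (\<integral>\<^sup>+x. ennreal ((cmod (g \<eta> * wave \<epsilon> \<eta> x))\<^sup>2) * ?B x \<partial>lborel) +
          (\<integral>\<^sup>+x. ennreal ((cmod (w x))\<^sup>2) * ?Z \<eta> \<partial>lborel) \<partial>lborel)"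
      by (intro nn_integral_cong nn_integral_add) measurable
    also have "\<dots> = (\<integral>\<^sup>+\<eta>. (\<integral>\<^sup>+x. ennreal ((cmod (g \<eta> * wave \<epsilon> \<eta> x))\<^sup>2) * ?B x \<partial>lborel) \<partial>lborel) +
          (\<integral>\<^sup>+\<eta>. (\<integral>\<^sup>+x. ennreal ((cmod (w x))\<^sup>2) * ?Z \<eta> \<partial>lborel) \<partial>lborel)"
      by (intro nn_integral_add) measurable
    also have "(\<integral>\<^sup>+\<eta>. (\<integral>\<^sup>+x. ennreal ((cmod (w x))\<^sup>2) * ?Z \<eta> \<partial>lborel) \<partial>lborel)
        = ennreal ((n2 lborel w)\<^sup>2) * emeasure lborel (Zscaled \<epsilon> :: (real^'n) set)"
      by (simp add: nn_integral_multc nn_integral_cmult nn_n2[OF w(1)])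
    also have "(\<integral>\<^sup>+\<eta>. (\<integral>\<^sup>+x. ennreal ((cmod (g \<eta> * wave \<epsilon> \<eta> x))\<^sup>2) * ?B x \<partial>lborel) \<partial>lborel) + \<dots> < \<infinity>"
      using pair_bound[OF \<epsilon> g, of R] Zscaled_finite[OF \<epsilon>, where 'n='n] by (simp add: ennreal_mult_less_top)
    finally show ?thesis .
  qed
  have int: "integrable (lborel \<Otimes>\<^sub>M lborel) (\<lambda>(\<eta>, x). ?f \<eta> x)"
    unfolding integrable_iff_bounded
  proof
    show "(\<lambda>(\<eta>, x). ?f \<eta> x) \<in> borel_measurable (lborel \<Otimes>\<^sub>M lborel)" by measurable
    have "(\<integral>\<^sup>+z. ennreal (norm (case z of (\<eta>, x) \<Rightarrow> ?f \<eta> x)) \<partial>(lborel \<Otimes>\<^sub>M lborel)) =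
        (\<integral>\<^sup>+\<eta>. (\<integral>\<^sup>+x. ennreal (cmod (?f \<eta> x)) \<partial>lborel) \<partial>lborel)"
      by (subst lborel.nn_integral_fst[symmetric]) auto
    then show "(\<integral>\<^sup>+z. ennreal (norm (case z of (\<eta>, x) \<Rightarrow> ?f \<eta> x)) \<partial>(lborel \<Otimes>\<^sub>M lborel)) < \<infinity>"
      using fin by simp
  qed
  have 1: "(\<integral>x. syn \<epsilon> g x * cnj (w x) \<partial>lborel) = (\<integral>x. (\<integral>\<eta>. ?f \<eta> x \<partial>lborel) \<partial>lborel)"
    unfolding syn_def by simp
  have 2: "\<dots> = (\<integral>\<eta>. (\<integral>x. ?f \<eta> x \<partial>lborel) \<partial>lborel)"
    by (rule lborel_pair.Fubini_integral[OF int])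
  have 3: "(\<integral>x. ?f \<eta> x \<partial>lborel) = g \<eta> * cnj (ana \<epsilon> w \<eta>)" for \<eta>
  proof -
    have "cnj (ana \<epsilon> w \<eta>) = (\<integral>x. wave \<epsilon> \<eta> x * cnj (w x) \<partial>lborel)"
      unfolding ana_def
      by (subst Bochner_Integration.integral_cnj[symmetric]) (rule Bochner_Integration.integral_cong, simp_all)
    then show ?thesis by (simp add: mult.assoc)
  qed
  have i1: "integrable lborel (\<lambda>x. syn \<epsilon> g x * cnj (w x))"
    by (intro sqint_mult_integrable syn_isometry[OF \<epsilon> g g0] w)
  have i2: "integrable lborel (\<lambda>\<eta>. g \<eta> * cnj (ana \<epsilon> w \<eta>))"
    using lborel_pair.integrable_fst[OF int] unfolding 3 .
  have re: "a \<bullet> b = Re (a * cnj b)" for a b :: complex by (simp add: inner_complex_def)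
  show ?thesis
    unfolding ip_def re integral_Re[OF i1] integral_Re[OF i2] 1 2 3 ..
qed

lemma ana_zero: "\<eta> \<notin> Zscaled \<epsilon> \<Longrightarrow> ana \<epsilon> w \<eta> = 0"
  by (simp add: ana_def wave_zero)

lemma ana_sqint:
  assumes \<epsilon>: "\<epsilon> > 0" and w: "sqint lborel w" "\<And>x. x \<notin> cball 0 R \<Longrightarrow> w x = 0"
  shows "sqint lborel (ana \<epsilon> w)"
proof -
  have [measurable]: "w \<in> borel_measurable borel" using w by (auto simp: sqint_def)
  obtain C where C: "C \<ge> 0" "AE \<eta> in lborel. (\<integral>\<^sup>+x. ennreal ((cmod (wave \<epsilon> \<eta> x))\<^sup>2) * indicator (cball 0 R) x \<partial>lborel) \<le> ennreal C"
    using wave_local_bound[OF \<epsilon>] by blast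
  have b: "AE \<eta> in lborel. norm (ana \<epsilon> w \<eta>) \<le> norm ((sqrt C * n2 lborel w) * indicator (Zscaled \<epsilon>) \<eta> :: real)"
    using C(2)
  proof eventually_elim
    case (elim \<eta>)
    show ?case
    proof (cases "\<eta> \<in> Zscaled \<epsilon>")
      case True
      let ?h = "\<lambda>x. indicator (cball 0 R) x *\<^sub>R wave \<epsilon> \<eta> x"
      have hm: "?h \<in> borel_measurable lborel" by measurable
      have "(\<integral>\<^sup>+x. ennreal ((norm (?h x))\<^sup>2) \<partial>lborel) = (\<integral>\<^sup>+x. ennreal ((cmod (wave \<epsilon> \<eta> x))\<^sup>2) * indicator (cball 0 R) x \<partial>lborel)"
        by (intro nn_integral_cong) (auto simp: indicator_def)
      then have h: "sqint lborel ?h" "n2 lborel ?h \<le> sqrt C"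
        using sqintI_nn[OF hm, of "sqrt C"] elim C(1) by auto
      have "ana \<epsilon> w \<eta> = (\<integral>x. w x * cnj (?h x) \<partial>lborel)"
        unfolding ana_def using w(2) by (intro Bochner_Integration.integral_cong) (auto simp: indicator_def)
      then have "norm (ana \<epsilon> w \<eta>) \<le> (\<integral>x. norm (w x * cnj (?h x)) \<partial>lborel)"
        by (simp only: integral_norm_bound)
      also have "\<dots> = ip lborel (\<lambda>x. norm (w x)) (\<lambda>x. norm (?h x))"
        unfolding ip_def by (simp add: norm_mult mult_ac)
      also have "\<dots> \<le> n2 lborel w * n2 lborel ?h"
        using CS_ip[OF sqint_norm[OF w(1)] sqint_norm[OF h(1)]] unfolding n2_norm by simp
      also have "\<dots> \<le> n2 lborel w * sqrt C" using h(2) by (intro mult_left_mono) auto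
      finally show ?thesis using True C(1) by (simp add: mult.commute)
    qed (simp add: ana_zero)
  qed
  have "sqint lborel (\<lambda>\<eta>::real^'n. (sqrt C * n2 lborel w) * indicator (Zscaled \<epsilon>) \<eta> :: real)"
  proof -
    have "(\<lambda>\<eta>::real^'n. (norm ((sqrt C * n2 lborel w) * indicator (Zscaled \<epsilon>) \<eta> :: real))\<^sup>2)
        = (\<lambda>\<eta>. (sqrt C * n2 lborel w)\<^sup>2 * indicator (Zscaled \<epsilon>) \<eta>)"
      by (auto simp: indicator_def)
    then show ?thesis using Zscaled_finite[OF \<epsilon>, where 'n='n] unfolding sqint_def by (simp add: integrable_indicator_iff)
  qed
  from sqint_dominated[OF this _ b] show ?thesis by simp
qed

text \<open>The analysis map applied to a localised function misses \<open>g\<close> by no more than the function misses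
  the wave packet of \<open>g\<close>, because synthesis is an isometry whose adjoint is analysis.\<close>

lemma ana_close:
  assumes \<epsilon>: "\<epsilon> > 0" and g: "sqint lborel g" "\<And>\<eta>. \<eta> \<notin> Zscaled \<epsilon> \<Longrightarrow> g \<eta> = 0"
    and w: "sqint lborel w" "\<And>x. x \<notin> cball 0 R \<Longrightarrow> w x = 0"
  shows "n2 lborel (\<lambda>\<eta>. ana \<epsilon> w \<eta> - g \<eta>) \<le> n2 lborel (\<lambda>x. w x - syn \<epsilon> g x)"
proof -
  \<comment> \<open>Testing with the error itself: \<open>|h|\<^sup>2 = \<langle>S h, w - S g\<rangle>\<close>.\<close>
  define h where "h = (\<lambda>\<eta>. ana \<epsilon> w \<eta> - g \<eta>)"
  have sa: "sqint lborel (ana \<epsilon> w)" by (rule ana_sqint[OF \<epsilon> w])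
  have h: "sqint lborel h" unfolding h_def by (intro sqint_diff sa g)
  have h0: "h \<eta> = 0" if "\<eta> \<notin> Zscaled \<epsilon>" for \<eta> using that g(2) by (simp add: h_def ana_zero)
  note Sh = syn_isometry[OF \<epsilon> h h0] and Sg = syn_isometry[OF \<epsilon> g]
  have "(n2 lborel h)\<^sup>2 = ip lborel h (ana \<epsilon> w) - ip lborel h g"
    unfolding n2_sq_ip by (subst (2) h_def) (rule ip_diff(1)[OF h sa g(1)])
  also have "\<dots> = ip lborel (syn \<epsilon> h) w - ip lborel (syn \<epsilon> h) (syn \<epsilon> g)"
    using adjoint[OF \<epsilon> h w h0] syn_ip[OF \<epsilon> h h0 g] by simp
  also have "\<dots> = ip lborel (syn \<epsilon> h) (\<lambda>x. w x - syn \<epsilon> g x)"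
    by (rule ip_diff(1)[OF Sh(1) w(1) Sg(1), symmetric])
  also have "\<dots> \<le> n2 lborel h * n2 lborel (\<lambda>x. w x - syn \<epsilon> g x)"
    using CS_ip[OF Sh(1) sqint_diff[OF w(1) Sg(1)]] Sh(2) by simp
  finally have "n2 lborel h * n2 lborel h \<le> n2 lborel h * n2 lborel (\<lambda>x. w x - syn \<epsilon> g x)"
    by (simp add: power2_eq_square)
  then show ?thesis
    unfolding h_def[symmetric]
    using n2_nonneg[of lborel h] n2_nonneg[of lborel "\<lambda>x. w x - syn \<epsilon> g x"]
    by (cases "n2 lborel h = 0") (auto simp: mult_le_cancel_left)
qed

end

section \<open>Borel representatives and truncation\<close>

lemma lebesgue_AE_measurable:
  fixes f g :: "'a::euclidean_space \<Rightarrow> 'b::euclidean_space"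
  assumes "AE x in lebesgue. f x = g x" "g \<in> borel_measurable lebesgue"
  shows "f \<in> borel_measurable lebesgue"
proof -
  have "AE x in lebesgue. g x = f x" using assms(1) by eventually_elim simp
  with assms(2) show ?thesis by (rule borel_measurable_AE)
qed

text \<open>
  Lebesgue measure is complete: a function equal almost everywhere to a non-measurable one is itself
  non-measurable, and both integrals take the default value \<open>0\<close>.
\<close>

lemma lebesgue_integral_cong_AE':
  fixes f g :: "'a::euclidean_space \<Rightarrow> 'b::euclidean_space"
  assumes "AE x in lebesgue. f x = g x"
  shows "integral\<^sup>L lebesgue f = integral\<^sup>L lebesgue g"
proof (cases "g \<in> borel_measurable lebesgue")
  case True
  then show ?thesis using lebesgue_AE_measurable[OF assms True] assms by (intro integral_cong_AE)
next
  case False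
  have "AE x in lebesgue. g x = f x" using assms by (auto elim: eventually_mono)
  then have "f \<notin> borel_measurable lebesgue" using False lebesgue_AE_measurable by blast
  then have "\<not> integrable lebesgue f" "\<not> integrable lebesgue g" using False by auto
  then show ?thesis by (simp add: not_integrable_integral_eq)
qed

lemma integral_lebesgue_lborel:
  fixes f g :: "'a::euclidean_space \<Rightarrow> 'b::euclidean_space"
  assumes "AE x in lborel. f x = g x" "g \<in> borel_measurable borel"
  shows "integral\<^sup>L lebesgue f = integral\<^sup>L lborel g"
proof -
  have "integral\<^sup>L lebesgue f = integral\<^sup>L lebesgue g"
    using assms(1) by (intro lebesgue_integral_cong_AE') (simp add: AE_completion_iff)
  also have "\<dots> = integral\<^sup>L lborel g" using assms(2) by (intro integral_completion) simp
  finally show ?thesis .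
qed

lemma sqint_lebesgue_lborel:
  fixes f g :: "'a::euclidean_space \<Rightarrow> 'b::euclidean_space"
  assumes "AE x in lborel. f x = g x" "g \<in> borel_measurable borel"
  shows "sqint lebesgue f \<longleftrightarrow> sqint lborel g" "n2 lebesgue f = n2 lborel g"
proof -
  have ae: "AE x in lebesgue. f x = g x" using assms(1) by (simp add: AE_completion_iff)
  have gm: "g \<in> borel_measurable lebesgue" using assms(2) by (intro measurable_completion) simp
  have fm: "f \<in> borel_measurable lebesgue" by (rule lebesgue_AE_measurable[OF ae gm])
  have "integrable lebesgue (\<lambda>x. (norm (f x))\<^sup>2) \<longleftrightarrow> integrable lebesgue (\<lambda>x. (norm (g x))\<^sup>2)"
    using ae fm gm by (intro integrable_cong_AE) (auto elim: eventually_mono)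
  also have "\<dots> \<longleftrightarrow> integrable lborel (\<lambda>x. (norm (g x))\<^sup>2)"
    using assms(2) by (intro integrable_completion) simp
  finally show "sqint lebesgue f \<longleftrightarrow> sqint lborel g"
    using fm assms(2) by (simp add: sqint_def)
  show "n2 lebesgue f = n2 lborel g"
    unfolding n2_def
    by (intro arg_cong[where f=sqrt] integral_lebesgue_lborel) (use assms in \<open>auto elim: eventually_mono\<close>)
qed

text \<open>
  Lebesgue measurability in the pair \<open>(\<eta>, x)\<close> does not descend to every section, so joint arguments are
  carried out for Borel representatives.
\<close>

lemma borel_representative:
  fixes f :: "'a::euclidean_space \<Rightarrow> complex"
  assumes "f \<in> borel_measurable lebesgue"
  shows "\<exists>g\<in>borel_measurable borel. AE x in lborel. f x = g x"
proof -
  have ri: "(\<lambda>x. Re (f x)) \<in> borel_measurable lebesgue" "(\<lambda>x. Im (f x)) \<in> borel_measurable lebesgue"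
    using assms by auto
  from completion_ex_borel_measurable_real[OF ri(1)] completion_ex_borel_measurable_real[OF ri(2)]
  obtain a b where a: "a \<in> borel_measurable lborel" "AE x in lborel. Re (f x) = a x"
    and b: "b \<in> borel_measurable lborel" "AE x in lborel. Im (f x) = b x"
    by auto
  have [measurable]: "a \<in> borel_measurable borel" "b \<in> borel_measurable borel" using a b by auto
  show ?thesis
  proof (intro bexI)
    show "AE x in lborel. f x = complex_of_real (a x) + \<i> * complex_of_real (b x)"
      using a(2) b(2) by eventually_elim (simp add: complex_eq_iff)
  qed measurable
qed

lemma L2_borel_representative:
  fixes f :: "'a::euclidean_space \<Rightarrow> complex"
  assumes "f \<in> L2 S" and [measurable]: "S \<in> sets borel"
  shows "\<exists>g. sqint lborel g \<and> (\<forall>x. x \<notin> S \<longrightarrow> g x = 0) \<and> (AE x in lborel. indicat_real S x *\<^sub>R f x = g x)"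
proof -
  have s: "sqint lebesgue (\<lambda>x. indicat_real S x *\<^sub>R f x)" using assms by (simp add: L2_iff_sqint)
  then obtain h where [measurable]: "h \<in> borel_measurable borel" and
    h: "AE x in lborel. indicat_real S x *\<^sub>R f x = h x"
    using borel_representative[OF sqintD(1)[OF s]] by blast
  have *: "AE x in lborel. indicat_real S x *\<^sub>R f x = indicat_real S x *\<^sub>R h x"
    using h by eventually_elim (auto simp: indicator_def)
  have "sqint lborel (\<lambda>x. indicat_real S x *\<^sub>R h x)"
    using s sqint_lebesgue_lborel(1)[OF *] by simp
  with * show ?thesis by (intro exI[of _ "\<lambda>x. indicat_real S x *\<^sub>R h x"]) auto
qed

lemma L2_tendsto_unique:
  fixes v v' :: "'a::euclidean_space \<Rightarrow> 'b::euclidean_space"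
  assumes "L2_tendsto S u v F" "L2_tendsto S u v' F" "F \<noteq> bot"
  shows "AE x in lebesgue. x \<in> S \<longrightarrow> v x = v' x"
proof -
  let ?e = "\<lambda>f x. indicat_real S x *\<^sub>R f x"
  have v: "sqint lebesgue (?e v)" "sqint lebesgue (?e v')"
    using assms by (auto simp: L2_tendsto_def L2_iff_sqint)
  have lim: "((\<lambda>k. n2 lebesgue (?e (\<lambda>x. u k x - v x)) + n2 lebesgue (?e (\<lambda>x. u k x - v' x))) \<longlongrightarrow> 0 + 0) F"
    using assms by (intro tendsto_add) (auto simp: L2_tendsto_def L2norm_eq_n2)
  have "\<forall>\<^sub>F k in F. n2 lebesgue (\<lambda>x. ?e v x - ?e v' x)
      \<le> n2 lebesgue (?e (\<lambda>x. u k x - v x)) + n2 lebesgue (?e (\<lambda>x. u k x - v' x))"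
  proof -
    have "\<forall>\<^sub>F k in F. sqint lebesgue (?e (u k))"
      using assms(1) by (simp add: L2_tendsto_def L2_iff_sqint)
    then show ?thesis
    proof eventually_elim
      case (elim k)
      from n2_triangle3[OF v(1) elim v(2)] show ?case
        by (subst (asm) n2_minus_commute[of _ "?e v" "?e (u k)"]) (simp add: scaleR_diff_right)
    qed
  qed
  then have "n2 lebesgue (\<lambda>x. ?e v x - ?e v' x) \<le> 0 + 0"
    using lim assms(3) by (intro tendsto_lowerbound) auto
  then have "n2 lebesgue (\<lambda>x. ?e v x - ?e v' x) = 0" by (simp add: order_antisym)
  then have "AE x in lebesgue. ?e v x - ?e v' x = 0"
    by (subst (asm) n2_eq_0[OF sqint_diff[OF v]]) simp
  then show ?thesis by eventually_elim (auto simp: indicator_def)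
qed

lemma truncation_tendsto:
  fixes u :: "'a::euclidean_space \<Rightarrow> 'b::euclidean_space"
  assumes u: "sqint lborel u"
  shows "((\<lambda>R. n2 lborel (\<lambda>x. indicat_real (cball 0 R) x *\<^sub>R u x - u x)) \<longlongrightarrow> 0) at_top"
proof -
  have [measurable]: "u \<in> borel_measurable borel" using u by (simp add: sqint_def)
  let ?t = "\<lambda>R x. indicat_real (cball 0 R) x *\<^sub>R u x"
  have seq: "(\<lambda>j. n2 lborel (\<lambda>x. ?t (real j) x - u x)) \<longlonglongrightarrow> 0"
  proof (rule n2_dominated_tendsto[OF _ _ _ u])
    show "AE x in lborel. (\<lambda>j. ?t (real j) x) \<longlonglongrightarrow> u x"
    proof (rule AE_I2)
      fix x :: 'a
      obtain j0 :: nat where "norm x \<le> real j0" using real_arch_simple by blast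
      then have "eventually (\<lambda>j. ?t (real j) x = u x) sequentially"
        unfolding eventually_sequentially by (intro exI[of _ j0]) auto
      then show "(\<lambda>j. ?t (real j) x) \<longlonglongrightarrow> u x" by (rule tendsto_eventually)
    qed
  qed (auto simp: indicator_def)
  have st: "sqint lborel (?t R)" for R
    by (rule sqint_dominated[OF u]) (auto simp: indicator_def)
  have mono: "n2 lborel (\<lambda>x. ?t R x - u x) \<le> n2 lborel (\<lambda>x. ?t (real j) x - u x)" if "real j \<le> R" for R j
    by (rule n2_mono[OF sqint_diff[OF st u]]) (use that in \<open>auto simp: indicator_def\<close>)
  show ?thesis
  proof (rule tendstoI)
    fix e :: real assume "e > 0"
    then obtain j where j: "n2 lborel (\<lambda>x. ?t (real j) x - u x) < e"
      using order_tendstoD(2)[OF seq] by (auto simp: eventually_sequentially)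
    show "\<forall>\<^sub>F R in at_top. dist (n2 lborel (\<lambda>x. ?t R x - u x)) 0 < e"
      using eventually_ge_at_top[of "real j"]
      by eventually_elim (use mono j in \<open>auto intro: order_le_less_trans\<close>)
  qed
qed

section \<open>Plane waves as a Bloch profile\<close>

text \<open>
  With this profile, synthesis and analysis are the inverse Fourier transform and the Fourier
  transform, both restricted to frequencies in \<open>Z/\<epsilon>\<close>.
\<close>

definition plane_profile :: "real^'n \<Rightarrow> real^'n \<Rightarrow> complex" where
  "plane_profile \<eta> y = indicator Zcell \<eta>"

interpretation plane: bloch_profile plane_profile
proof
  show "(\<lambda>z. plane_profile (fst z) (snd z)) \<in> borel_measurable (borel \<Otimes>\<^sub>M borel)"
    unfolding plane_profile_def by measurable
  show "AE \<eta> in lborel. \<eta> \<in> Zcell \<longrightarrow>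
      (\<integral>\<^sup>+y. ennreal ((cmod (plane_profile \<eta> y))\<^sup>2) * indicator (unit_cell 0) y \<partial>lborel) = 1"
    by (auto simp: plane_profile_def)
qed (auto simp: plane_profile_def)

lemma Zscaled_mono:
  assumes "0 < \<epsilon>" "\<epsilon> \<le> \<delta>"
  shows "Zscaled \<delta> \<subseteq> Zscaled \<epsilon>"
proof
  fix \<eta> :: "real^'n" assume \<eta>: "\<eta> \<in> Zscaled \<delta>"
  have "- 1/2 \<le> \<epsilon> * \<eta> $ i \<and> \<epsilon> * \<eta> $ i < 1/2" for i
  proof -
    have d: "- 1/2 \<le> \<delta> * \<eta> $ i" "\<delta> * \<eta> $ i < 1/2" using \<eta> by (auto simp: Zscaled_def Zcell_def)
    show ?thesis
    proof (cases "0 \<le> \<eta> $ i")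
      case True
      then have "\<epsilon> * \<eta> $ i \<le> \<delta> * \<eta> $ i" "0 \<le> \<epsilon> * \<eta> $ i" using assms by (auto intro: mult_right_mono)
      with d show ?thesis by linarith
    next
      case False
      then have "\<delta> * \<eta> $ i \<le> \<epsilon> * \<eta> $ i" "\<epsilon> * \<eta> $ i \<le> 0"
        using assms by (auto intro: mult_right_mono_neg mult_nonneg_nonpos)
      with d show ?thesis by linarith
    qed
  qed
  then show "\<eta> \<in> Zscaled \<epsilon>" by (simp add: Zscaled_def Zcell_def)
qed

lemma Zscaled_exhaust:
  assumes "norm \<eta> \<le> r" "r > 0" "0 < \<epsilon>" "\<epsilon> \<le> 1 / (4 * r)"
  shows "\<eta> \<in> Zscaled \<epsilon>"
proof -
  have "\<bar>\<epsilon> * \<eta> $ i\<bar> \<le> 1/4" for i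
  proof -
    have "\<bar>\<epsilon> * \<eta> $ i\<bar> = \<epsilon> * \<bar>\<eta> $ i\<bar>" using assms by (simp add: abs_mult)
    also have "\<dots> \<le> (1 / (4 * r)) * r"
      using assms component_le_norm_cart[of \<eta> i] by (intro mult_mono) auto
    also have "\<dots> = 1/4" using assms by simp
    finally show ?thesis .
  qed
  then have "- 1/2 \<le> \<epsilon> * \<eta> $ i \<and> \<epsilon> * \<eta> $ i < 1/2" for i
  proof -
    have "\<bar>\<epsilon> * \<eta> $ i\<bar> \<le> 1/4" by fact
    then show ?thesis by linarith
  qed
  then show ?thesis by (simp add: Zscaled_def Zcell_def)
qed

definition ft :: "(real^'n \<Rightarrow> complex) \<Rightarrow> real^'n \<Rightarrow> complex" where
  "ft w \<eta> = (\<integral>x. w x * cis (- (2 * pi * (x \<bullet> \<eta>))) \<partial>lborel)"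

lemma plane_wave: "\<epsilon> \<noteq> 0 \<Longrightarrow> \<eta> \<in> Zscaled \<epsilon> \<Longrightarrow> plane.wave \<epsilon> \<eta> x = cis (2 * pi * (\<eta> \<bullet> x))"
  by (simp add: plane.wave_def plane_profile_def Zscaled_def)

lemma plane_ana: "\<epsilon> \<noteq> 0 \<Longrightarrow> \<eta> \<in> Zscaled \<epsilon> \<Longrightarrow> plane.ana \<epsilon> w \<eta> = ft w \<eta>"
  by (simp add: plane.ana_def ft_def plane_wave cis_cnj inner_commute)

lemma plane_syn_eq:
  assumes "0 < \<epsilon>" "\<epsilon> \<le> \<delta>" "\<And>\<eta>. \<eta> \<notin> Zscaled \<delta> \<Longrightarrow> g \<eta> = 0"
  shows "plane.syn \<epsilon> g = plane.syn \<delta> g"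
proof
  fix x
  show "plane.syn \<epsilon> g x = plane.syn \<delta> g x"
    unfolding plane.syn_def
  proof (rule Bochner_Integration.integral_cong[OF refl])
    fix \<eta>
    show "g \<eta> * plane.wave \<epsilon> \<eta> x = g \<eta> * plane.wave \<delta> \<eta> x"
      using assms Zscaled_mono[OF assms(1,2)] by (cases "\<eta> \<in> Zscaled \<delta>") (auto simp: plane_wave subset_iff)
  qed
qed

lemma ft_meas [measurable]: "w \<in> borel_measurable borel \<Longrightarrow> ft w \<in> borel_measurable borel"
proof -
  assume [measurable]: "w \<in> borel_measurable borel"
  have "(\<lambda>\<eta>. \<integral>x. w x * cis (- (2 * pi * (x \<bullet> \<eta>))) \<partial>lborel) \<in> borel_measurable lborel"
    by (rule lborel.borel_measurable_lebesgue_integral) measurable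
  then show ?thesis by (simp add: ft_def[abs_def])
qed

text \<open>
  The estimate \<open>plane.ana_close\<close> on the cubes \<open>Z/\<epsilon>\<close> is uniform as they exhaust the frequency space,
  while the synthesis of \<open>g\<close> does not change once the cube contains its support.
\<close>

lemma ft_close:
  fixes g w :: "real^'n \<Rightarrow> complex"
  assumes \<delta>: "\<delta> > 0" and g: "sqint lborel g" "\<And>\<eta>. \<eta> \<notin> Zscaled \<delta> \<Longrightarrow> g \<eta> = 0"
    and w: "sqint lborel w" "\<And>x. x \<notin> cball 0 R \<Longrightarrow> w x = 0"
  shows "sqint lborel (\<lambda>\<eta>. ft w \<eta> - g \<eta>)"
    "n2 lborel (\<lambda>\<eta>. ft w \<eta> - g \<eta>) \<le> n2 lborel (\<lambda>x. w x - plane.syn \<delta> g x)"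
proof -
  have [measurable]: "g \<in> borel_measurable borel" "w \<in> borel_measurable borel"
    using g w by (auto simp: sqint_def)
  define \<epsilon> where "\<epsilon> = (\<lambda>j. \<delta> / real (Suc j))"
  have \<epsilon>: "0 < \<epsilon> j" "\<epsilon> j \<le> \<delta>" for j
    using \<delta> by (auto simp: \<epsilon>_def divide_le_eq mult_le_cancel_left1)
  let ?f = "\<lambda>j \<eta>. plane.ana (\<epsilon> j) w \<eta> - g \<eta>"
  have g0: "g \<eta> = 0" if "\<eta> \<notin> Zscaled (\<epsilon> j)" for \<eta> j
    using g(2) Zscaled_mono[OF \<epsilon>] that by blast
  have s: "sqint lborel (?f j)" for j
    by (intro sqint_diff g plane.ana_sqint[OF \<epsilon>(1) w])
  have b: "n2 lborel (?f j) \<le> n2 lborel (\<lambda>x. w x - plane.syn \<delta> g x)" for j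
  proof -
    have e: "plane.syn (\<epsilon> j) g = plane.syn \<delta> g"
      by (rule plane_syn_eq) (use \<epsilon> g(2) in auto)
    have "n2 lborel (?f j) \<le> n2 lborel (\<lambda>x. w x - plane.syn (\<epsilon> j) g x)"
      by (rule plane.ana_close[where R=R]) (use \<epsilon> g(1) g0 w in auto)
    then show ?thesis unfolding e .
  qed
  have lim: "(\<lambda>j. ?f j \<eta>) \<longlonglongrightarrow> ft w \<eta> - g \<eta>" for \<eta>
  proof -
    define r where "r = norm \<eta> + 1"
    have r: "norm \<eta> \<le> r" "r > 0" by (auto simp: r_def add_nonneg_pos)
    obtain j0 :: nat where j0: "4 * r * \<delta> \<le> real j0" using real_arch_simple by blast
    have "?f j \<eta> = ft w \<eta> - g \<eta>" if "j \<ge> j0" for j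
    proof -
      have "4 * r * \<delta> \<le> real (Suc j)" using j0 that by simp
      then have "\<epsilon> j \<le> 1 / (4 * r)" using r by (simp add: \<epsilon>_def field_simps)
      then have "\<eta> \<in> Zscaled (\<epsilon> j)" by (intro Zscaled_exhaust[OF r] \<epsilon>)
      then show ?thesis using plane_ana[of "\<epsilon> j" \<eta> w] \<epsilon>(1)[of j] by simp
    qed
    then show ?thesis
      by (intro tendsto_eventually) (auto simp: eventually_sequentially)
  qed
  show "sqint lborel (\<lambda>\<eta>. ft w \<eta> - g \<eta>)"
    "n2 lborel (\<lambda>\<eta>. ft w \<eta> - g \<eta>) \<le> n2 lborel (\<lambda>x. w x - plane.syn \<delta> g x)"
    using fatou_sqint[where f="?f" and v="\<lambda>\<eta>. ft w \<eta> - g \<eta>", OF s b] lim by auto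
qed

lemma ft_contraction:
  fixes w :: "real^'n \<Rightarrow> complex"
  assumes w: "sqint lborel w" "\<And>x. x \<notin> cball 0 R \<Longrightarrow> w x = 0"
  shows "sqint lborel (ft w)" "n2 lborel (ft w) \<le> n2 lborel w"
  using ft_close[where g="\<lambda>_. 0" and \<delta>=1 and w=w and R=R] w by (simp_all add: plane.syn_def)

lemma sqint_bounded_support_integrable:
  fixes w :: "real^'n \<Rightarrow> complex"
  assumes w: "sqint lborel w" "\<And>x. x \<notin> cball 0 R \<Longrightarrow> w x = 0" and c: "c \<in> borel_measurable borel" "\<And>x. cmod (c x) = 1"
  shows "integrable lborel (\<lambda>x. w x * c x)"
proof -
  have "emeasure lborel (cball (0::real^'n) R) < \<infinity>" by (intro emeasure_bounded_finite bounded_cball)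
  moreover have "(\<lambda>\<eta>::real^'n. (norm (indicator (cball 0 R) \<eta> :: real))\<^sup>2) = indicator (cball 0 R)"
    by (auto simp: indicator_def)
  ultimately have i: "sqint lborel (\<lambda>\<eta>::real^'n. indicator (cball 0 R) \<eta> :: real)"
    unfolding sqint_def by (simp add: integrable_indicator_iff)
  show ?thesis
  proof (rule Bochner_Integration.integrable_bound[OF sqint_norm_mult[OF w(1) i]])
    show "AE \<eta> in lborel. norm (w \<eta> * c \<eta>) \<le> norm (norm (w \<eta>) * norm (indicator (cball 0 R) \<eta> :: real))"
      using w(2) c(2) by (auto simp: indicator_def norm_mult)
  qed (use w c in \<open>auto simp: sqint_def\<close>)
qed

lemma ft_diff:
  fixes w v :: "real^'n \<Rightarrow> complex"
  assumes w: "sqint lborel w" "\<And>x. x \<notin> cball 0 R \<Longrightarrow> w x = 0"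
    and v: "sqint lborel v" "\<And>x. x \<notin> cball 0 R \<Longrightarrow> v x = 0"
  shows "ft (\<lambda>x. w x - v x) \<eta> = ft w \<eta> - ft v \<eta>"
proof -
  have c: "(\<lambda>x. cis (- (2 * pi * (x \<bullet> \<eta>)))) \<in> borel_measurable borel"
    by (intro borel_measurable_continuous_onI continuous_intros)
  show ?thesis
    unfolding ft_def left_diff_distrib
    by (intro Bochner_Integration.integral_diff sqint_bounded_support_integrable[OF w c]
        sqint_bounded_support_integrable[OF v c]) simp_all
qed

section \<open>The Plancherel extension\<close>

lemma fourier_L2_truncation:
  fixes u u' :: "real^'n \<Rightarrow> complex"
  assumes "AE x in lborel. u x = u' x" and [measurable]: "u' \<in> borel_measurable borel"
  shows "(LINT x:cball 0 R|lebesgue. u x * cis (- (2 * pi * (x \<bullet> \<eta>))))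
     = ft (\<lambda>x. indicat_real (cball 0 R) x *\<^sub>R u' x) \<eta>"
  unfolding set_lebesgue_integral_def ft_def
proof (rule integral_lebesgue_lborel)
  show "AE x in lborel. indicat_real (cball 0 R) x *\<^sub>R (u x * cis (- (2 * pi * (x \<bullet> \<eta>)))) =
      indicat_real (cball 0 R) x *\<^sub>R u' x * cis (- (2 * pi * (x \<bullet> \<eta>)))"
    using assms(1) by eventually_elim simp
qed measurable

lemma L2_UNIV_borel:
  fixes f :: "'a::euclidean_space \<Rightarrow> 'b::euclidean_space"
  assumes "f \<in> borel_measurable borel"
  shows "f \<in> L2 UNIV \<longleftrightarrow> sqint lborel f" "L2norm UNIV f = n2 lborel f"
  using sqint_lebesgue_lborel[of f f] assms by (auto simp: L2_iff_sqint L2norm_eq_n2)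

lemma sqint_truncate:
  fixes u :: "'a::euclidean_space \<Rightarrow> 'b::euclidean_space"
  assumes "sqint lborel u"
  shows "sqint lborel (\<lambda>x. indicat_real (cball 0 R) x *\<^sub>R u x)"
  by (rule sqint_dominated[OF assms]) (use assms in \<open>auto simp: sqint_def indicator_def\<close>)

text \<open>
  The transforms of the truncations form a Cauchy family because the transform is a contraction on
  functions of bounded support.
\<close>

lemma plancherel_exists:
  fixes u :: "real^'n \<Rightarrow> complex"
  assumes "u \<in> L2 UNIV"
  shows "\<exists>v. L2_tendsto UNIV
     (\<lambda>R \<eta>. LINT x:cball 0 R|lebesgue. u x * cis (- (2 * pi * (x \<bullet> \<eta>)))) v at_top"
proof -
  obtain u' where u': "sqint lborel u'" "AE x in lborel. u x = u' x"
    using L2_borel_representative[OF assms] by auto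
  have [measurable]: "u' \<in> borel_measurable borel" using u' by (simp add: sqint_def)
  define w where "w = (\<lambda>R x. indicat_real (cball 0 R) x *\<^sub>R u' x)"
  have [measurable]: "w R \<in> borel_measurable borel" for R unfolding w_def by measurable
  have sw: "sqint lborel (w R)" for R unfolding w_def by (rule sqint_truncate[OF u'(1)])
  have w0: "w R x = 0" if "x \<notin> cball 0 (max R R')" for R R' x using that by (auto simp: w_def)
  have tr: "(LINT x:cball 0 R|lebesgue. u x * cis (- (2 * pi * (x \<bullet> \<eta>)))) = ft (w R) \<eta>" for R \<eta>
    unfolding w_def by (rule fourier_L2_truncation[OF u'(2)]) measurable
  have tail: "((\<lambda>R. n2 lborel (\<lambda>x. w R x - u' x)) \<longlongrightarrow> 0) at_top"
    unfolding w_def by (rule truncation_tendsto[OF u'(1)])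
  have tailn: "(\<lambda>j. n2 lborel (\<lambda>x. w (real j) x - u' x)) \<longlonglongrightarrow> 0"
    by (rule filterlim_compose[OF tail filterlim_real_sequentially])
  have sf: "sqint lborel (ft (w R))" for R
    using ft_contraction(1)[OF sw, of R R] w0[of _ R R] by simp
  have diff: "n2 lborel (\<lambda>\<eta>. ft (w R) \<eta> - ft (w R') \<eta>) \<le> n2 lborel (\<lambda>x. w R x - u' x) + n2 lborel (\<lambda>x. w R' x - u' x)" for R R'
  proof -
    have e: "(\<lambda>\<eta>. ft (w R) \<eta> - ft (w R') \<eta>) = ft (\<lambda>x. w R x - w R' x)"
      by (rule ext, rule ft_diff[symmetric, where R="max R R'"])
        (use sw w0[of _ R R'] w0[of _ R' R] in \<open>auto simp: max.commute\<close>)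
    have "n2 lborel (\<lambda>\<eta>. ft (w R) \<eta> - ft (w R') \<eta>) \<le> n2 lborel (\<lambda>x. w R x - w R' x)"
      unfolding e
      by (rule ft_contraction(2)[where R="max R R'"])
        (use sw w0[of _ R R'] w0[of _ R' R] in \<open>auto simp: max.commute intro: sqint_diff\<close>)
    also have "\<dots> \<le> n2 lborel (\<lambda>x. w R x - u' x) + n2 lborel (\<lambda>x. u' x - w R' x)"
      by (rule n2_triangle3[OF sw u'(1) sw])
    finally show ?thesis by (simp add: n2_minus_commute[of _ u'])
  qed
  have "\<exists>N. \<forall>m\<ge>N. \<forall>n\<ge>N. n2 lborel (\<lambda>\<eta>. ft (w (real m)) \<eta> - ft (w (real n)) \<eta>) < e" if "e > 0" for e
  proof -
    have "\<forall>\<^sub>F j in sequentially. n2 lborel (\<lambda>x. w (real j) x - u' x) < e / 2"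
      using that by (intro order_tendstoD[OF tailn]) simp
    then obtain N where N: "\<And>j. j \<ge> N \<Longrightarrow> n2 lborel (\<lambda>x. w (real j) x - u' x) < e / 2"
      by (auto simp: eventually_sequentially)
    show ?thesis
    proof (intro exI[of _ N] allI impI)
      fix m n assume "m \<ge> N" "n \<ge> N"
      from N[OF this(1)] N[OF this(2)] diff[of "real m" "real n"]
      show "n2 lborel (\<lambda>\<eta>. ft (w (real m)) \<eta> - ft (w (real n)) \<eta>) < e" by linarith
    qed
  qed
  from sqint_complete[where u="\<lambda>j. ft (w (real j))", OF sf this]
  obtain v where v: "sqint lborel v" "(\<lambda>j. n2 lborel (\<lambda>\<eta>. ft (w (real j)) \<eta> - v \<eta>)) \<longlonglongrightarrow> 0" by auto
  have [measurable]: "v \<in> borel_measurable borel" using v by (simp add: sqint_def)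
  have est: "n2 lborel (\<lambda>\<eta>. ft (w R) \<eta> - v \<eta>) \<le> n2 lborel (\<lambda>x. w R x - u' x)" for R
  proof (rule LIMSEQ_le_const)
    show "(\<lambda>j. n2 lborel (\<lambda>x. w R x - u' x) + n2 lborel (\<lambda>x. w (real j) x - u' x)
        + n2 lborel (\<lambda>\<eta>. ft (w (real j)) \<eta> - v \<eta>)) \<longlonglongrightarrow> n2 lborel (\<lambda>x. w R x - u' x)"
      by (rule tendsto_eq_intros tailn v(2) refl | simp)+
    show "\<exists>N. \<forall>j\<ge>N. n2 lborel (\<lambda>\<eta>. ft (w R) \<eta> - v \<eta>) \<le> n2 lborel (\<lambda>x. w R x - u' x) +
        n2 lborel (\<lambda>x. w (real j) x - u' x) + n2 lborel (\<lambda>\<eta>. ft (w (real j)) \<eta> - v \<eta>)"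
    proof (intro exI[of _ 0] allI impI)
      fix j :: nat
      show "n2 lborel (\<lambda>\<eta>. ft (w R) \<eta> - v \<eta>) \<le> n2 lborel (\<lambda>x. w R x - u' x) +
        n2 lborel (\<lambda>x. w (real j) x - u' x) + n2 lborel (\<lambda>\<eta>. ft (w (real j)) \<eta> - v \<eta>)"
        using n2_triangle3[OF sf[of R] sf[of "real j"] v(1)] diff[of R "real j"] by linarith
    qed
  qed
  have "L2_tendsto UNIV (\<lambda>R. ft (w R)) v at_top"
    unfolding L2_tendsto_def
  proof (intro conjI)
    show "v \<in> L2 UNIV" using v by (simp add: L2_UNIV_borel)
    show "\<forall>\<^sub>F R in at_top. ft (w R) \<in> L2 UNIV" using sf by (simp add: L2_UNIV_borel)
    have "((\<lambda>R. n2 lborel (\<lambda>\<eta>. ft (w R) \<eta> - v \<eta>)) \<longlongrightarrow> 0) at_top"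
      by (rule tendsto_sandwich[OF _ _ tendsto_const tail]) (use est in auto)
    then show "((\<lambda>R. L2norm UNIV (\<lambda>\<eta>. ft (w R) \<eta> - v \<eta>)) \<longlongrightarrow> 0) at_top"
      by (simp add: L2_UNIV_borel)
  qed
  then show ?thesis unfolding tr by blast
qed

lemma fourier_L2_tendsto:
  assumes "u \<in> L2 UNIV"
  shows "L2_tendsto UNIV
     (\<lambda>R \<eta>. LINT x:cball 0 R|lebesgue. u x * cis (- (2 * pi * (x \<bullet> \<eta>)))) (fourier_L2 u) at_top"
  unfolding fourier_L2_def by (rule someI_ex[OF plancherel_exists[OF assms]])

lemma fourier_L2_in_L2: "u \<in> L2 UNIV \<Longrightarrow> fourier_L2 u \<in> L2 UNIV"
  using fourier_L2_tendsto by (auto simp: L2_tendsto_def)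

lemma fourier_synth_plane:
  assumes \<delta>: "\<delta> > 0" and K: "K \<in> sets borel" "K \<subseteq> Zscaled \<delta>"
    and g: "g \<in> borel_measurable borel" "AE \<eta> in lborel. indicat_real K \<eta> *\<^sub>R v \<eta> = g \<eta>" "\<And>\<eta>. \<eta> \<notin> K \<Longrightarrow> g \<eta> = 0"
  shows "fourier_synth K v = plane.syn \<delta> g"
proof
  fix x
  note [measurable] = g(1)
  show "fourier_synth K v x = plane.syn \<delta> g x"
    unfolding fourier_synth_def set_lebesgue_integral_def plane.syn_def
  proof (rule integral_lebesgue_lborel)
    show "AE \<eta> in lborel. indicat_real K \<eta> *\<^sub>R (v \<eta> * cis (2 * pi * (\<eta> \<bullet> x))) = g \<eta> * plane.wave \<delta> \<eta> x"
      using g(2)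
    proof eventually_elim
      case (elim \<eta>)
      show ?case
      proof (cases "\<eta> \<in> K")
        case True
        then show ?thesis using elim K(2) \<delta> by (auto simp: plane_wave subset_iff)
      qed (simp add: g(3))
    qed
  qed measurable
qed

text \<open>
  The function \<open>fourier_synth K v\<close> is a plane-wave packet; by \<open>ft_close\<close> the transforms of its
  truncations converge to the coefficients.
\<close>

lemma fourier_inversion:
  fixes v :: "real^'n \<Rightarrow> complex"
  assumes K: "compact K" and v: "v \<in> L2 K"
  shows "AE \<eta> in lebesgue. fourier_L2 (fourier_synth K v) \<eta> = indicat_real K \<eta> *\<^sub>R v \<eta>"
proof -
  have Kb: "K \<in> sets borel" using K by (simp add: borel_compact)
  obtain r where r: "r > 0" "\<And>\<eta>. \<eta> \<in> K \<Longrightarrow> norm \<eta> \<le> r"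
    using compact_imp_bounded[OF K] by (auto simp: bounded_pos)
  define \<delta> where "\<delta> = 1 / (4 * r)"
  have \<delta>: "\<delta> > 0" using r by (simp add: \<delta>_def)
  have sub: "K \<subseteq> Zscaled \<delta>" using Zscaled_exhaust[OF r(2) r(1) \<delta>] by (auto simp: \<delta>_def)
  obtain g where g: "sqint lborel g" "\<And>\<eta>. \<eta> \<notin> K \<Longrightarrow> g \<eta> = 0" "AE \<eta> in lborel. indicat_real K \<eta> *\<^sub>R v \<eta> = g \<eta>"
    using L2_borel_representative[OF v Kb] by blast
  have [measurable]: "g \<in> borel_measurable borel" using g by (simp add: sqint_def)
  have g0: "\<And>\<eta>. \<eta> \<notin> Zscaled \<delta> \<Longrightarrow> g \<eta> = 0" using g(2) sub by blast
  have u: "fourier_synth K v = plane.syn \<delta> g"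
    by (rule fourier_synth_plane[OF \<delta> Kb sub _ g(3,2)]) measurable
  note Sg = plane.syn_isometry[OF \<delta> g(1) g0]
  have [measurable]: "plane.syn \<delta> g \<in> borel_measurable borel" using Sg(1) by (simp add: sqint_def)
  define w where "w = (\<lambda>R x. indicat_real (cball 0 R) x *\<^sub>R plane.syn \<delta> g x)"
  have [measurable]: "w R \<in> borel_measurable borel" for R unfolding w_def by measurable
  have sw: "sqint lborel (w R)" for R unfolding w_def by (rule sqint_truncate[OF Sg(1)])
  have w0: "w R x = 0" if "x \<notin> cball 0 R" for R x using that by (auto simp: w_def)
  have tr: "(LINT x:cball 0 R|lebesgue. fourier_synth K v x * cis (- (2 * pi * (x \<bullet> \<eta>)))) = ft (w R) \<eta>" for R \<eta>
    unfolding w_def u by (rule fourier_L2_truncation) auto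
  have tail: "((\<lambda>R. n2 lborel (\<lambda>x. w R x - plane.syn \<delta> g x)) \<longlongrightarrow> 0) at_top"
    unfolding w_def by (rule truncation_tendsto[OF Sg(1)])
  have "L2_tendsto UNIV (\<lambda>R. ft (w R)) g at_top"
    unfolding L2_tendsto_def
  proof (intro conjI)
    show "g \<in> L2 UNIV" using g by (simp add: L2_UNIV_borel)
    show "\<forall>\<^sub>F R in at_top. ft (w R) \<in> L2 UNIV"
      using ft_contraction(1)[OF sw w0] by (simp add: L2_UNIV_borel)
    have "((\<lambda>R. n2 lborel (\<lambda>\<eta>. ft (w R) \<eta> - g \<eta>)) \<longlongrightarrow> 0) at_top"
      by (rule tendsto_sandwich[OF _ _ tendsto_const tail])
        (use ft_close(2)[OF \<delta> g(1) g0 sw w0] in auto)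
    then show "((\<lambda>R. L2norm UNIV (\<lambda>\<eta>. ft (w R) \<eta> - g \<eta>)) \<longlongrightarrow> 0) at_top"
      by (simp add: L2_UNIV_borel)
  qed
  moreover have "L2_tendsto UNIV (\<lambda>R. ft (w R)) (fourier_L2 (fourier_synth K v)) at_top"
  proof -
    have "fourier_synth K v \<in> L2 UNIV" unfolding u using Sg(1) by (simp add: L2_UNIV_borel)
    from fourier_L2_tendsto[OF this] show ?thesis unfolding tr .
  qed
  ultimately have "AE \<eta> in lebesgue. fourier_L2 (fourier_synth K v) \<eta> = g \<eta>"
    using L2_tendsto_unique[OF _ _ trivial_limit_at_top_linorder, of UNIV "\<lambda>R. ft (w R)" "fourier_L2 (fourier_synth K v)" g]
    by simp
  moreover have "AE \<eta> in lebesgue. indicat_real K \<eta> *\<^sub>R v \<eta> = g \<eta>" using g(3) by (simp add: AE_completion_iff)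
  ultimately show ?thesis by eventually_elim simp
qed

section \<open>The admissible set in Fourier variables\<close>

lemma AE_translate:
  fixes Q :: "'a::euclidean_space \<Rightarrow> bool"
  assumes "AE x in lborel. Q x"
  shows "AE x in lborel. Q (x + k)"
proof -
  obtain N where N: "{x. \<not> Q x} \<subseteq> N" "N \<in> null_sets lborel"
    using assms(1) by (auto elim!: AE_E simp: null_sets_def)
  then have [measurable]: "N \<in> sets borel" by auto
  have "(\<integral>\<^sup>+x. indicator N (x + k) \<partial>lborel) = (\<integral>\<^sup>+x. indicator N x \<partial>lborel)"
    by (rule nn_integral_translate) measurable
  also have "\<dots> = 0" using N(2) by (simp add: null_sets_def)
  finally have "AE x in lborel. (indicator N (x + k) :: ennreal) = 0"
    by (subst (asm) nn_integral_0_iff_AE) auto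
  then show ?thesis
    by eventually_elim (use N(1) in \<open>auto simp: indicator_def split: if_splits\<close>)
qed

text \<open>
  A profile agreeing with \<open>\<Phi>\<^sub>0\<close> off a Borel null set of pairs, as eigenfunctions are given only up to
  Lebesgue null sets.
\<close>

locale bloch_representative = bloch_profile P for P :: "real^'n \<Rightarrow> real^'n \<Rightarrow> complex" +
  fixes Phi :: "nat \<Rightarrow> real^'n \<Rightarrow> real^'n \<Rightarrow> complex" and N :: "((real^'n) \<times> (real^'n)) set"
  assumes null: "N \<in> null_sets (lborel \<Otimes>\<^sub>M lborel)"
    and repr: "\<And>\<eta> y. \<eta> \<in> Zcell \<Longrightarrow> (\<eta>, y) \<notin> N \<Longrightarrow> Phi 0 \<eta> y = P \<eta> y"

text \<open>
  A Borel representative of \<open>\<Phi>\<^sub>0\<close> on the product agrees with it on almost every section, which is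
  enough to inherit the normalisation and the periodicity.
\<close>

lemma bloch_system_representative:
  fixes A :: "real^'n \<Rightarrow> real^'n^'n"
  assumes "bloch_system A lam Phi"
  shows "\<exists>P N. bloch_representative P Phi N"
proof -
  let ?F = "\<lambda>z. indicat_real (Zcell \<times> UNIV) z *\<^sub>R (case z of (\<eta>, x) \<Rightarrow> Phi 0 \<eta> x)"
  have "?F \<in> borel_measurable lebesgue"
    using assms by (simp add: bloch_system_def set_borel_measurable_def)
  then obtain G where [measurable]: "G \<in> borel_measurable borel" and G: "AE z in lborel. ?F z = G z"
    using borel_representative by blast
  have "AE z in lborel \<Otimes>\<^sub>M lborel. ?F z = G z" by (subst lborel_prod) (rule G)
  then obtain N where N: "{z. ?F z \<noteq> G z} \<subseteq> N" "N \<in> null_sets (lborel \<Otimes>\<^sub>M lborel)"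
    by (auto elim!: AE_E simp: null_sets_def space_pair_measure)
  define P where "P = (\<lambda>\<eta> y. indicat_real Zcell \<eta> *\<^sub>R G (\<eta>, y))"
  have eq: "Phi 0 \<eta> y = P \<eta> y" if "\<eta> \<in> Zcell" "(\<eta>, y) \<notin> N" for \<eta> y
  proof -
    have "?F (\<eta>, y) = G (\<eta>, y)" using that(2) N(1) by blast
    then show ?thesis using that(1) by (simp add: P_def)
  qed
  have "AE z in lborel \<Otimes>\<^sub>M lborel. z \<notin> N" using N(2) by (rule AE_not_in)
  then have fib: "AE \<eta> in lborel. AE y in lborel. (\<eta>, y) \<notin> N"
    by (rule lborel_pair.AE_pair)
  have L2p: "Phi 0 \<eta> \<in> L2_per" if "\<eta> \<in> Zcell" for \<eta>
    using assms that by (auto simp: bloch_system_def orthonormal_basis_per_def)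
  have nrm: "inner_Y (Phi 0 \<eta>) (Phi 0 \<eta>) = 1" if "\<eta> \<in> Zcell" for \<eta>
    using assms that by (auto simp: bloch_system_def orthonormal_basis_per_def)
  have "bloch_profile P"
  proof
    have "G \<in> borel_measurable (borel \<Otimes>\<^sub>M borel)" by (simp add: borel_prod)
    then show m: "(\<lambda>z. P (fst z) (snd z)) \<in> borel_measurable (borel \<Otimes>\<^sub>M borel)"
      unfolding P_def by measurable
    show "P \<eta> y = 0" if "\<eta> \<notin> Zcell" for \<eta> y using that by (simp add: P_def)
    have Pm: "P \<eta> \<in> borel_measurable borel" for \<eta>
      using measurable_compose[OF _ m, of "\<lambda>y. (\<eta>, y)" borel] by simp
    have Yb: "Ycell \<in> sets borel" by (simp add: Ycell_cbox)
    show "AE \<eta> in lborel. \<eta> \<in> Zcell \<longrightarrow>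
      (\<integral>\<^sup>+y. ennreal ((cmod (P \<eta> y))\<^sup>2) * indicator (unit_cell 0) y \<partial>lborel) = 1"
      using fib
    proof eventually_elim
      case (elim \<eta>)
      show ?case
      proof
        assume \<eta>: "\<eta> \<in> Zcell"
        note [measurable] = Pm[of \<eta>] Yb
        have "1 = (\<integral>y. indicat_real Ycell y *\<^sub>R (Phi 0 \<eta> y * cnj (Phi 0 \<eta> y)) \<partial>lebesgue)"
          using nrm[OF \<eta>] by (simp add: inner_Y_def set_lebesgue_integral_def)
        also have "\<dots> = (\<integral>y. complex_of_real (indicat_real Ycell y * (cmod (P \<eta> y))\<^sup>2) \<partial>lborel)"
        proof (rule integral_lebesgue_lborel)
          show "AE y in lborel. indicat_real Ycell y *\<^sub>R (Phi 0 \<eta> y * cnj (Phi 0 \<eta> y)) =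
            complex_of_real (indicat_real Ycell y * (cmod (P \<eta> y))\<^sup>2)"
            using elim
            by eventually_elim (use eq[OF \<eta>] in \<open>auto simp: scaleR_conv_of_real complex_norm_square[symmetric]\<close>)
        qed measurable
        also have "\<dots> = complex_of_real (\<integral>y. indicat_real Ycell y * (cmod (P \<eta> y))\<^sup>2 \<partial>lborel)"
          by (rule integral_complex_of_real)
        finally have 1: "(\<integral>y. indicat_real Ycell y * (cmod (P \<eta> y))\<^sup>2 \<partial>lborel) = 1"
          by (metis of_real_eq_1_iff)
        have i: "integrable lborel (\<lambda>y. indicat_real Ycell y * (cmod (P \<eta> y))\<^sup>2)"
        proof (rule ccontr)
          assume "\<not> ?thesis"
          from not_integrable_integral_eq[OF this] show False unfolding 1 by simp
        qed
        have "(\<integral>\<^sup>+y. ennreal ((cmod (P \<eta> y))\<^sup>2) * indicator (unit_cell 0) y \<partial>lborel) =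
          (\<integral>\<^sup>+y. ennreal (indicat_real Ycell y * (cmod (P \<eta> y))\<^sup>2) \<partial>lborel)"
          using AE_Ycell by (intro nn_integral_cong_AE) (auto simp: indicator_def elim!: eventually_mono)
        also have "\<dots> = ennreal 1"
          unfolding 1[symmetric] by (rule nn_integral_eq_integral[OF i]) auto
        finally show "(\<integral>\<^sup>+y. ennreal ((cmod (P \<eta> y))\<^sup>2) * indicator (unit_cell 0) y \<partial>lborel) = 1" by simp
      qed
    qed
    show "AE \<eta> in lborel. AE y in lborel. P \<eta> (y + k) = P \<eta> y" if k: "k \<in> lattice" for k
      using fib
    proof eventually_elim
      case (elim \<eta>)
      show ?case
      proof (cases "\<eta> \<in> Zcell")
        case True
        have "AE y in lebesgue. Phi 0 \<eta> (y + k) = Phi 0 \<eta> y"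
          using L2p[OF True] k by (simp add: L2_per_def Y_periodic_def lattice_def)
        then have "AE y in lborel. Phi 0 \<eta> (y + k) = Phi 0 \<eta> y" by (simp add: AE_completion_iff)
        with elim AE_translate[OF elim, of k] show ?thesis
          by eventually_elim (use eq[OF True] in auto)
      qed (simp add: P_def)
    qed
  qed
  then have "bloch_representative P Phi N"
    by (rule bloch_representative.intro) (unfold_locales, use N(2) eq in auto)
  then show ?thesis by blast
qed

context bloch_representative
begin

text \<open>
  The exceptional null set is Borel in the product, so its sections are null in both orders.
\<close>

lemma fiber_AE:
  assumes \<epsilon>: "\<epsilon> > 0"
  shows "AE x in lborel. AE \<eta> in lborel. \<eta> \<in> Zscaled \<epsilon> \<longrightarrow> bloch_wave Phi \<epsilon> 0 \<eta> x = wave \<epsilon> \<eta> x"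
    "AE \<eta> in lborel. \<eta> \<in> Zscaled \<epsilon> \<longrightarrow> (AE x in lborel. bloch_wave Phi \<epsilon> 0 \<eta> x = wave \<epsilon> \<eta> x)"
proof -
  have inv: "inverse \<epsilon> \<noteq> 0" "\<epsilon> \<noteq> 0" using \<epsilon> by auto
  have Nm: "N \<in> sets (lborel \<Otimes>\<^sub>M lborel)" using null by auto
  have "AE z in lborel \<Otimes>\<^sub>M lborel. z \<notin> N" using null by (rule AE_not_in)
  then have 1: "AE \<eta> in lborel. AE y in lborel. (\<eta>, y) \<notin> N" by (rule lborel_pair.AE_pair)
  have "{z \<in> space (lborel \<Otimes>\<^sub>M lborel). (fst z, snd z) \<notin> N} \<in> sets (lborel \<Otimes>\<^sub>M lborel)"
  proof -
    have "{z \<in> space (lborel \<Otimes>\<^sub>M lborel). (fst z, snd z) \<notin> N} = space (lborel \<Otimes>\<^sub>M lborel) - N" by auto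
    also have "\<dots> \<in> sets (lborel \<Otimes>\<^sub>M lborel)" using Nm by (rule sets.compl_sets)
    finally show ?thesis .
  qed
  with 1 have 2: "AE y in lborel. AE \<eta> in lborel. (\<eta>, y) \<notin> N"
    by (subst (asm) lborel_pair.AE_commute) auto
  show "AE x in lborel. AE \<eta> in lborel. \<eta> \<in> Zscaled \<epsilon> \<longrightarrow> bloch_wave Phi \<epsilon> 0 \<eta> x = wave \<epsilon> \<eta> x"
    using AE_scale[OF 2 inv(1)]
  proof eventually_elim
    case (elim x)
    from AE_scale[OF elim inv(2)] show ?case
      by eventually_elim (auto simp: bloch_wave_def wave_def Zscaled_def repr)
  qed
  show "AE \<eta> in lborel. \<eta> \<in> Zscaled \<epsilon> \<longrightarrow> (AE x in lborel. bloch_wave Phi \<epsilon> 0 \<eta> x = wave \<epsilon> \<eta> x)"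
    using AE_scale[OF 1 inv(2)]
  proof eventually_elim
    case (elim \<eta>)
    show ?case
    proof
      assume \<eta>: "\<eta> \<in> Zscaled \<epsilon>"
      show "AE x in lborel. bloch_wave Phi \<epsilon> 0 \<eta> x = wave \<epsilon> \<eta> x"
        using AE_scale[OF elim inv(1)]
        by eventually_elim (use \<eta> in \<open>auto simp: bloch_wave_def wave_def Zscaled_def repr\<close>)
    qed
  qed
qed

lemma bloch_synth_syn:
  assumes \<epsilon>: "\<epsilon> > 0" and S: "S \<in> sets borel" "S \<subseteq> Zscaled \<epsilon>"
    and [measurable]: "c' \<in> borel_measurable borel" and c': "\<And>\<eta>. \<eta> \<notin> S \<Longrightarrow> c' \<eta> = 0"
    "AE \<eta> in lborel. indicat_real S \<eta> *\<^sub>R c \<eta> = c' \<eta>"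
  shows "AE x in lborel. bloch_synth Phi \<epsilon> S c x = syn \<epsilon> c' x"
  using fiber_AE(1)[OF \<epsilon>]
proof eventually_elim
  case (elim x)
  show ?case
    unfolding bloch_synth_def set_lebesgue_integral_def syn_def
  proof (rule integral_lebesgue_lborel)
    show "AE \<eta> in lborel. indicat_real S \<eta> *\<^sub>R (c \<eta> * bloch_wave Phi \<epsilon> 0 \<eta> x) = c' \<eta> * wave \<epsilon> \<eta> x"
      using elim c'(2)
    proof eventually_elim
      case (elim \<eta>)
      then show ?case using S(2) c'(1)[of \<eta>] by (cases "\<eta> \<in> S") auto
    qed
  qed measurable
qed

text \<open>
  The truncated integrals agree with the analysis map applied to truncations of the packet, and these
  converge to \<open>g\<close>; limits in \<open>L\<^sup>2\<close> are unique.
\<close>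

lemma bloch_coeff_syn:
  assumes \<epsilon>: "\<epsilon> > 0" and g: "sqint lborel g" "\<And>\<eta>. \<eta> \<notin> Zscaled \<epsilon> \<Longrightarrow> g \<eta> = 0"
    and u: "AE x in lborel. u x = syn \<epsilon> g x"
  shows "AE \<eta> in lebesgue. \<eta> \<in> Zscaled \<epsilon> \<longrightarrow> bloch_coeff Phi \<epsilon> 0 u \<eta> = g \<eta>"
proof -
  have [measurable]: "g \<in> borel_measurable borel" using g by (simp add: sqint_def)
  note Sg = syn_isometry[OF \<epsilon> g]
  define w where "w = (\<lambda>R x. indicat_real (cball 0 R) x *\<^sub>R syn \<epsilon> g x)"
  have [measurable]: "w R \<in> borel_measurable borel" for R unfolding w_def by measurable
  have sw: "sqint lborel (w R)" for R unfolding w_def by (rule sqint_truncate[OF Sg(1)])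
  have w0: "w R x = 0" if "x \<notin> cball 0 R" for R x using that by (auto simp: w_def)
  let ?T = "\<lambda>R \<eta>. LINT x:cball 0 R|lebesgue. u x * cnj (bloch_wave Phi \<epsilon> 0 \<eta> x)"
  let ?e = "\<lambda>f \<eta>. indicat_real (Zscaled \<epsilon>) \<eta> *\<^sub>R (f \<eta> :: complex)"
  have T: "AE \<eta> in lborel. \<eta> \<in> Zscaled \<epsilon> \<longrightarrow> ?T R \<eta> = ana \<epsilon> (w R) \<eta>" for R
    using fiber_AE(2)[OF \<epsilon>]
  proof eventually_elim
    case (elim \<eta>)
    show ?case
    proof
      assume "\<eta> \<in> Zscaled \<epsilon>"
      then have e: "AE x in lborel. bloch_wave Phi \<epsilon> 0 \<eta> x = wave \<epsilon> \<eta> x" using elim by simp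
      show "?T R \<eta> = ana \<epsilon> (w R) \<eta>"
        unfolding set_lebesgue_integral_def ana_def
      proof (rule integral_lebesgue_lborel)
        show "AE x in lborel. indicat_real (cball 0 R) x *\<^sub>R (u x * cnj (bloch_wave Phi \<epsilon> 0 \<eta> x)) =
            w R x * cnj (wave \<epsilon> \<eta> x)"
          using e u by eventually_elim (simp add: w_def)
      qed measurable
    qed
  qed
  have eT: "AE \<eta> in lborel. ?e (?T R) \<eta> = ana \<epsilon> (w R) \<eta>" for R
    using T[of R] by eventually_elim (auto simp: indicator_def ana_zero)
  have "L2_tendsto (Zscaled \<epsilon>) ?T g at_top"
    unfolding L2_tendsto_def
  proof (intro conjI)
    have ge: "?e g = g" using g(2) by (auto simp: indicator_def)
    show "g \<in> L2 (Zscaled \<epsilon>)"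
      unfolding L2_iff_sqint ge using g(1) sqint_lebesgue_lborel(1)[of g g] by simp
    have "?T R \<in> L2 (Zscaled \<epsilon>)" for R
      unfolding L2_iff_sqint using sqint_lebesgue_lborel(1)[OF eT] ana_sqint[OF \<epsilon> sw w0] by simp
    then show "\<forall>\<^sub>F R in at_top. ?T R \<in> L2 (Zscaled \<epsilon>)" by simp
    have "L2norm (Zscaled \<epsilon>) (\<lambda>\<eta>. ?T R \<eta> - g \<eta>) = n2 lborel (\<lambda>\<eta>. ana \<epsilon> (w R) \<eta> - g \<eta>)" for R
      unfolding L2norm_eq_n2
    proof (rule sqint_lebesgue_lborel(2))
      show "AE \<eta> in lborel. ?e (\<lambda>\<eta>. ?T R \<eta> - g \<eta>) \<eta> = ana \<epsilon> (w R) \<eta> - g \<eta>"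
        using T[of R] by eventually_elim (auto simp: indicator_def ana_zero g(2))
    qed measurable
    moreover have "((\<lambda>R. n2 lborel (\<lambda>\<eta>. ana \<epsilon> (w R) \<eta> - g \<eta>)) \<longlongrightarrow> 0) at_top"
    proof (rule tendsto_sandwich[OF _ _ tendsto_const])
      show "((\<lambda>R. n2 lborel (\<lambda>x. w R x - syn \<epsilon> g x)) \<longlongrightarrow> 0) at_top"
        unfolding w_def by (rule truncation_tendsto[OF Sg(1)])
      show "\<forall>\<^sub>F R in at_top. n2 lborel (\<lambda>\<eta>. ana \<epsilon> (w R) \<eta> - g \<eta>) \<le> n2 lborel (\<lambda>x. w R x - syn \<epsilon> g x)"
        using ana_close[OF \<epsilon> g sw w0] by simp
    qed simp
    ultimately show "((\<lambda>R. L2norm (Zscaled \<epsilon>) (\<lambda>\<eta>. ?T R \<eta> - g \<eta>)) \<longlongrightarrow> 0) at_top" by simp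
  qed
  moreover from this have "L2_tendsto (Zscaled \<epsilon>) ?T (bloch_coeff Phi \<epsilon> 0 u) at_top"
    unfolding bloch_coeff_def by (rule someI[where P="\<lambda>c. L2_tendsto (Zscaled \<epsilon>) ?T c at_top"])
  ultimately show ?thesis
    by (rule L2_tendsto_unique[OF _ _ trivial_limit_at_top_linorder, rotated])
qed

text \<open>
  Adaption replaces plane waves by Bloch waves and keeps the Fourier coefficients.
\<close>

lemma adaption_fourier_synth:
  assumes \<epsilon>: "\<epsilon> > 0" and K: "compact K" "K \<subseteq> Zscaled \<epsilon>" and v: "v \<in> L2 K"
  shows "adaption Phi \<epsilon> (fourier_synth K v) = bloch_synth Phi \<epsilon> K v"
proof
  fix x
  show "adaption Phi \<epsilon> (fourier_synth K v) x = bloch_synth Phi \<epsilon> K v x"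
    unfolding adaption_def bloch_synth_def set_lebesgue_integral_def
  proof (rule lebesgue_integral_cong_AE')
    show "AE \<eta> in lebesgue. indicat_real (Zscaled \<epsilon>) \<eta> *\<^sub>R (fourier_L2 (fourier_synth K v) \<eta> * bloch_wave Phi \<epsilon> 0 \<eta> x)
       = indicat_real K \<eta> *\<^sub>R (v \<eta> * bloch_wave Phi \<epsilon> 0 \<eta> x)"
      using fourier_inversion[OF K(1) v]
    proof eventually_elim
      case (elim \<eta>)
      then show ?case using K(2) by (cases "\<eta> \<in> K") (auto simp: indicator_def)
    qed
  qed
qed

text \<open>
  The admissible set is described through Bloch synthesis alone; no Fourier transform remains.
\<close>

lemma Uhat_iff:
  assumes \<epsilon>: "\<epsilon> > 0" and K: "compact K" "K \<subseteq> Zscaled \<epsilon>"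
  shows "v \<in> Uhat Phi K Uad \<epsilon> \<longleftrightarrow> v \<in> L2 K \<and> real_member (bloch_synth Phi \<epsilon> K v) (Uad \<epsilon>)"
proof -
  have "v \<in> Uhat Phi K Uad \<epsilon> \<longleftrightarrow> v \<in> L2 K \<and> real_member (adaption Phi \<epsilon> (fourier_synth K v)) (Uad \<epsilon>)"
    unfolding Uhat_def Ustar_def by blast
  then show ?thesis using adaption_fourier_synth[OF assms, of v] by auto
qed

text \<open>
  The Bloch coefficient of the adaption of \<open>u\<^sub>0\<close> is the Fourier transform of \<open>u\<^sub>0\<close>, so projecting onto
  \<open>K\<close> shows that this transform is admissible. It is the same function for all \<open>\<epsilon>\<close>, which provides a
  uniformly bounded competitor.
\<close>

lemma fourier_data_in_Uhat:
  assumes adm: "admissible_sets Phi K Uad" and K: "compact K"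
  shows "\<exists>v0\<in>L2 K. \<forall>\<epsilon>>0. K \<subseteq> Zscaled \<epsilon> \<longrightarrow> v0 \<in> Uhat Phi K Uad \<epsilon>"
proof -
  obtain u0 where u0: "u0 \<in> L2 UNIV"
    "\<And>\<epsilon>. \<epsilon> > 0 \<Longrightarrow> real_member (adaption Phi \<epsilon> (\<lambda>x. complex_of_real (u0 x))) (Uad \<epsilon>)"
    using adm by (auto simp: admissible_sets_def)
  define v0 where "v0 = fourier_L2 (\<lambda>x. complex_of_real (u0 x))"
  have "(\<lambda>x. complex_of_real (u0 x)) \<in> L2 UNIV"
    using u0(1) by (auto simp: L2_iff_sqint sqint_def)
  then have v0: "v0 \<in> L2 UNIV" unfolding v0_def by (rule fourier_L2_in_L2)
  have sub: "v0 \<in> L2 S" if "S \<in> sets borel" for S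
  proof -
    have "sqint lebesgue v0" using v0 by (simp add: L2_iff_sqint)
    then have "sqint lebesgue (\<lambda>x. indicat_real S x *\<^sub>R v0 x)"
    proof (rule sqint_dominated)
      have "S \<in> sets lebesgue" using that by auto
      then show "(\<lambda>x. indicat_real S x *\<^sub>R v0 x) \<in> borel_measurable lebesgue"
        using \<open>sqint lebesgue v0\<close> by (intro borel_measurable_scaleR borel_measurable_indicator) (auto simp: sqint_def)
    qed (auto simp: indicator_def)
    then show ?thesis by (simp add: L2_iff_sqint)
  qed
  have Kb: "K \<in> sets borel" using K by (simp add: borel_compact)
  have "v0 \<in> Uhat Phi K Uad \<epsilon>" if \<epsilon>: "\<epsilon> > 0" and KZ: "K \<subseteq> Zscaled \<epsilon>" for \<epsilon>
  proof -
    obtain g where g: "sqint lborel g" "\<And>\<eta>. \<eta> \<notin> Zscaled \<epsilon> \<Longrightarrow> g \<eta> = 0"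
      "AE \<eta> in lborel. indicat_real (Zscaled \<epsilon>) \<eta> *\<^sub>R v0 \<eta> = g \<eta>"
      using L2_borel_representative[OF sub[OF Zscaled_borel] Zscaled_borel] by blast
    have [measurable]: "g \<in> borel_measurable borel" using g by (simp add: sqint_def)
    obtain u where u: "u \<in> Uad \<epsilon>" "AE x in lebesgue. adaption Phi \<epsilon> (\<lambda>x. complex_of_real (u0 x)) x = complex_of_real (u x)"
      using u0(2)[OF \<epsilon>] by (auto simp: real_member_def)
    have "AE x in lborel. adaption Phi \<epsilon> (\<lambda>x. complex_of_real (u0 x)) x = syn \<epsilon> g x"
      unfolding adaption_def v0_def[symmetric]
      by (rule bloch_synth_syn[OF \<epsilon>]) (use g in auto)
    moreover have "AE x in lborel. adaption Phi \<epsilon> (\<lambda>x. complex_of_real (u0 x)) x = complex_of_real (u x)"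
      using u(2) by (simp add: AE_completion_iff)
    ultimately have ug: "AE x in lborel. complex_of_real (u x) = syn \<epsilon> g x"
      by eventually_elim simp
    from bloch_coeff_syn[OF \<epsilon> g(1,2) this]
    have coeff: "AE \<eta> in lebesgue. \<eta> \<in> Zscaled \<epsilon> \<longrightarrow> bloch_coeff Phi \<epsilon> 0 (\<lambda>x. complex_of_real (u x)) \<eta> = g \<eta>" .
    have "bloch_synth Phi \<epsilon> K (bloch_coeff Phi \<epsilon> 0 (\<lambda>x. complex_of_real (u x))) = bloch_synth Phi \<epsilon> K v0"
    proof
      fix x
      have g3: "AE \<eta> in lebesgue. indicat_real (Zscaled \<epsilon>) \<eta> *\<^sub>R v0 \<eta> = g \<eta>"
        using g(3) by (simp add: AE_completion_iff)
      show "bloch_synth Phi \<epsilon> K (bloch_coeff Phi \<epsilon> 0 (\<lambda>x. complex_of_real (u x))) x = bloch_synth Phi \<epsilon> K v0 x"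
        unfolding bloch_synth_def set_lebesgue_integral_def
      proof (rule lebesgue_integral_cong_AE')
        show "AE \<eta> in lebesgue. indicat_real K \<eta> *\<^sub>R (bloch_coeff Phi \<epsilon> 0 (\<lambda>x. complex_of_real (u x)) \<eta> * bloch_wave Phi \<epsilon> 0 \<eta> x)
           = indicat_real K \<eta> *\<^sub>R (v0 \<eta> * bloch_wave Phi \<epsilon> 0 \<eta> x)"
          using coeff g3
        proof eventually_elim
          case (elim \<eta>)
          show ?case
          proof (cases "\<eta> \<in> K")
            case True
            then have "\<eta> \<in> Zscaled \<epsilon>" using KZ by blast
            with elim show ?thesis by simp
          qed simp
        qed
      qed
    qed
    moreover have "real_member (bloch_synth Phi \<epsilon> K (bloch_coeff Phi \<epsilon> 0 (\<lambda>x. complex_of_real (u x)))) (Uad \<epsilon>)"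
      using adm \<epsilon> KZ u(1) by (auto simp: admissible_sets_def)
    ultimately show ?thesis using Uhat_iff[OF \<epsilon> K KZ] sub[OF Kb] by simp
  qed
  then show ?thesis using sub[OF Kb] by blast
qed

lemma Uhat_convex:
  assumes adm: "admissible_sets Phi K Uad" and \<epsilon>: "\<epsilon> > 0" and K: "compact K" "K \<subseteq> Zscaled \<epsilon>"
  shows "L2_convex (Uhat Phi K Uad \<epsilon>)"
  unfolding L2_convex_def
proof (intro ballI)
  fix u v :: "real^'n \<Rightarrow> complex" and t :: real
  assume u: "u \<in> Uhat Phi K Uad \<epsilon>" and v: "v \<in> Uhat Phi K Uad \<epsilon>" and t: "t \<in> {0..1}"
  have Kb: "K \<in> sets borel" using K by (simp add: borel_compact)
  have Kl: "K \<in> sets lebesgue" using Kb by auto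
  have L: "u \<in> L2 K" "v \<in> L2 K" using u v Uhat_iff[OF \<epsilon> K] by auto
  obtain gu where gu: "gu \<in> Uad \<epsilon>" "AE x in lborel. bloch_synth Phi \<epsilon> K u x = complex_of_real (gu x)"
    using u Uhat_iff[OF \<epsilon> K, of u] unfolding real_member_def AE_completion_iff by blast
  obtain gv where gv: "gv \<in> Uad \<epsilon>" "AE x in lborel. bloch_synth Phi \<epsilon> K v x = complex_of_real (gv x)"
    using v Uhat_iff[OF \<epsilon> K, of v] unfolding real_member_def AE_completion_iff by blast
  obtain cu where cu: "sqint lborel cu" "\<And>\<eta>. \<eta> \<notin> K \<Longrightarrow> cu \<eta> = 0" "AE \<eta> in lborel. indicat_real K \<eta> *\<^sub>R u \<eta> = cu \<eta>"
    using L2_borel_representative[OF L(1) Kb] by blast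
  obtain cv where cv: "sqint lborel cv" "\<And>\<eta>. \<eta> \<notin> K \<Longrightarrow> cv \<eta> = 0" "AE \<eta> in lborel. indicat_real K \<eta> *\<^sub>R v \<eta> = cv \<eta>"
    using L2_borel_representative[OF L(2) Kb] by blast
  have [measurable]: "cu \<in> borel_measurable borel" "cv \<in> borel_measurable borel"
    using cu cv by (auto simp: sqint_def)
  let ?w = "\<lambda>\<eta>. u \<eta> + t *\<^sub>R (v \<eta> - u \<eta>)"
  let ?c = "\<lambda>\<eta>. cu \<eta> + t *\<^sub>R (cv \<eta> - cu \<eta>)"
  have w: "?w \<in> L2 K"
    using L unfolding L2_iff_sqint_on[OF Kl] by (intro sqint_add sqint_scaleR sqint_diff)
  have "AE x in lborel. bloch_synth Phi \<epsilon> K ?w x = syn \<epsilon> ?c x"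
  proof (rule bloch_synth_syn[OF \<epsilon> Kb K(2)])
    show "AE \<eta> in lborel. indicat_real K \<eta> *\<^sub>R ?w \<eta> = ?c \<eta>"
      using cu(3) cv(3) by eventually_elim (auto simp: indicator_def split: if_splits)
  qed (use cu cv in auto)
  moreover have "AE x in lborel. bloch_synth Phi \<epsilon> K u x = syn \<epsilon> cu x"
    by (rule bloch_synth_syn[OF \<epsilon> Kb K(2)]) (use cu in auto)
  moreover have "AE x in lborel. bloch_synth Phi \<epsilon> K v x = syn \<epsilon> cv x"
    by (rule bloch_synth_syn[OF \<epsilon> Kb K(2)]) (use cv in auto)
  moreover have "AE x in lborel. syn \<epsilon> ?c x = syn \<epsilon> cu x + t *\<^sub>R (syn \<epsilon> cv x - syn \<epsilon> cu x)"
    using fiber_integrable[OF \<epsilon> cu(1)] fiber_integrable[OF \<epsilon> cv(1)]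
  proof eventually_elim
    case (elim x)
    have "syn \<epsilon> ?c x = (\<integral>\<eta>. cu \<eta> * wave \<epsilon> \<eta> x + t *\<^sub>R (cv \<eta> * wave \<epsilon> \<eta> x - cu \<eta> * wave \<epsilon> \<eta> x) \<partial>lborel)"
      unfolding syn_def by (intro Bochner_Integration.integral_cong refl) (simp add: scaleR_conv_of_real algebra_simps)
    also have "\<dots> = syn \<epsilon> cu x + t *\<^sub>R (syn \<epsilon> cv x - syn \<epsilon> cu x)"
      unfolding syn_def using elim by simp
    finally show ?case .
  qed
  ultimately have "AE x in lborel. bloch_synth Phi \<epsilon> K ?w x = complex_of_real ((1 - t) * gu x + t * gv x)"
    using gu(2) gv(2) by eventually_elim (simp add: scaleR_conv_of_real algebra_simps)
  moreover have "(\<lambda>x. (1 - t) * gu x + t * gv x) \<in> Uad \<epsilon>"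
    using adm \<epsilon> gu(1) gv(1) t by (auto simp: admissible_sets_def fun_convex_def)
  ultimately have "real_member (bloch_synth Phi \<epsilon> K ?w) (Uad \<epsilon>)"
    unfolding real_member_def AE_completion_iff
    by (intro bexI[where x="\<lambda>x. (1 - t) * gu x + t * gv x"]) assumption+
  with w show "?w \<in> Uhat Phi K Uad \<epsilon>" using Uhat_iff[OF \<epsilon> K] by simp
qed

text \<open>
  Bloch synthesis preserves distances, so convergence of the coefficients gives convergence of the
  packets. Their limit is real up to a null set because the distance to the real functions \<open>g k\<close>
  dominates its imaginary part.
\<close>

lemma Uhat_closed:
  assumes adm: "admissible_sets Phi K Uad" and \<epsilon>: "\<epsilon> > 0" and K: "compact K" "K \<subseteq> Zscaled \<epsilon>"
  shows "L2_seq_closed (lebesgue_on K) (Uhat Phi K Uad \<epsilon>)"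
  unfolding L2_seq_closed_def
proof (intro allI impI)
  fix u :: "nat \<Rightarrow> real^'n \<Rightarrow> complex" and v
  assume u: "\<forall>k. u k \<in> Uhat Phi K Uad \<epsilon>" and v: "sqint (lebesgue_on K) v"
    and lim: "(\<lambda>k. n2 (lebesgue_on K) (\<lambda>x. u k x - v x)) \<longlonglongrightarrow> 0"
  have Kb: "K \<in> sets borel" using K by (simp add: borel_compact)
  have Kl: "K \<in> sets lebesgue" using Kb by auto
  have L: "u k \<in> L2 K" "v \<in> L2 K" for k using u v Uhat_iff[OF \<epsilon> K] L2_iff_sqint_on[OF Kl] by auto
  have "\<forall>k. \<exists>g. g \<in> Uad \<epsilon> \<and> (AE x in lborel. bloch_synth Phi \<epsilon> K (u k) x = complex_of_real (g x))"
    using u Uhat_iff[OF \<epsilon> K] unfolding real_member_def AE_completion_iff by blast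
  from choice[OF this] obtain g where
    g': "\<forall>k. g k \<in> Uad \<epsilon> \<and> (AE x in lborel. bloch_synth Phi \<epsilon> K (u k) x = complex_of_real (g k x))" ..
  then have g: "g k \<in> Uad \<epsilon>" "AE x in lborel. bloch_synth Phi \<epsilon> K (u k) x = complex_of_real (g k x)" for k
    by simp_all
  have "\<forall>k. \<exists>c. sqint lborel c \<and> (\<forall>\<eta>. \<eta> \<notin> K \<longrightarrow> c \<eta> = 0) \<and> (AE \<eta> in lborel. indicat_real K \<eta> *\<^sub>R u k \<eta> = c \<eta>)"
    by (intro allI L2_borel_representative[OF L(1) Kb])
  from choice[OF this] obtain c where
    c': "\<forall>k. sqint lborel (c k) \<and> (\<forall>\<eta>. \<eta> \<notin> K \<longrightarrow> c k \<eta> = 0) \<and> (AE \<eta> in lborel. indicat_real K \<eta> *\<^sub>R u k \<eta> = c k \<eta>)" ..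
  then have c: "sqint lborel (c k)" "\<And>\<eta>. \<eta> \<notin> K \<Longrightarrow> c k \<eta> = 0"
    "AE \<eta> in lborel. indicat_real K \<eta> *\<^sub>R u k \<eta> = c k \<eta>" for k by simp_all
  obtain d where d: "sqint lborel d" "\<And>\<eta>. \<eta> \<notin> K \<Longrightarrow> d \<eta> = 0" "AE \<eta> in lborel. indicat_real K \<eta> *\<^sub>R v \<eta> = d \<eta>"
    using L2_borel_representative[OF L(2) Kb] by blast
  have [measurable]: "c k \<in> borel_measurable borel" "d \<in> borel_measurable borel" for k
    using c d by (auto simp: sqint_def)
  have c0: "c k \<eta> = 0" "d \<eta> = 0" if "\<eta> \<notin> Zscaled \<epsilon>" for k \<eta> using that K(2) c(2) d(2) by blast+
  have Sc: "AE x in lborel. bloch_synth Phi \<epsilon> K (u k) x = syn \<epsilon> (c k) x" for k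
    by (rule bloch_synth_syn[OF \<epsilon> Kb K(2)]) (use c in auto)
  have Sd: "AE x in lborel. bloch_synth Phi \<epsilon> K v x = syn \<epsilon> d x"
    by (rule bloch_synth_syn[OF \<epsilon> Kb K(2)]) (use d in auto)
  have sd: "sqint lborel (syn \<epsilon> d)" using syn_isometry(1)[OF \<epsilon> d(1)] c0 by blast
  have sc: "sqint lborel (syn \<epsilon> (c k))" for k using syn_isometry(1)[OF \<epsilon> c(1)] c0 by blast
  have dist: "n2 lborel (\<lambda>x. syn \<epsilon> (c k) x - syn \<epsilon> d x) = n2 (lebesgue_on K) (\<lambda>x. u k x - v x)" for k
  proof -
    have "n2 lborel (\<lambda>x. syn \<epsilon> (c k) x - syn \<epsilon> d x) = n2 lborel (syn \<epsilon> (\<lambda>\<eta>. c k \<eta> - d \<eta>))"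
      using syn_diff[OF \<epsilon> c(1)[of k] d(1)] by (intro n2_cong_AE) (auto elim: eventually_mono)
    also have "\<dots> = n2 lborel (\<lambda>\<eta>. c k \<eta> - d \<eta>)"
      by (rule syn_isometry(2)[OF \<epsilon> sqint_diff[OF c(1) d(1)]]) (simp add: c0)
    also have "\<dots> = n2 lebesgue (\<lambda>\<eta>. indicat_real K \<eta> *\<^sub>R (u k \<eta> - v \<eta>))"
    proof (rule sqint_lebesgue_lborel(2)[symmetric])
      show "AE \<eta> in lborel. indicat_real K \<eta> *\<^sub>R (u k \<eta> - v \<eta>) = c k \<eta> - d \<eta>"
        using c(3)[of k] d(3) by eventually_elim (simp add: scaleR_diff_right)
    qed measurable
    also have "\<dots> = n2 (lebesgue_on K) (\<lambda>x. u k x - v x)"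
      using L2norm_eq_n2 L2norm_eq_n2_on[OF Kl] by metis
    finally show ?thesis .
  qed
  define h where "h = (\<lambda>x. Re (syn \<epsilon> d x))"
  have [measurable]: "h \<in> borel_measurable borel" unfolding h_def by measurable
  have gL: "g k \<in> L2 UNIV" for k using adm \<epsilon> g(1) by (auto simp: admissible_sets_def)
  have close: "AE x in lborel. \<bar>g k x - h x\<bar> \<le> cmod (syn \<epsilon> (c k) x - syn \<epsilon> d x) \<and>
      \<bar>Im (syn \<epsilon> d x)\<bar> \<le> cmod (syn \<epsilon> (c k) x - syn \<epsilon> d x)" for k
    using g(2)[of k] Sc[of k]
  proof eventually_elim
    case (elim x)
    then have e: "syn \<epsilon> (c k) x = complex_of_real (g k x)" by simp
    show ?case
      unfolding e h_def
      using abs_Re_le_cmod[of "complex_of_real (g k x) - syn \<epsilon> d x"]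
        abs_Im_le_cmod[of "complex_of_real (g k x) - syn \<epsilon> d x"] by simp
  qed
  have sh: "sqint lborel h"
    by (rule sqint_dominated[OF sd]) (auto simp: h_def abs_Re_le_cmod)
  have gh: "L2_tendsto UNIV g h sequentially"
    unfolding L2_tendsto_def
  proof (intro conjI)
    show "h \<in> L2 UNIV" using sh by (simp add: L2_UNIV_borel)
    show "\<forall>\<^sub>F k in sequentially. g k \<in> L2 UNIV" using gL by simp
    have "L2norm UNIV (\<lambda>x. g k x - h x) \<le> n2 (lebesgue_on K) (\<lambda>x. u k x - v x)" for k
    proof -
      have s: "sqint lebesgue (\<lambda>x. syn \<epsilon> (c k) x - syn \<epsilon> d x)"
        using sqint_lebesgue_lborel(1)[of "\<lambda>x. syn \<epsilon> (c k) x - syn \<epsilon> d x" "\<lambda>x. syn \<epsilon> (c k) x - syn \<epsilon> d x"]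
          sqint_diff[OF sc sd] by simp
      have "L2norm UNIV (\<lambda>x. g k x - h x) = n2 lebesgue (\<lambda>x. g k x - h x)"
        by (simp add: L2norm_eq_n2)
      also have "\<dots> \<le> n2 lebesgue (\<lambda>x. syn \<epsilon> (c k) x - syn \<epsilon> d x)"
      proof (rule n2_mono[OF s])
        have "g k \<in> borel_measurable lebesgue" using gL[of k] by (simp add: L2_iff_sqint sqint_def)
        moreover have "h \<in> borel_measurable lebesgue" by (intro measurable_completion) simp
        ultimately show "(\<lambda>x. g k x - h x) \<in> borel_measurable lebesgue" by simp
        show "AE x in lebesgue. norm (g k x - h x) \<le> norm (syn \<epsilon> (c k) x - syn \<epsilon> d x)"
          using close[of k] unfolding AE_completion_iff by (auto elim: eventually_mono)
      qed
      also have "\<dots> = n2 lborel (\<lambda>x. syn \<epsilon> (c k) x - syn \<epsilon> d x)"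
        by (rule sqint_lebesgue_lborel(2)) auto
      finally show ?thesis by (simp add: dist)
    qed
    then show "((\<lambda>k. L2norm UNIV (\<lambda>x. g k x - h x)) \<longlongrightarrow> 0) sequentially"
      by (intro tendsto_sandwich[OF _ _ tendsto_const lim]) (auto simp: L2norm_eq_n2)
  qed
  have hU: "h \<in> Uad \<epsilon>"
    using adm \<epsilon> g(1) gh by (auto simp: admissible_sets_def L2_closed_def)
  have si: "sqint lborel (\<lambda>x. Im (syn \<epsilon> d x))"
    by (rule sqint_dominated[OF sd]) (auto simp: abs_Im_le_cmod)
  have "n2 lborel (\<lambda>x. Im (syn \<epsilon> d x)) \<le> n2 (lebesgue_on K) (\<lambda>x. u k x - v x)" for k
    unfolding dist[symmetric]
    by (rule n2_mono[OF sqint_diff[OF sc sd]]) (use close[of k] in \<open>auto elim: eventually_mono\<close>)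
  then have "n2 lborel (\<lambda>x. Im (syn \<epsilon> d x)) \<le> 0"
    by (intro LIMSEQ_le_const[OF lim]) auto
  then have "n2 lborel (\<lambda>x. Im (syn \<epsilon> d x)) = 0" by (simp add: order_antisym)
  then have "AE x in lborel. Im (syn \<epsilon> d x) = 0" using n2_eq_0[OF si] by simp
  with Sd have "AE x in lborel. bloch_synth Phi \<epsilon> K v x = complex_of_real (h x)"
    by eventually_elim (simp add: h_def complex_eq_iff)
  then have "real_member (bloch_synth Phi \<epsilon> K v) (Uad \<epsilon>)"
    using hU unfolding real_member_def AE_completion_iff by blast
  then show "v \<in> Uhat Phi K Uad \<epsilon>" using Uhat_iff[OF \<epsilon> K] L by simp
qed

end

section \<open>Regularity of the lowest Bloch eigenvalue\<close>

text \<open>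
  Subtracting from \<open>p\<close> components that are mutually orthogonal for the form \<open>b\<close>. It is used for the \<open>L\<^sup>2\<close>
  inner product and for the energy form at once.
\<close>

lemma residual_energy:
  fixes b :: "('a \<Rightarrow> 'c::real_vector) \<Rightarrow> ('a \<Rightarrow> 'c) \<Rightarrow> real" and E :: "nat \<Rightarrow> 'a \<Rightarrow> 'c"
  assumes S: "\<And>f g. S f \<Longrightarrow> S g \<Longrightarrow> S (\<lambda>x. f x - g x)"
    and lin: "\<And>f g h. S f \<Longrightarrow> S g \<Longrightarrow> S h \<Longrightarrow> b (\<lambda>x. f x - g x) h = b f h - b g h"
    and sym: "\<And>f g. S f \<Longrightarrow> S g \<Longrightarrow> b f g = b g f"
    and p: "S p" and E: "\<And>m. S (E m)" and Ep: "\<And>m. b (E m) p = e m"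
    and EE: "\<And>m l. b (E m) (E l) = (if m = l then e m else 0)"
  shows "S (\<lambda>x. p x - (\<Sum>m<N. E m x)) \<and>
    b (\<lambda>x. p x - (\<Sum>m<N. E m x)) (\<lambda>x. p x - (\<Sum>m<N. E m x)) = b p p - (\<Sum>m<N. e m)"
proof -
  let ?r = "\<lambda>N x. p x - (\<Sum>m<N. E m x)"
  have "S (?r N) \<and> (\<forall>l. b (E l) (?r N) = (if l < N then 0 else e l)) \<and> b (?r N) (?r N) = b p p - (\<Sum>m<N. e m)"
  proof (induction N)
    case 0
    then show ?case using p Ep by simp
  next
    case (Suc N)
    then have r: "S (?r N)" and rl: "\<And>l. b (E l) (?r N) = (if l < N then 0 else e l)"
      and rr: "b (?r N) (?r N) = b p p - (\<Sum>m<N. e m)" by auto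
    have eq: "?r (Suc N) = (\<lambda>x. ?r N x - E N x)" by (auto simp: algebra_simps)
    have s: "S (?r (Suc N))" unfolding eq by (intro S r E)
    have right: "b f (?r (Suc N)) = b f (?r N) - b f (E N)" if "S f" for f
    proof -
      have "b f (?r (Suc N)) = b (?r (Suc N)) f" by (rule sym[OF that s])
      also have "\<dots> = b (?r N) f - b (E N) f" unfolding eq by (rule lin[OF r E that])
      also have "\<dots> = b f (?r N) - b f (E N)" using sym[OF r that] sym[OF E that] by simp
      finally show ?thesis .
    qed
    have "b (E l) (?r (Suc N)) = (if l < Suc N then 0 else e l)" for l
      unfolding right[OF E] rl EE by (auto simp: less_Suc_eq)
    moreover have "b (?r (Suc N)) (?r (Suc N)) = b (?r N) (?r N) - 2 * b (E N) (?r N) + b (E N) (E N)"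
      unfolding right[OF s] sym[OF s r] sym[OF s E] right[OF r] right[OF E] sym[OF r E] by simp
    ultimately show ?case using s rl[of N] rr EE[of N N] by simp
  qed
  then show ?thesis by blast
qed

lemma vec_lambda_meas [measurable (raw)]:
  fixes f :: "'n::finite \<Rightarrow> 'a \<Rightarrow> 'b::euclidean_space"
  assumes [measurable]: "\<And>i. f i \<in> borel_measurable M"
  shows "(\<lambda>x. \<chi> i. f i x) \<in> borel_measurable M"
proof -
  have "continuous_on UNIV (\<lambda>z::'b. if Q then z else 0)" for Q by (cases Q) auto
  then have "(\<lambda>z::'b. axis i z :: 'b^'n) \<in> borel_measurable borel" for i
    unfolding axis_def by (intro borel_measurable_continuous_onI continuous_on_vec_lambda)
  then have [measurable]: "(\<lambda>x. axis i (f i x) :: 'b^'n) \<in> borel_measurable M" for i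
    by (rule measurable_compose[rotated]) measurable
  have "(\<lambda>x. \<chi> i. f i x) = (\<lambda>x. \<Sum>i\<in>UNIV. axis i (f i x))"
    by (auto simp: vec_eq_iff axis_def)
  then show ?thesis by simp
qed

lemma vec_component_meas [measurable (raw)]:
  fixes f :: "'a \<Rightarrow> 'b::euclidean_space^'n"
  assumes [measurable]: "f \<in> borel_measurable M"
  shows "(\<lambda>x. f x $ i) \<in> borel_measurable M"
  by (rule measurable_compose[OF assms]) (intro borel_measurable_continuous_onI continuous_intros)

lemma norm_le_sum_components:
  fixes v :: "'b::real_normed_vector^'n"
  shows "norm v \<le> (\<Sum>i\<in>UNIV. norm (v $ i))"
  unfolding norm_vec_def by (rule L2_set_le_sum) simp

text \<open>
  The action of the real matrix \<open>a\<close> on complex vectors; \<open>mact a v \<bullet> w\<close> is the real part of the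
  sesquilinear expression in \<open>bloch_form\<close>.
\<close>

definition mact :: "real^'n^'n \<Rightarrow> complex^'n \<Rightarrow> complex^'n" where
  "mact a v = (\<chi> i. \<Sum>j\<in>UNIV. a $ i $ j *\<^sub>R v $ j)"

lemma mact_diff: "mact a (v - w) = mact a v - mact a w"
  by (simp add: mact_def vec_eq_iff scaleR_diff_right sum_subtractf)

lemma mact_add: "mact a (v + w) = mact a v + mact a w"
  by (simp add: mact_def vec_eq_iff scaleR_add_right sum.distrib)

lemma mact_inner: "mact a v \<bullet> w = (\<Sum>i\<in>UNIV. \<Sum>j\<in>UNIV. a $ i $ j * (v $ j \<bullet> w $ i))"
  by (simp add: mact_def inner_vec_def inner_sum_left)

lemma mact_sym:
  assumes "transpose a = a"
  shows "mact a v \<bullet> w = mact a w \<bullet> v"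
proof -
  have "a $ i $ j = a $ j $ i" for i j
    using assms by (metis transpose_def vec_lambda_beta)
  then show ?thesis
    unfolding mact_inner by (subst sum.swap) (simp add: inner_commute)
qed

lemma mact_nonneg:
  assumes "\<And>\<xi>. \<xi> \<bullet> (a *v \<xi>) \<ge> \<alpha> * (norm \<xi>)\<^sup>2" "\<alpha> > 0"
  shows "0 \<le> mact a v \<bullet> v"
proof -
  define x y where "x = (\<chi> i. Re (v $ i))" and "y = (\<chi> i. Im (v $ i))"
  have "mact a v \<bullet> v = x \<bullet> (a *v x) + y \<bullet> (a *v y)"
    unfolding mact_inner
    by (simp add: x_def y_def inner_vec_def matrix_vector_mult_def inner_complex_def sum_distrib_left
        algebra_simps flip: sum.distrib)
  moreover have "0 \<le> x \<bullet> (a *v x)" "0 \<le> y \<bullet> (a *v y)"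
    using order_trans[OF _ assms(1)[of x]] order_trans[OF _ assms(1)[of y]] assms(2) by simp_all
  ultimately show ?thesis by simp
qed

lemma mact_norm:
  assumes "norm (a::real^'n^'n) \<le> \<beta>"
  shows "norm (mact a v) \<le> (real CARD('n) * (real CARD('n) * \<beta>)) * norm v"
proof -
  have \<beta>: "0 \<le> \<beta>" using assms norm_ge_zero order_trans by blast
  have 1: "\<bar>a $ i $ j\<bar> \<le> \<beta>" for i j
    using Finite_Cartesian_Product.norm_nth_le[of "a $ i" j] Finite_Cartesian_Product.norm_nth_le[of a i] assms by simp
  have "norm (mact a v) \<le> (\<Sum>i\<in>UNIV. norm (mact a v $ i))" by (rule norm_le_sum_components)
  also have "\<dots> \<le> (\<Sum>i\<in>(UNIV::'n set). real CARD('n) * \<beta> * norm v)"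
  proof (rule sum_mono)
    fix i
    have "norm (mact a v $ i) \<le> (\<Sum>j\<in>UNIV. norm (a $ i $ j *\<^sub>R v $ j))"
      unfolding mact_def by (simp add: norm_sum del: norm_scaleR)
    also have "\<dots> \<le> (\<Sum>j\<in>(UNIV::'n set). \<beta> * norm v)"
      using 1 \<beta> Finite_Cartesian_Product.norm_nth_le[of v] by (intro sum_mono) (auto intro: mult_mono)
    finally show "norm (mact a v $ i) \<le> real CARD('n) * \<beta> * norm v" by simp
  qed
  finally show ?thesis by simp
qed

abbreviation Ymeas :: "(real^'n) measure" where
  "Ymeas \<equiv> lebesgue_on Ycell"

lemma Ycell_lebesgue: "Ycell \<in> sets lebesgue"
  by (simp add: Ycell_cbox)

lemma L2_per_sqint: "u \<in> L2_per \<Longrightarrow> sqint Ymeas u"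
  by (simp add: L2_per_def L2_iff_sqint_on[OF Ycell_lebesgue])

lemma set_integral_Ycell:
  fixes f :: "real^'n \<Rightarrow> 'b::{banach, second_countable_topology}"
  shows "(LINT x:Ycell|lebesgue. f x) = integral\<^sup>L Ymeas f"
  unfolding set_lebesgue_integral_def
  by (subst integral_restrict_space) (simp_all add: Ycell_lebesgue)

lemma inner_Y_ip:
  assumes "sqint Ymeas u" "sqint Ymeas v"
  shows "Re (c * cnj d * inner_Y u v) = ip Ymeas (\<lambda>x. c * u x) (\<lambda>x. d * v x)"
proof -
  have i: "integrable Ymeas (\<lambda>x. u x * cnj (v x))" by (rule sqint_mult_integrable[OF assms])
  have "Re (c * cnj d * inner_Y u v) = Re (\<integral>x. c * cnj d * (u x * cnj (v x)) \<partial>Ymeas)"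
    unfolding inner_Y_def set_integral_Ycell by simp
  also have "\<dots> = (\<integral>x. Re (c * cnj d * (u x * cnj (v x))) \<partial>Ymeas)"
    using i by (intro integral_Re[symmetric]) simp
  also have "\<dots> = ip Ymeas (\<lambda>x. c * u x) (\<lambda>x. d * v x)"
    unfolding ip_def by (intro Bochner_Integration.integral_cong) (auto simp: inner_complex_def algebra_simps)
  finally show ?thesis .
qed

lemma inner_Y_cnj: "inner_Y v u = cnj (inner_Y u v)"
  unfolding inner_Y_def set_integral_Ycell
  by (subst Bochner_Integration.integral_cnj[symmetric]) (rule Bochner_Integration.integral_cong, simp_all)

definition cscale :: "complex \<Rightarrow> complex^'n \<Rightarrow> complex^'n" where
  "cscale c v = (\<chi> i. c * v $ i)"

lemma norm_cscale: "norm (cscale c v) = cmod c * norm v"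
  by (simp add: cscale_def norm_vec_def norm_mult L2_set_right_distrib)

lemma sqint_cscale:
  assumes "sqint M p"
  shows "sqint M (\<lambda>x. cscale c (p x))"
proof (rule sqint_scale[OF assms, where c="cmod c"])
  have [measurable]: "p \<in> borel_measurable M" using assms by (simp add: sqint_def)
  show "(\<lambda>x. cscale c (p x)) \<in> borel_measurable M" unfolding cscale_def by measurable
qed (simp add: norm_cscale)

text \<open>
  A change of quasi-momentum perturbs the shifted gradient by a term of order zero in \<open>\<phi>\<close>.
\<close>

lemma shifted_grad_shift:
  "shifted_grad \<eta>' \<phi> g x = shifted_grad \<eta> \<phi> g x + (\<chi> i. 2 * pi * \<i> * complex_of_real ((\<eta>' - \<eta>) $ i) * \<phi> x)"
  by (simp add: shifted_grad_def vec_eq_iff algebra_simps)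

lemma norm_shift: "norm (\<chi> i. 2 * pi * \<i> * complex_of_real (\<zeta> $ i) * z) = (2 * pi * norm \<zeta>) * cmod z"
proof -
  have "(\<chi> i. 2 * pi * \<i> * complex_of_real (\<zeta> $ i) * z) = cscale (2 * pi * \<i> * z) (\<chi> i. complex_of_real (\<zeta> $ i))"
    by (simp add: cscale_def vec_eq_iff algebra_simps)
  moreover have "norm (\<chi> i. complex_of_real (\<zeta> $ i)) = norm \<zeta>"
    by (simp add: norm_vec_def)
  ultimately show ?thesis by (simp add: norm_cscale norm_mult)
qed

lemma sqint_shift:
  assumes "sqint M \<phi>"
  shows "sqint M (\<lambda>x. \<chi> i. 2 * pi * \<i> * complex_of_real (\<zeta> $ i) * \<phi> x)"
proof (rule sqint_scale[OF assms])
  have [measurable]: "\<phi> \<in> borel_measurable M" using assms by (simp add: sqint_def)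
  show "(\<lambda>x. \<chi> i. 2 * pi * \<i> * complex_of_real (\<zeta> $ i) * \<phi> x) \<in> borel_measurable M" by measurable
  show "AE x in M. norm (\<chi> i. 2 * pi * \<i> * complex_of_real (\<zeta> $ i) * \<phi> x) \<le> (2 * pi * norm \<zeta>) * norm (\<phi> x)"
    unfolding norm_shift by simp
qed

lemma sqint_shifted_grad:
  assumes "sqint M \<phi>" "sqint M g"
  shows "sqint M (shifted_grad \<eta> \<phi> g)"
proof -
  have "sqint M (\<lambda>x. shifted_grad 0 \<phi> g x + (\<chi> i. 2 * pi * \<i> * complex_of_real ((\<eta> - 0) $ i) * \<phi> x))"
  proof (rule sqint_add[OF _ sqint_shift[OF assms(1)]])
    have "shifted_grad 0 \<phi> g = g" by (auto simp: shifted_grad_def vec_eq_iff fun_eq_iff)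
    then show "sqint M (shifted_grad 0 \<phi> g)" using assms(2) by simp
  qed
  then show ?thesis unfolding shifted_grad_shift[of \<eta> _ _ _ 0, symmetric] by simp
qed

context
  fixes A :: "real^'n \<Rightarrow> real^'n^'n" and \<beta> \<alpha> :: real
  assumes A_meas: "A \<in> borel_measurable lebesgue"
    and A_bound: "AE x in lebesgue. norm (A x) \<le> \<beta>"
    and A_sym: "AE x in lebesgue. transpose (A x) = A x"
    and A_ell: "AE x in lebesgue. \<forall>\<xi>. \<xi> \<bullet> (A x *v \<xi>) \<ge> \<alpha> * (norm \<xi>)\<^sup>2" "\<alpha> > 0"
begin

lemma AE_Ymeas: "AE x in lebesgue. P x \<Longrightarrow> AE x in Ymeas. P x"
  using Ycell_lebesgue by (subst AE_restrict_space_iff) (auto elim: eventually_mono)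

lemma A_meas_Y [measurable]: "A \<in> borel_measurable Ymeas"
  by (rule measurable_restrict_space1[OF A_meas])

definition energy :: "(real^'n \<Rightarrow> complex^'n) \<Rightarrow> (real^'n \<Rightarrow> complex^'n) \<Rightarrow> real" where
  "energy p q = ip Ymeas (\<lambda>x. mact (A x) (p x)) q"

lemma act_sqint:
  assumes "sqint Ymeas p"
  shows "sqint Ymeas (\<lambda>x. mact (A x) (p x))"
    "n2 Ymeas (\<lambda>x. mact (A x) (p x)) \<le> (real CARD('n) * (real CARD('n) * \<bar>\<beta>\<bar>)) * n2 Ymeas p"
proof -
  have [measurable]: "p \<in> borel_measurable Ymeas" using assms by (simp add: sqint_def)
  have m: "(\<lambda>x. mact (A x) (p x)) \<in> borel_measurable Ymeas" unfolding mact_def by measurable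
  have b: "AE x in Ymeas. norm (mact (A x) (p x)) \<le> (real CARD('n) * (real CARD('n) * \<bar>\<beta>\<bar>)) * norm (p x)"
    using AE_Ymeas[OF A_bound] by eventually_elim (intro mact_norm, simp)
  show "sqint Ymeas (\<lambda>x. mact (A x) (p x))" by (rule sqint_scale[OF assms m b])
  show "n2 Ymeas (\<lambda>x. mact (A x) (p x)) \<le> (real CARD('n) * (real CARD('n) * \<bar>\<beta>\<bar>)) * n2 Ymeas p"
    by (rule n2_scale[OF assms m b]) simp
qed

lemma energy_diff:
  assumes "sqint Ymeas p" "sqint Ymeas q" "sqint Ymeas h"
  shows "energy (\<lambda>x. p x - q x) h = energy p h - energy q h"
  unfolding energy_def mact_diff by (rule ip_diff(2)) (intro assms act_sqint)+

lemma energy_add: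
  assumes "sqint Ymeas p" "sqint Ymeas q" "sqint Ymeas h"
  shows "energy (\<lambda>x. p x + q x) h = energy p h + energy q h"
  unfolding energy_def mact_add by (rule ip_add(2)) (intro assms act_sqint)+

lemma energy_sym:
  assumes "sqint Ymeas p" "sqint Ymeas q"
  shows "energy p q = energy q p"
  unfolding energy_def ip_def
proof (rule integral_cong_AE)
  have [measurable]: "p \<in> borel_measurable Ymeas" "q \<in> borel_measurable Ymeas"
    using assms by (auto simp: sqint_def)
  show "(\<lambda>x. mact (A x) (p x) \<bullet> q x) \<in> borel_measurable Ymeas"
    "(\<lambda>x. mact (A x) (q x) \<bullet> p x) \<in> borel_measurable Ymeas"
    using act_sqint(1)[OF assms(1)] act_sqint(1)[OF assms(2)] by (auto simp: sqint_def)
  show "AE x in Ymeas. mact (A x) (p x) \<bullet> q x = mact (A x) (q x) \<bullet> p x"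
    using AE_Ymeas[OF A_sym] by eventually_elim (rule mact_sym)
qed

lemma energy_nonneg: "0 \<le> energy p p"
  unfolding energy_def ip_def
  by (rule integral_nonneg_AE) (use AE_Ymeas[OF A_ell(1)] in \<open>eventually_elim, use A_ell(2) mact_nonneg in blast\<close>)

text \<open>
  The complex factors are absorbed into the functions, so that the real form \<open>energy\<close> carries the full
  information of the sesquilinear form.
\<close>

lemma bloch_form_energy:
  assumes "sqint Ymeas \<phi>" "sqint Ymeas g" "sqint Ymeas \<psi>" "sqint Ymeas h"
  shows "Re (c * cnj d * bloch_form A \<eta> \<phi> g \<psi> h) =
    energy (\<lambda>x. cscale c (shifted_grad \<eta> \<phi> g x)) (\<lambda>x. cscale d (shifted_grad \<eta> \<psi> h x))"
proof -
  let ?p = "shifted_grad \<eta> \<phi> g" and ?q = "shifted_grad \<eta> \<psi> h"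
  have p: "sqint Ymeas ?p" and q: "sqint Ymeas ?q" using assms by (auto intro: sqint_shifted_grad)
  let ?I = "\<lambda>x. \<Sum>i\<in>UNIV. \<Sum>j\<in>UNIV. complex_of_real (A x $ i $ j) * ?p x $ j * cnj (?q x $ i)"
  have I: "?I x = (\<Sum>i\<in>UNIV. (mact (A x) (?p x)) $ i * cnj (?q x $ i))" for x
    by (simp add: mact_def sum_distrib_right scaleR_conv_of_real)
  have comp: "sqint Ymeas (\<lambda>x. f x $ i)" if "sqint Ymeas f" for f :: "real^'n \<Rightarrow> complex^'n" and i
    by (rule sqint_dominated[OF that])
      (use that in \<open>auto simp: sqint_def intro!: AE_I2 Finite_Cartesian_Product.norm_nth_le\<close>)
  have int: "integrable Ymeas ?I"
    unfolding I by (intro Bochner_Integration.integrable_sum sqint_mult_integrable comp act_sqint p q)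
  have "Re (c * cnj d * bloch_form A \<eta> \<phi> g \<psi> h) = Re (\<integral>x. c * cnj d * ?I x \<partial>Ymeas)"
    unfolding bloch_form_def set_integral_Ycell by simp
  also have "\<dots> = (\<integral>x. Re (c * cnj d * ?I x) \<partial>Ymeas)"
    using int by (intro integral_Re[symmetric] integrable_mult_right)
  also have "\<dots> = energy (\<lambda>x. cscale c (?p x)) (\<lambda>x. cscale d (?q x))"
    unfolding energy_def ip_def
  proof (rule Bochner_Integration.integral_cong[OF refl])
    fix x
    have "Re (c * cnj d * ?I x) = (\<Sum>i\<in>UNIV. \<Sum>j\<in>UNIV. Re (c * cnj d * (complex_of_real (A x $ i $ j) * ?p x $ j * cnj (?q x $ i))))"
      by (simp only: sum_distrib_left Re_sum)
    also have "\<dots> = mact (A x) (cscale c (?p x)) \<bullet> cscale d (?q x)"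
      unfolding mact_inner
      by (intro sum.cong refl) (simp add: cscale_def inner_complex_def algebra_simps)
    finally show "Re (c * cnj d * ?I x) = mact (A x) (cscale c (?p x)) \<bullet> cscale d (?q x)" .
  qed
  finally show ?thesis .
qed

text \<open>
  Expanding \<open>\<phi>\<close> in the eigenfunctions: each component contributes \<open>\<lambda>\<^sub>m |c\<^sub>m|\<^sup>2 \<ge> \<lambda>\<^sub>0 |c\<^sub>m|\<^sup>2\<close> to the
  energy, and the remainder has nonnegative energy while its \<open>L\<^sup>2\<close> norm tends to zero.
\<close>

lemma rayleigh:
  assumes bs: "bloch_system A lam Phi" and \<eta>: "\<eta> \<in> Zcell" and \<phi>: "H1_per \<phi> g"
  shows "lam 0 \<eta> * (n2 Ymeas \<phi>)\<^sup>2 \<le> energy (shifted_grad \<eta> \<phi> g) (shifted_grad \<eta> \<phi> g)"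
proof -
  have lam: "0 \<le> lam 0 \<eta>" "\<And>m. lam m \<eta> \<le> lam (Suc m) \<eta>"
    and eig: "\<And>m. bloch_eigen A \<eta> (lam m \<eta>) (Phi m \<eta>)"
    and onb: "orthonormal_basis_per (\<lambda>m. Phi m \<eta>)"
    using bs \<eta> by (auto simp: bloch_system_def)
  have lam0: "lam 0 \<eta> \<le> lam m \<eta>" for m
    using lam(2) by (induction m) (auto intro: order_trans)
  have "\<forall>m. \<exists>g. H1_per (Phi m \<eta>) g \<and> (\<forall>\<psi> h. H1_per \<psi> h \<longrightarrow>
      bloch_form A \<eta> (Phi m \<eta>) g \<psi> h = complex_of_real (lam m \<eta>) * inner_Y (Phi m \<eta>) \<psi>)"
    using eig by (simp add: bloch_eigen_def)
  from choice[OF this] obtain G where G: "\<And>m. H1_per (Phi m \<eta>) (G m)"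
    "\<And>m \<psi> h. H1_per \<psi> h \<Longrightarrow> bloch_form A \<eta> (Phi m \<eta>) (G m) \<psi> h = complex_of_real (lam m \<eta>) * inner_Y (Phi m \<eta>) \<psi>"
    by auto
  have s\<phi>: "sqint Ymeas \<phi>" "sqint Ymeas g" using \<phi> by (auto simp: H1_per_def L2_per_sqint)
  have sG: "sqint Ymeas (Phi m \<eta>)" "sqint Ymeas (G m)" for m using G(1)[of m] by (auto simp: H1_per_def L2_per_sqint)
  define c where "c = (\<lambda>m. inner_Y \<phi> (Phi m \<eta>))"
  have ortho: "inner_Y (Phi m \<eta>) (Phi l \<eta>) = (if m = l then 1 else 0)" for m l
    using onb by (simp add: orthonormal_basis_per_def)
  have cc: "inner_Y (Phi m \<eta>) \<phi> = cnj (c m)" for m unfolding c_def by (rule inner_Y_cnj)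
  define F where "F = (\<lambda>m x. c m * Phi m \<eta> x)"
  define p where "p = shifted_grad \<eta> \<phi> g"
  define E where "E = (\<lambda>m x. cscale (c m) (shifted_grad \<eta> (Phi m \<eta>) (G m) x))"
  have one: "cscale 1 v = v" for v :: "complex^'n" by (simp add: cscale_def)
  have sp: "sqint Ymeas p" unfolding p_def by (rule sqint_shifted_grad[OF s\<phi>])
  have sE: "sqint Ymeas (E m)" for m unfolding E_def by (intro sqint_cscale sqint_shifted_grad sG)
  have sF: "sqint Ymeas (F m)" for m unfolding F_def by (intro sqint_cmult sG)
  have sq: "c m * cnj (c m) = complex_of_real ((cmod (c m))\<^sup>2)" for m by (simp only: complex_norm_square)
  have E1: "energy (E m) p = lam m \<eta> * (cmod (c m))\<^sup>2" for m
  proof -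
    have "energy (E m) p = Re (c m * cnj 1 * bloch_form A \<eta> (Phi m \<eta>) (G m) \<phi> g)"
      unfolding bloch_form_energy[OF sG s\<phi>] E_def p_def one ..
    also have "\<dots> = Re (complex_of_real (lam m \<eta>) * (c m * cnj (c m)))"
      by (simp add: G(2)[OF \<phi>] cc algebra_simps)
    finally show ?thesis unfolding sq by simp
  qed
  have E2: "energy (E m) (E l) = (if m = l then lam m \<eta> * (cmod (c m))\<^sup>2 else 0)" for m l
  proof -
    have "energy (E m) (E l) = Re (c m * cnj (c l) * bloch_form A \<eta> (Phi m \<eta>) (G m) (Phi l \<eta>) (G l))"
      unfolding bloch_form_energy[OF sG sG] E_def ..
    also have "\<dots> = (if m = l then Re (complex_of_real (lam m \<eta>) * (c m * cnj (c m))) else 0)"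
      by (simp add: G(2)[OF G(1)] ortho algebra_simps)
    finally show ?thesis unfolding sq by simp
  qed
  have F1: "ip Ymeas (F m) \<phi> = (cmod (c m))\<^sup>2" for m
  proof -
    have "ip Ymeas (F m) \<phi> = Re (c m * cnj 1 * inner_Y (Phi m \<eta>) \<phi>)"
      unfolding inner_Y_ip[OF sG(1) s\<phi>(1)] F_def by simp
    also have "\<dots> = Re (c m * cnj (c m))" by (simp add: cc)
    finally show ?thesis unfolding sq by simp
  qed
  have F2: "ip Ymeas (F m) (F l) = (if m = l then (cmod (c m))\<^sup>2 else 0)" for m l
  proof -
    have "ip Ymeas (F m) (F l) = Re (c m * cnj (c l) * inner_Y (Phi m \<eta>) (Phi l \<eta>))"
      unfolding inner_Y_ip[OF sG(1) sG(1)] F_def by simp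
    also have "\<dots> = (if m = l then Re (c m * cnj (c m)) else 0)" by (simp add: ortho)
    finally show ?thesis unfolding sq by simp
  qed
  have en: "(\<Sum>m<N. lam m \<eta> * (cmod (c m))\<^sup>2) \<le> energy p p" for N
  proof -
    let ?r = "\<lambda>x. p x - (\<Sum>m<N. E m x)"
    have "sqint Ymeas ?r \<and> energy ?r ?r = energy p p - (\<Sum>m<N. lam m \<eta> * (cmod (c m))\<^sup>2)"
    proof (rule residual_energy[where S="sqint Ymeas" and b=energy and p=p and E=E and e="\<lambda>m. lam m \<eta> * (cmod (c m))\<^sup>2" and N=N])
      show "sqint Ymeas p" "sqint Ymeas (E m)" "energy (E m) p = lam m \<eta> * (cmod (c m))\<^sup>2" for m
        by (rule sp sE E1)+
      show "energy (E m) (E l) = (if m = l then lam m \<eta> * (cmod (c m))\<^sup>2 else 0)" for m l by (rule E2)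
    next
      fix f g :: "real^'n \<Rightarrow> complex^'n" assume "sqint Ymeas f" "sqint Ymeas g"
      then show "sqint Ymeas (\<lambda>x. f x - g x)" "energy f g = energy g f"
        by (rule sqint_diff, rule energy_sym)
    next
      fix f g h :: "real^'n \<Rightarrow> complex^'n" assume "sqint Ymeas f" "sqint Ymeas g" "sqint Ymeas h"
      then show "energy (\<lambda>x. f x - g x) h = energy f h - energy g h" by (rule energy_diff)
    qed
    then show ?thesis using energy_nonneg[of ?r] by simp
  qed
  have nr: "(n2 Ymeas (\<lambda>x. (\<Sum>m<N. F m x) - \<phi> x))\<^sup>2 = (n2 Ymeas \<phi>)\<^sup>2 - (\<Sum>m<N. (cmod (c m))\<^sup>2)" for N
  proof -
    let ?r = "\<lambda>x. \<phi> x - (\<Sum>m<N. F m x)"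
    have "sqint Ymeas ?r \<and> ip Ymeas ?r ?r = ip Ymeas \<phi> \<phi> - (\<Sum>m<N. (cmod (c m))\<^sup>2)"
    proof (rule residual_energy[where S="sqint Ymeas" and b="ip Ymeas" and p=\<phi> and E=F and e="\<lambda>m. (cmod (c m))\<^sup>2" and N=N])
      show "sqint Ymeas \<phi>" "sqint Ymeas (F m)" "ip Ymeas (F m) \<phi> = (cmod (c m))\<^sup>2" for m
        by (rule s\<phi>(1) sF F1)+
      show "ip Ymeas (F m) (F l) = (if m = l then (cmod (c m))\<^sup>2 else 0)" for m l by (rule F2)
    next
      fix f g :: "real^'n \<Rightarrow> complex" assume "sqint Ymeas f" "sqint Ymeas g"
      then show "sqint Ymeas (\<lambda>x. f x - g x)" by (rule sqint_diff)
      show "ip Ymeas f g = ip Ymeas g f" by (rule ip_commute)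
    next
      fix f g h :: "real^'n \<Rightarrow> complex" assume "sqint Ymeas f" "sqint Ymeas g" "sqint Ymeas h"
      then show "ip Ymeas (\<lambda>x. f x - g x) h = ip Ymeas f h - ip Ymeas g h" by (intro ip_diff(2))
    qed
    then show ?thesis unfolding n2_minus_commute[of Ymeas _ \<phi>] n2_sq_ip by simp
  qed
  have "\<phi> \<in> L2_per" using \<phi> by (simp add: H1_per_def)
  then have "L2_tendsto Ycell (\<lambda>N x. \<Sum>m<N. F m x) \<phi> sequentially"
    using onb unfolding orthonormal_basis_per_def F_def c_def by blast
  then have "(\<lambda>N. n2 Ymeas (\<lambda>x. (\<Sum>m<N. F m x) - \<phi> x)) \<longlonglongrightarrow> 0"
    by (simp add: L2_tendsto_def L2norm_eq_n2_on[OF Ycell_lebesgue])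
  then have "(\<lambda>N. lam 0 \<eta> * ((n2 Ymeas \<phi>)\<^sup>2 - (n2 Ymeas (\<lambda>x. (\<Sum>m<N. F m x) - \<phi> x))\<^sup>2))
      \<longlonglongrightarrow> lam 0 \<eta> * ((n2 Ymeas \<phi>)\<^sup>2 - 0\<^sup>2)"
    by (intro tendsto_intros)
  moreover have "lam 0 \<eta> * ((n2 Ymeas \<phi>)\<^sup>2 - (n2 Ymeas (\<lambda>x. (\<Sum>m<N. F m x) - \<phi> x))\<^sup>2) \<le> energy p p" for N
  proof -
    have "lam 0 \<eta> * ((n2 Ymeas \<phi>)\<^sup>2 - (n2 Ymeas (\<lambda>x. (\<Sum>m<N. F m x) - \<phi> x))\<^sup>2) = (\<Sum>m<N. lam 0 \<eta> * (cmod (c m))\<^sup>2)"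
      unfolding nr by (simp add: sum_distrib_left)
    also have "\<dots> \<le> (\<Sum>m<N. lam m \<eta> * (cmod (c m))\<^sup>2)"
      by (intro sum_mono mult_right_mono lam0) simp
    also have "\<dots> \<le> energy p p" by (rule en)
    finally show ?thesis .
  qed
  ultimately have "lam 0 \<eta> * ((n2 Ymeas \<phi>)\<^sup>2 - 0\<^sup>2) \<le> energy p p"
    by (intro LIMSEQ_le_const2) auto
  then show ?thesis by (simp add: p_def)
qed

text \<open>
  The ground state at \<open>\<eta>\<close> is a trial function at \<open>\<eta>'\<close>. Its shifted gradient is \<open>p + d\<close> with \<open>d\<close> of size
  \<open>2\<pi>|\<eta> - \<eta>'|\<close>, and the mixed term is absorbed by Young's inequality with parameter \<open>\<delta>\<close>.
\<close>

lemma ground_state_comparison: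
  assumes bs: "bloch_system A lam Phi" and \<eta>: "\<eta> \<in> Zcell" "\<eta>' \<in> Zcell" and \<delta>: "\<delta> > 0"
  shows "lam 0 \<eta>' \<le> (1 + \<delta>) * lam 0 \<eta> +
    (1 + 1 / \<delta>) * ((real CARD('n) * (real CARD('n) * \<bar>\<beta>\<bar>)) * (2 * pi)\<^sup>2 * (dist \<eta> \<eta>')\<^sup>2)"
proof -
  define \<phi> where "\<phi> = Phi 0 \<eta>"
  obtain g where g: "H1_per \<phi> g"
    "\<And>\<psi> h. H1_per \<psi> h \<Longrightarrow> bloch_form A \<eta> \<phi> g \<psi> h = complex_of_real (lam 0 \<eta>) * inner_Y \<phi> \<psi>"
    using bs \<eta>(1) unfolding bloch_system_def bloch_eigen_def \<phi>_def by blast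
  have s: "sqint Ymeas \<phi>" "sqint Ymeas g" using g by (auto simp: H1_per_def L2_per_sqint)
  have nrm: "inner_Y \<phi> \<phi> = 1"
    using bs \<eta>(1) by (auto simp: bloch_system_def orthonormal_basis_per_def \<phi>_def)
  have n1: "(n2 Ymeas \<phi>)\<^sup>2 = 1"
    using inner_Y_ip[OF s(1) s(1), of 1 1] nrm by (simp add: n2_sq_ip)
  define p where "p = shifted_grad \<eta> \<phi> g"
  define d where "d = (\<lambda>x. \<chi> i. 2 * pi * \<i> * complex_of_real ((\<eta>' - \<eta>) $ i) * \<phi> x)"
  have sp: "sqint Ymeas p" unfolding p_def by (rule sqint_shifted_grad[OF s])
  have sd: "sqint Ymeas d" unfolding d_def by (rule sqint_shift[OF s(1)])
  have one: "cscale 1 v = v" for v :: "complex^'n" by (simp add: cscale_def)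
  have pp: "energy p p = lam 0 \<eta>"
    using bloch_form_energy[OF s s, of 1 1 \<eta>] g(2)[OF g(1)] nrm by (simp add: one p_def)
  have dd: "energy d d \<le> (real CARD('n) * (real CARD('n) * \<bar>\<beta>\<bar>)) * (2 * pi)\<^sup>2 * (dist \<eta> \<eta>')\<^sup>2" (is "_ \<le> ?C")
  proof -
    have nd: "n2 Ymeas d = (2 * pi * norm (\<eta>' - \<eta>)) * n2 Ymeas \<phi>"
      unfolding n2_def d_def norm_shift power_mult_distrib[of _ "norm (\<phi> _)"] by (simp add: real_sqrt_mult abs_mult)
    have "energy d d \<le> n2 Ymeas (\<lambda>x. mact (A x) (d x)) * n2 Ymeas d"
      unfolding energy_def using CS_ip[OF act_sqint(1)[OF sd] sd] by simp
    also have "\<dots> \<le> (real CARD('n) * (real CARD('n) * \<bar>\<beta>\<bar>)) * n2 Ymeas d * n2 Ymeas d"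
      by (intro mult_right_mono act_sqint sd) simp
    also have "\<dots> = (real CARD('n) * (real CARD('n) * \<bar>\<beta>\<bar>)) * (n2 Ymeas d)\<^sup>2"
      by (simp add: power2_eq_square mult.assoc)
    also have "(n2 Ymeas d)\<^sup>2 = (2 * pi)\<^sup>2 * (dist \<eta> \<eta>')\<^sup>2"
      unfolding nd power_mult_distrib n1 by (simp add: dist_norm norm_minus_commute power_mult_distrib)
    finally show ?thesis by (simp add: mult.assoc)
  qed
  have spd: "sqint Ymeas (\<lambda>x. p x + d x)" by (rule sqint_add[OF sp sd])
  have "lam 0 \<eta>' \<le> energy (shifted_grad \<eta>' \<phi> g) (shifted_grad \<eta>' \<phi> g)"
    using rayleigh[OF bs \<eta>(2) g(1)] n1 by simp
  also have "shifted_grad \<eta>' \<phi> g = (\<lambda>x. p x + d x)"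
    unfolding p_def d_def by (rule ext) (rule shifted_grad_shift)
  also have "energy (\<lambda>x. p x + d x) (\<lambda>x. p x + d x) = energy p p + 2 * energy p d + energy d d"
    by (simp add: energy_add[OF sp sd spd] energy_sym[OF _ spd] energy_add[OF sp sd] energy_sym[OF sd sp] sp sd)
  also have "\<dots> \<le> energy p p + (\<delta> * energy p p + energy d d / \<delta>) + energy d d"
  proof -
    \<comment> \<open>Young's inequality is nonnegativity of the energy of \<open>r p - d/r\<close>.\<close>
    define r where "r = sqrt \<delta>"
    have r: "r > 0" "r * r = \<delta>" using \<delta> by (auto simp: r_def)
    let ?x = "\<lambda>x. r *\<^sub>R p x" and ?y = "\<lambda>x. (1 / r) *\<^sub>R d x"
    have sx: "sqint Ymeas ?x" and sy: "sqint Ymeas ?y" by (intro sqint_scaleR sp sd)+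
    have hom: "energy (\<lambda>x. s *\<^sub>R u x) (\<lambda>x. t *\<^sub>R w x) = s * t * energy u w" for s t u w
    proof -
      have "mact (A x) (s *\<^sub>R u x) = s *\<^sub>R mact (A x) (u x)" for x
        by (simp add: mact_def vec_eq_iff scaleR_sum_right mult.commute)
      then show ?thesis unfolding energy_def by (simp add: ip_scaleR)
    qed
    have "0 \<le> energy (\<lambda>x. ?x x - ?y x) (\<lambda>x. ?x x - ?y x)" by (rule energy_nonneg)
    also have "\<dots> = energy ?x ?x - 2 * energy ?x ?y + energy ?y ?y"
      by (simp add: energy_diff[OF sx sy sqint_diff[OF sx sy]] energy_sym[OF _ sqint_diff[OF sx sy]]
          energy_diff[OF sx sy] energy_sym[OF sy sx] sx sy)
    also have "\<dots> = \<delta> * energy p p - 2 * energy p d + energy d d / \<delta>"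
      unfolding hom using r by (simp add: divide_inverse flip: inverse_mult_distrib)
    finally show ?thesis by simp
  qed
  also have "\<dots> = (1 + \<delta>) * lam 0 \<eta> + (1 + 1 / \<delta>) * energy d d"
    unfolding pp by (simp add: algebra_simps)
  also have "\<dots> \<le> (1 + \<delta>) * lam 0 \<eta> + (1 + 1 / \<delta>) * ?C"
    using dd \<delta> by (intro add_left_mono mult_left_mono) auto
  finally show ?thesis .
qed

end

text \<open>
  The choice \<open>\<delta> = 1\<close> with a fixed base point bounds \<open>f\<close>; then \<open>\<delta> = dist x y\<close> gives a Lipschitz
  estimate.
\<close>

lemma lipschitz_of_comparison:
  fixes f :: "'a::metric_space \<Rightarrow> real"
  assumes cmp: "\<And>x y \<delta>. x \<in> S \<Longrightarrow> y \<in> S \<Longrightarrow> \<delta> > 0 \<Longrightarrow> f y \<le> (1 + \<delta>) * f x + (1 + 1 / \<delta>) * (C * (dist x y)\<^sup>2)"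
    and S: "z \<in> S" "\<And>x y. x \<in> S \<Longrightarrow> y \<in> S \<Longrightarrow> dist x y \<le> D" and C: "0 \<le> C" and nonneg: "\<And>x. x \<in> S \<Longrightarrow> 0 \<le> f x"
  shows "continuous_on S f" "\<exists>B. \<forall>x\<in>S. f x \<le> B"
proof -
  define B where "B = 2 * f z + 2 * (C * D\<^sup>2)"
  have D: "0 \<le> D" using S(2)[OF S(1) S(1)] by simp
  have fB: "f x \<le> B" if "x \<in> S" for x
  proof -
    have "C * (dist z x)\<^sup>2 \<le> C * D\<^sup>2" using S(2)[OF S(1) that] C by (intro mult_left_mono power_mono) auto
    then show ?thesis using cmp[OF S(1) that, of 1] unfolding B_def by simp
  qed
  then show "\<exists>B. \<forall>x\<in>S. f x \<le> B" by blast
  have B0: "0 \<le> B" using fB[OF S(1)] nonneg[OF S(1)] by simp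
  have one: "f y - f x \<le> (B + C * D + C) * dist x y" if xy: "x \<in> S" "y \<in> S" for x y
  proof (cases "x = y")
    case False
    let ?d = "dist x y"
    have d: "?d > 0" using False by simp
    have "f y \<le> (1 + ?d) * f x + (1 + 1 / ?d) * (C * ?d\<^sup>2)" by (rule cmp[OF xy d])
    also have "\<dots> = f x + ?d * f x + C * ?d * ?d + C * ?d"
      using d by (simp add: field_simps power2_eq_square)
    also have "\<dots> \<le> f x + ?d * B + C * D * ?d + C * ?d"
      using fB[OF xy(1)] S(2)[OF xy] C d by (intro add_mono mult_left_mono mult_right_mono) auto
    finally show ?thesis by (simp add: algebra_simps)
  qed simp
  have "(B + C * D + C)-lipschitz_on S f"
  proof (rule lipschitz_onI)
    fix x y assume "x \<in> S" "y \<in> S"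
    then show "dist (f x) (f y) \<le> (B + C * D + C) * dist x y"
      using one[of x y] one[of y x] by (simp add: dist_real_def dist_commute abs_le_iff)
  qed (use B0 C D in simp)
  then show "continuous_on S f" by (rule lipschitz_on_continuous_on)
qed

lemma ground_state_regular:
  fixes A :: "real^'n \<Rightarrow> real^'n^'n"
  assumes A: "admissible_coefficient A" and bs: "bloch_system A lam Phi"
  shows "continuous_on Zcell (lam 0)" "\<exists>B. \<forall>\<eta>\<in>Zcell. lam 0 \<eta> \<le> B"
proof -
  obtain \<beta> \<alpha> where a: "A \<in> borel_measurable lebesgue" "AE x in lebesgue. norm (A x) \<le> \<beta>"
    "AE x in lebesgue. transpose (A x) = A x"
    "AE x in lebesgue. \<forall>\<xi>. \<xi> \<bullet> (A x *v \<xi>) \<ge> \<alpha> * (norm \<xi>)\<^sup>2" "\<alpha> > 0"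
    using A unfolding admissible_coefficient_def by blast
  let ?C = "(real CARD('n) * (real CARD('n) * \<bar>\<beta>\<bar>)) * (2 * pi)\<^sup>2"
  have z: "0 \<in> (Zcell :: (real^'n) set)" by (simp add: Zcell_def)
  have D: "dist x y \<le> 2 * real CARD('n)" if "x \<in> Zcell" "y \<in> Zcell" for x y :: "real^'n"
    using Zcell_norm[OF that(1)] Zcell_norm[OF that(2)] norm_triangle_ineq4[of x y] by (simp add: dist_norm)
  have nn: "0 \<le> lam 0 \<eta>" if "\<eta> \<in> Zcell" for \<eta> using bs that by (simp add: bloch_system_def)
  note * = lipschitz_of_comparison[where S=Zcell and f="lam 0" and C="?C", OF
      ground_state_comparison[OF a bs] z D _ nn]
  show "continuous_on Zcell (lam 0)" by (rule *(1)) simp_all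
  show "\<exists>B. \<forall>\<eta>\<in>Zcell. lam 0 \<eta> \<le> B" by (rule *(2)) simp_all
qed

section \<open>The Taylor error and the comparison of minimisers\<close>

lemma tensor_contract_scale:
  fixes \<eta> :: "real^'n"
  shows "tensor_contract p T (c *\<^sub>R \<eta>) = c ^ p * tensor_contract p T \<eta>"
proof -
  have *: "(\<Prod>i\<leftarrow>is. (c *\<^sub>R \<eta>) $ i) = c ^ length is * (\<Prod>i\<leftarrow>is. \<eta> $ i)" for "is" :: "'n list"
    by (induction "is") auto
  have "tensor_contract p T (c *\<^sub>R \<eta>) = (\<Sum>is | length is = p. c ^ p * (T is * (\<Prod>i\<leftarrow>is. \<eta> $ i)))"
    unfolding tensor_contract_def
  proof (rule sum.cong[OF refl])
    fix "is" :: "'n list" assume "is \<in> {is. length is = p}"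
    then have "length is = p" by simp
    then show "T is * (\<Prod>i\<leftarrow>is. (c *\<^sub>R \<eta>) $ i) = c ^ p * (T is * (\<Prod>i\<leftarrow>is. \<eta> $ i))"
      unfolding * by simp
  qed
  then show ?thesis unfolding tensor_contract_def by (simp add: sum_distrib_left)
qed

lemma continuous_tensor_contract:
  fixes f :: "'a::topological_space \<Rightarrow> real^'n"
  assumes "continuous_on S f"
  shows "continuous_on S (\<lambda>x. tensor_contract p T (f x))"
proof -
  have "continuous_on S (\<lambda>x. \<Prod>i\<leftarrow>is. f x $ i)" for "is" :: "'n list"
    using assms by (induction "is") (auto intro!: continuous_intros)
  then show ?thesis unfolding tensor_contract_def by (intro continuous_intros)
qed

text \<open>
  The rescaled polynomial is the Taylor polynomial of \<open>\<lambda>\<^sub>0\<close> at \<open>\<epsilon>\<eta>\<close> divided by \<open>\<epsilon>\<^sup>2\<close>, exactly as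
  \<open>\<lambda>\<^sup>\<epsilon>\<^sub>0\<close> arises from \<open>\<lambda>\<^sub>0\<close>.
\<close>

lemma taylor_poly_scale:
  assumes "\<epsilon> \<noteq> 0"
  shows "taylor_poly Ast \<epsilon> N \<eta> =
    (\<Sum>k=1..N. (2 * pi) ^ (2 * k) * tensor_contract (2 * k) (Ast k) (\<epsilon> *\<^sub>R \<eta>)) / \<epsilon>\<^sup>2"
proof -
  have "\<epsilon> ^ (2 * k - 2) = \<epsilon> ^ (2 * k) / \<epsilon>\<^sup>2" if "k \<in> {1..N}" for k
    using that assms by (subst power_diff) auto
  then show ?thesis
    unfolding taylor_poly_def tensor_contract_scale sum_divide_distrib
    by (intro sum.cong) auto
qed

lemma continuous_taylor_poly: "continuous_on S (taylor_poly Ast \<epsilon> N)"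
  unfolding taylor_poly_def[abs_def] by (intro continuous_intros continuous_tensor_contract)

lemma taylor_poly_bounded:
  fixes K :: "(real^'n) set"
  assumes "compact K"
  shows "\<exists>B. \<forall>\<epsilon>\<in>{0..\<epsilon>M}. \<forall>\<eta>\<in>K. \<bar>taylor_poly Ast \<epsilon> N \<eta>\<bar> \<le> B"
proof -
  have "continuous_on ({0..\<epsilon>M} \<times> K) (\<lambda>z. taylor_poly Ast (fst z) N (snd z))"
    unfolding taylor_poly_def by (intro continuous_intros continuous_tensor_contract)
  then have "compact ((\<lambda>z. taylor_poly Ast (fst z) N (snd z)) ` ({0..\<epsilon>M} \<times> K))"
    using assms by (intro compact_continuous_image compact_Times) auto
  then have "bounded ((\<lambda>z. taylor_poly Ast (fst z) N (snd z)) ` ({0..\<epsilon>M} \<times> K))"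
    by (rule compact_imp_bounded)
  then obtain B where B: "\<forall>y\<in>(\<lambda>z. taylor_poly Ast (fst z) N (snd z)) ` ({0..\<epsilon>M} \<times> K). norm y \<le> B"
    unfolding bounded_iff by blast
  have "\<bar>taylor_poly Ast \<epsilon> N \<eta>\<bar> \<le> B" if "\<epsilon> \<in> {0..\<epsilon>M}" "\<eta> \<in> K" for \<epsilon> \<eta>
    using B[rule_format, of "taylor_poly Ast \<epsilon> N \<eta>"] that by force
  then show ?thesis by blast
qed

text \<open>
  If \<open>\<epsilon>K\<close> lies in the neighbourhood of \<open>0\<close> where Taylor's formula holds, the error is
  \<open>\<epsilon>\<^sup>-\<^sup>2 O(|\<epsilon>\<eta>|\<^sup>2\<^sup>M\<^sup>+\<^sup>2)\<close>. Otherwise \<open>\<epsilon> \<ge> d/r\<close>, so a bounded quantity is at most a multiple of \<open>\<epsilon>\<^sup>2\<^sup>M\<close>. The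
  point \<open>\<eta> = 0\<close>, where the formula gives no information, is excluded; it is a null set.
\<close>

lemma taylor_error:
  fixes K :: "(real^'n) set"
  assumes K: "compact K" and T: "taylor_tensors lam0 Ast" and M: "M \<ge> 1" and \<epsilon>M: "\<epsilon>M > 0"
    and B: "\<And>\<eta>. \<eta> \<in> Zcell \<Longrightarrow> \<bar>lam0 \<eta>\<bar> \<le> B"
  shows "\<exists>C\<ge>0. \<forall>\<epsilon> \<eta>. 0 < \<epsilon> \<longrightarrow> \<epsilon> < \<epsilon>M \<longrightarrow> K \<subseteq> Zscaled \<epsilon> \<longrightarrow> \<eta> \<in> K \<longrightarrow> \<eta> \<noteq> 0 \<longrightarrow>
    \<bar>lam0 (\<epsilon> *\<^sub>R \<eta>) / \<epsilon>\<^sup>2 - taylor_poly Ast \<epsilon> M \<eta>\<bar> \<le> C * \<epsilon> ^ (2 * M)"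
proof -
  let ?p = "\<lambda>\<eta>. (\<Sum>k=1..M. (2 * pi) ^ (2 * k) * tensor_contract (2 * k) (Ast k) \<eta>)"
  obtain r where r: "r > 0" "\<And>\<eta>. \<eta> \<in> K \<Longrightarrow> norm \<eta> \<le> r"
    using compact_imp_bounded[OF K] by (auto simp: bounded_pos)
  have "(\<lambda>\<eta>. lam0 \<eta> - ?p \<eta>) \<in> O[at 0](\<lambda>\<eta>. norm \<eta> ^ (2 * M + 2))"
    using T M by (simp add: taylor_tensors_def)
  then obtain c where c: "c > 0" "\<forall>\<^sub>F \<eta> in at 0. norm (lam0 \<eta> - ?p \<eta>) \<le> c * norm (norm \<eta> ^ (2 * M + 2))"
    by (elim landau_o.bigE)
  then obtain d where d: "d > 0" "\<And>\<eta>. \<eta> \<noteq> 0 \<Longrightarrow> norm \<eta> < d \<Longrightarrow> \<bar>lam0 \<eta> - ?p \<eta>\<bar> \<le> c * norm \<eta> ^ (2 * M + 2)"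
    unfolding eventually_at by (auto simp: dist_norm)
  obtain PB where PB: "\<And>\<epsilon> \<eta>. 0 \<le> \<epsilon> \<Longrightarrow> \<epsilon> \<le> \<epsilon>M \<Longrightarrow> \<eta> \<in> K \<Longrightarrow> \<bar>taylor_poly Ast \<epsilon> M \<eta>\<bar> \<le> PB"
    using taylor_poly_bounded[OF K, of \<epsilon>M Ast M] unfolding Ball_def atLeastAtMost_iff by blast
  \<comment> \<open>A bound for both symbols on \<open>K\<close> when \<open>\<epsilon> \<ge> d/r\<close>.\<close>
  define C1 where "C1 = \<bar>B\<bar> * (r / d)\<^sup>2 + \<bar>PB\<bar>"
  define C where "C = c * r ^ (2 * M + 2) + C1 * (r / d) ^ (2 * M)"
  have C1: "C1 \<ge> 0" unfolding C1_def by (intro add_nonneg_nonneg mult_nonneg_nonneg) auto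
  have parts: "0 \<le> c * r ^ (2 * M + 2)" "0 \<le> C1 * (r / d) ^ (2 * M)"
    using c(1) r(1) d(1) C1 by auto
  have "\<bar>lam0 (\<epsilon> *\<^sub>R \<eta>) / \<epsilon>\<^sup>2 - taylor_poly Ast \<epsilon> M \<eta>\<bar> \<le> C * \<epsilon> ^ (2 * M)"
    if \<epsilon>: "0 < \<epsilon>" "\<epsilon> < \<epsilon>M" and KZ: "K \<subseteq> Zscaled \<epsilon>" and \<eta>: "\<eta> \<in> K" "\<eta> \<noteq> 0" for \<epsilon> \<eta>
  proof (cases "\<epsilon> * r < d")
    case True
    have n: "norm (\<epsilon> *\<^sub>R \<eta>) \<le> \<epsilon> * r" using \<epsilon> r(2)[OF \<eta>(1)] by simp
    have "\<bar>lam0 (\<epsilon> *\<^sub>R \<eta>) / \<epsilon>\<^sup>2 - taylor_poly Ast \<epsilon> M \<eta>\<bar> = \<bar>lam0 (\<epsilon> *\<^sub>R \<eta>) - ?p (\<epsilon> *\<^sub>R \<eta>)\<bar> / \<epsilon>\<^sup>2"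
      using \<epsilon> by (subst taylor_poly_scale) (auto simp: abs_divide simp flip: diff_divide_distrib)
    also have "\<dots> \<le> (c * (\<epsilon> * r) ^ (2 * M + 2)) / \<epsilon>\<^sup>2"
    proof (rule divide_right_mono)
      have "\<bar>lam0 (\<epsilon> *\<^sub>R \<eta>) - ?p (\<epsilon> *\<^sub>R \<eta>)\<bar> \<le> c * norm (\<epsilon> *\<^sub>R \<eta>) ^ (2 * M + 2)"
        using order_le_less_trans[OF n True] \<epsilon> \<eta> by (intro d(2)) auto
      also have "\<dots> \<le> c * (\<epsilon> * r) ^ (2 * M + 2)"
        using n c(1) by (intro mult_left_mono power_mono) auto
      finally show "\<bar>lam0 (\<epsilon> *\<^sub>R \<eta>) - ?p (\<epsilon> *\<^sub>R \<eta>)\<bar> \<le> c * (\<epsilon> * r) ^ (2 * M + 2)" .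
    qed simp
    also have "\<dots> = c * r ^ (2 * M + 2) * \<epsilon> ^ (2 * M)"
      using \<epsilon> by (simp add: power_mult_distrib power_add power2_eq_square field_simps)
    also have "\<dots> \<le> C * \<epsilon> ^ (2 * M)"
      using parts \<epsilon> unfolding C_def by (intro mult_right_mono) auto
    finally show ?thesis .
  next
    case False
    then have e: "1 / \<epsilon> \<le> r / d" "1 \<le> (r / d) * \<epsilon>" using \<epsilon> d(1) r(1) by (auto simp: field_simps)
    have "\<epsilon> *\<^sub>R \<eta> \<in> Zcell" using KZ \<eta>(1) by (auto simp: Zscaled_def)
    then have "\<bar>lam0 (\<epsilon> *\<^sub>R \<eta>)\<bar> \<le> \<bar>B\<bar>" using B by force
    then have "\<bar>lam0 (\<epsilon> *\<^sub>R \<eta>)\<bar> * (1 / \<epsilon>)\<^sup>2 \<le> \<bar>B\<bar> * (r / d)\<^sup>2"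
      using e(1) \<epsilon> by (intro mult_mono power_mono) auto
    then have "\<bar>lam0 (\<epsilon> *\<^sub>R \<eta>) / \<epsilon>\<^sup>2\<bar> \<le> \<bar>B\<bar> * (r / d)\<^sup>2" by (simp add: power_divide)
    moreover have "\<bar>taylor_poly Ast \<epsilon> M \<eta>\<bar> \<le> \<bar>PB\<bar>" using PB[of \<epsilon> \<eta>] \<epsilon> \<eta> by simp
    ultimately have "\<bar>lam0 (\<epsilon> *\<^sub>R \<eta>) / \<epsilon>\<^sup>2 - taylor_poly Ast \<epsilon> M \<eta>\<bar> \<le> C1"
      unfolding C1_def by linarith
    also have "\<dots> \<le> C1 * ((r / d) * \<epsilon>) ^ (2 * M)"
      using C1 one_le_power[OF e(2), of "2 * M"] by (simp add: mult_le_cancel_left1)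
    also have "\<dots> = C1 * (r / d) ^ (2 * M) * \<epsilon> ^ (2 * M)" by (simp only: power_mult_distrib mult.assoc)
    also have "\<dots> \<le> C * \<epsilon> ^ (2 * M)"
      using parts \<epsilon> unfolding C_def by (intro mult_right_mono) auto
    finally show ?thesis .
  qed
  moreover have "C \<ge> 0" using parts unfolding C_def by simp
  ultimately show ?thesis by blast
qed

lemma fourier_real_sqint_on:
  fixes f :: "real^'n \<Rightarrow> real"
  assumes f: "f \<in> L2 UNIV" and K: "K \<in> sets lebesgue"
  shows "sqint (lebesgue_on K) (fourier_real f)"
proof -
  have "(\<lambda>x. complex_of_real (f x)) \<in> L2 UNIV" using f by (auto simp: L2_iff_sqint sqint_def)
  then have "fourier_real f \<in> L2 UNIV" unfolding fourier_real_def by (rule fourier_L2_in_L2)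
  then have s: "sqint lebesgue (fourier_real f)" by (simp add: L2_iff_sqint)
  have "sqint lebesgue (\<lambda>x. indicat_real K x *\<^sub>R fourier_real f x)"
  proof (rule sqint_dominated[OF s])
    show "(\<lambda>x. indicat_real K x *\<^sub>R fourier_real f x) \<in> borel_measurable lebesgue"
      using s K by (intro borel_measurable_scaleR borel_measurable_indicator) (auto simp: sqint_def)
  qed (auto simp: indicator_def)
  then show ?thesis using L2_iff_sqint_on[OF K, of "fourier_real f"] by (simp add: L2_iff_sqint)
qed

lemma unique_minimizer_of_quad:
  fixes U :: "(real^'n \<Rightarrow> complex) set"
  assumes W: "L2_weight (lebesgue_on K) q a Q b" and K: "K \<in> sets lebesgue"
    and J: "\<And>v. sqint (lebesgue_on K) v \<Longrightarrow> J v = quad (lebesgue_on K) q b v + c"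
    and U: "U \<subseteq> Collect (sqint (lebesgue_on K))" "L2_convex U" "L2_seq_closed (lebesgue_on K) U" "U \<noteq> {}"
  shows "\<exists>v\<in>U. is_unique_minimizer K J U v \<and> (\<forall>w\<in>U. quad (lebesgue_on K) q b v \<le> quad (lebesgue_on K) q b w)"
proof -
  interpret L2_weight "lebesgue_on K" q a Q b by fact
  obtain v where v: "v \<in> U" "\<And>w. w \<in> U \<Longrightarrow> quad (lebesgue_on K) q b v \<le> quad (lebesgue_on K) q b w"
    using minimizer_exists[OF U] by blast
  have JU: "J w = quad (lebesgue_on K) q b w + c" if "w \<in> U" for w using J U(1) that by auto
  have "is_minimizer J U v" unfolding is_minimizer_def using v by (auto simp: JU)
  moreover have "AE \<eta> in lebesgue. \<eta> \<in> K \<longrightarrow> w \<eta> = v \<eta>" if w: "is_minimizer J U w" for w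
  proof -
    have wU: "w \<in> U" "J w \<le> J v" using w v(1) by (auto simp: is_minimizer_def)
    then have "quad (lebesgue_on K) q b w \<le> quad (lebesgue_on K) q b v" using v(1) by (simp add: JU)
    with minimizer_unique[OF U(1,2) v(1) v(2) wU(1)]
    have "AE x in lebesgue_on K. w x = v x" by simp
    then show ?thesis using K by (subst (asm) AE_restrict_space_iff) auto
  qed
  ultimately show ?thesis using v unfolding is_unique_minimizer_def by blast
qed

theorem theorem3p1:
  fixes A :: "real^'n \<Rightarrow> real^'n^'n"
    and lam :: "nat \<Rightarrow> real^'n \<Rightarrow> real"
    and Phi :: "nat \<Rightarrow> real^'n \<Rightarrow> real^'n \<Rightarrow> complex"
    and Ast :: "nat \<Rightarrow> 'n list \<Rightarrow> real"
    and K :: "(real^'n) set"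
    and f yd1 yd2 :: "real^'n \<Rightarrow> real"
    and Uad :: "real \<Rightarrow> (real^'n \<Rightarrow> real) set"
    and \<mu>1 \<mu>2 \<kappa> \<Lambda> \<epsilon>M :: real
    and M :: nat
  assumes "admissible_coefficient A"
    and "bloch_system A lam Phi"
    and "\<mu>1 \<ge> 0" and "\<mu>2 \<ge> 0" and "\<kappa> > 0"
    and "compact K" and "uminus ` K = K"
    and "f \<in> L2 UNIV" and "yd1 \<in> L2 UNIV" and "yd2 \<in> L2 UNIV"
    and "AE \<eta> in lebesgue. \<eta> \<notin> K \<longrightarrow> fourier_real f \<eta> = 0"
    and "AE \<eta> in lebesgue. \<eta> \<notin> K \<longrightarrow> fourier_real yd1 \<eta> = 0"
    and "AE \<eta> in lebesgue. \<eta> \<notin> K \<longrightarrow> fourier_real yd2 \<eta> = 0"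
    and "admissible_sets Phi K Uad"
    and "taylor_tensors (lam 0) Ast"
    and "\<Lambda> > 0"
    and "\<And>\<eta>. tensor_contract 2 (Ast 1) \<eta> \<ge> \<Lambda> * (norm \<eta>)\<^sup>2"
    and "M \<ge> 1"
    and "\<epsilon>M > 0"
    and "\<And>\<eta> \<epsilon> N. \<eta> \<in> K \<Longrightarrow> 0 < \<epsilon> \<Longrightarrow> \<epsilon> < \<epsilon>M \<Longrightarrow> 1 \<le> N \<Longrightarrow> N \<le> M \<Longrightarrow>
           taylor_poly Ast \<epsilon> N \<eta> \<ge> \<Lambda> / 2 * (norm \<eta>)\<^sup>2"
  shows "\<exists>C>0. \<forall>\<epsilon>. 0 < \<epsilon> \<longrightarrow> \<epsilon> < \<epsilon>M \<longrightarrow> K \<subseteq> Zscaled \<epsilon> \<longrightarrow>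
    (\<exists>v vM.
      is_unique_minimizer K
        (cost \<mu>1 \<mu>2 \<kappa> K (fourier_real f) (fourier_real yd1) (fourier_real yd2)
          (bloch_value lam \<epsilon> 0)) (Uhat Phi K Uad \<epsilon>) v \<and>
      is_unique_minimizer K
        (cost \<mu>1 \<mu>2 \<kappa> K (fourier_real f) (fourier_real yd1) (fourier_real yd2)
          (taylor_poly Ast \<epsilon> M)) (Uhat Phi K Uad \<epsilon>) vM \<and>
      L2norm K (\<lambda>\<eta>. v \<eta> - vM \<eta>) \<le> C * \<epsilon> ^ (2 * M))"
proof -
  note A = assms(1) and bs = assms(2) and mu = assms(3-5) and K = assms(6) and adm = assms(14)
    and T = assms(15) and \<Lambda> = assms(16) and M = assms(18) and \<epsilon>M = assms(19) and pos = assms(20)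
  have Kl: "K \<in> sets lebesgue" using K by (simp add: borel_compact)
  let ?M = "lebesgue_on K"
  let ?F = "fourier_real f" and ?y1 = "fourier_real yd1" and ?y2 = "fourier_real yd2"
  have sq: "sqint ?M ?F" "sqint ?M ?y1" "sqint ?M ?y2"
    using assms(8-10) by (auto intro: fourier_real_sqint_on Kl)
  obtain P N where "bloch_representative P Phi N" using bloch_system_representative[OF bs] by blast
  then interpret R: bloch_representative P Phi N .
  obtain v0 where v0: "v0 \<in> L2 K" "\<And>\<epsilon>. \<epsilon> > 0 \<Longrightarrow> K \<subseteq> Zscaled \<epsilon> \<Longrightarrow> v0 \<in> Uhat Phi K Uad \<epsilon>"
    using R.fourier_data_in_Uhat[OF adm K] by blast
  have lam_cont: "continuous_on Zcell (lam 0)" by (rule ground_state_regular(1)[OF A bs])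
  obtain B where B: "\<And>\<eta>. \<eta> \<in> Zcell \<Longrightarrow> lam 0 \<eta> \<le> B" using ground_state_regular(2)[OF A bs] by blast
  have lam0: "0 \<le> lam 0 \<eta>" if "\<eta> \<in> Zcell" for \<eta> using bs that by (simp add: bloch_system_def)
  have "\<bar>lam 0 \<eta>\<bar> \<le> B" if "\<eta> \<in> Zcell" for \<eta> using B[OF that] lam0[OF that] by simp
  from taylor_error[OF K T M \<epsilon>M this] obtain C0 where C0: "C0 \<ge> 0"
    "\<And>\<epsilon> \<eta>. 0 < \<epsilon> \<Longrightarrow> \<epsilon> < \<epsilon>M \<Longrightarrow> K \<subseteq> Zscaled \<epsilon> \<Longrightarrow> \<eta> \<in> K \<Longrightarrow> \<eta> \<noteq> 0 \<Longrightarrow>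
      \<bar>lam 0 (\<epsilon> *\<^sub>R \<eta>) / \<epsilon>\<^sup>2 - taylor_poly Ast \<epsilon> M \<eta>\<bar> \<le> C0 * \<epsilon> ^ (2 * M)" by auto
  define Q where "Q = \<mu>1 / 2 + \<mu>2 / 2 + \<kappa> / 2"
  have Q: "0 \<le> Q" using mu by (simp add: Q_def)
  \<comment> \<open>Bounds for the loads and for their difference, relative to the difference of the symbols.\<close>
  define Bn where "Bn = n2 ?M (\<lambda>\<eta>. \<mu>1 / 2 * (cmod (?y1 \<eta>) + cmod (?F \<eta>)) + \<mu>2 / 2 * (cmod (?y2 \<eta>) + cmod (?F \<eta>)))"
  define Dn where "Dn = n2 ?M (\<lambda>x. \<mu>1 / 2 * cmod (?F x) + \<mu>2 / 2 * (cmod (?y2 x) + 2 * cmod (?F x)))"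
  define W where "W = n2 ?M v0"
  \<comment> \<open>A bound for the minimiser at the Taylor symbol, obtained from the competitor \<open>v0\<close>.\<close>
  define Rb where "Rb = W + sqrt ((Q * W\<^sup>2 + 2 * (Bn * W) + Bn\<^sup>2 / (\<kappa> / 2)) / (\<kappa> / 2))"
  have Rb: "0 \<le> Rb"
    using mu Q unfolding Rb_def W_def Bn_def
    by (intro add_nonneg_nonneg real_sqrt_ge_zero divide_nonneg_nonneg mult_nonneg_nonneg) auto
  define C where "C = (2 / \<kappa>) * ((\<mu>1 / 2 + \<mu>2) * C0 * Rb + C0 * Dn) + 1"
  have C: "C > 0"
    using mu C0(1) Rb unfolding C_def Dn_def
    by (intro add_nonneg_pos mult_nonneg_nonneg add_nonneg_nonneg) auto
  have main: "\<exists>v vM. is_unique_minimizer K (cost \<mu>1 \<mu>2 \<kappa> K ?F ?y1 ?y2 (bloch_value lam \<epsilon> 0)) (Uhat Phi K Uad \<epsilon>) v \<and>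
      is_unique_minimizer K (cost \<mu>1 \<mu>2 \<kappa> K ?F ?y1 ?y2 (taylor_poly Ast \<epsilon> M)) (Uhat Phi K Uad \<epsilon>) vM \<and>
      L2norm K (\<lambda>\<eta>. v \<eta> - vM \<eta>) \<le> C * \<epsilon> ^ (2 * M)"
    if \<epsilon>: "0 < \<epsilon>" "\<epsilon> < \<epsilon>M" and KZ: "K \<subseteq> Zscaled \<epsilon>" for \<epsilon>
  proof -
    let ?U = "Uhat Phi K Uad \<epsilon>"
    let ?La = "bloch_value lam \<epsilon> 0" and ?Lb = "taylor_poly Ast \<epsilon> M"
    have U: "?U \<subseteq> Collect (sqint ?M)" "L2_convex ?U" "L2_seq_closed ?M ?U" "?U \<noteq> {}"
      using R.Uhat_iff[OF \<epsilon>(1) K KZ] L2_iff_sqint_on[OF Kl] R.Uhat_convex[OF adm \<epsilon>(1) K KZ]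
        R.Uhat_closed[OF adm \<epsilon>(1) K KZ] v0(2)[OF \<epsilon>(1) KZ] by auto
    have Zin: "\<epsilon> *\<^sub>R \<eta> \<in> Zcell" if "\<eta> \<in> K" for \<eta> using that KZ by (auto simp: Zscaled_def)
    have La0: "0 \<le> ?La x" if "x \<in> K" for x
      using lam0[OF Zin[OF that]] by (simp add: bloch_value_def)
    have LaB: "?La x \<le> B / \<epsilon>\<^sup>2" if "x \<in> K" for x
      using B[OF Zin[OF that]] by (simp add: bloch_value_def divide_right_mono)
    have "continuous_on K ?La"
      unfolding bloch_value_def
      using \<epsilon> Zin by (intro continuous_intros continuous_on_compose2[OF lam_cont]) auto
    then have Lam: "?La \<in> borel_measurable ?M" by (rule continuous_imp_measurable_on_sets_lebesgue) (rule Kl)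
    have Lb0: "0 \<le> ?Lb x" if "x \<in> K" for x
      using pos[OF that \<epsilon> M order_refl] \<Lambda> by (meson divide_nonneg_nonneg less_imp_le mult_nonneg_nonneg order_trans zero_le_numeral zero_le_power2)
    obtain PB where PB: "\<bar>?Lb x\<bar> \<le> PB" if "x \<in> K" for x
      using taylor_poly_bounded[OF K, of \<epsilon>M Ast M] \<epsilon> unfolding Ball_def atLeastAtMost_iff
      by (meson less_imp_le)
    have LbB: "?Lb x \<le> PB" if "x \<in> K" for x using PB[OF that] by simp
    have Lbm: "?Lb \<in> borel_measurable ?M"
      by (rule continuous_imp_measurable_on_sets_lebesgue[OF continuous_taylor_poly Kl])
    have W1: "L2_weight ?M (cost_weight \<mu>1 \<mu>2 \<kappa> ?La) (\<kappa> / 2) Q (cost_load \<mu>1 \<mu>2 ?F ?y1 ?y2 ?La)"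
      unfolding Q_def by (rule cost_weight_L2_weight[OF mu sq Lam]) (simp add: La0)
    have W2: "L2_weight ?M (cost_weight \<mu>1 \<mu>2 \<kappa> ?Lb) (\<kappa> / 2) Q (cost_load \<mu>1 \<mu>2 ?F ?y1 ?y2 ?Lb)"
      unfolding Q_def by (rule cost_weight_L2_weight[OF mu sq Lbm]) (simp add: Lb0)
    obtain ca where ca: "\<And>v. sqint ?M v \<Longrightarrow> cost \<mu>1 \<mu>2 \<kappa> K ?F ?y1 ?y2 ?La v =
        quad ?M (cost_weight \<mu>1 \<mu>2 \<kappa> ?La) (cost_load \<mu>1 \<mu>2 ?F ?y1 ?y2 ?La) v + ca"
      using cost_eq_quad[OF mu Kl sq Lam La0 LaB] by blast
    obtain cb where cb: "\<And>v. sqint ?M v \<Longrightarrow> cost \<mu>1 \<mu>2 \<kappa> K ?F ?y1 ?y2 ?Lb v =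
        quad ?M (cost_weight \<mu>1 \<mu>2 \<kappa> ?Lb) (cost_load \<mu>1 \<mu>2 ?F ?y1 ?y2 ?Lb) v + cb"
      using cost_eq_quad[OF mu Kl sq Lbm Lb0 LbB] by blast
    obtain v where v: "v \<in> ?U" "is_unique_minimizer K (cost \<mu>1 \<mu>2 \<kappa> K ?F ?y1 ?y2 ?La) ?U v"
      "\<And>w. w \<in> ?U \<Longrightarrow> quad ?M (cost_weight \<mu>1 \<mu>2 \<kappa> ?La) (cost_load \<mu>1 \<mu>2 ?F ?y1 ?y2 ?La) v
         \<le> quad ?M (cost_weight \<mu>1 \<mu>2 \<kappa> ?La) (cost_load \<mu>1 \<mu>2 ?F ?y1 ?y2 ?La) w"
      using unique_minimizer_of_quad[OF W1 Kl ca U] by blast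
    obtain vM where vM: "vM \<in> ?U" "is_unique_minimizer K (cost \<mu>1 \<mu>2 \<kappa> K ?F ?y1 ?y2 ?Lb) ?U vM"
      "\<And>w. w \<in> ?U \<Longrightarrow> quad ?M (cost_weight \<mu>1 \<mu>2 \<kappa> ?Lb) (cost_load \<mu>1 \<mu>2 ?F ?y1 ?y2 ?Lb) vM
         \<le> quad ?M (cost_weight \<mu>1 \<mu>2 \<kappa> ?Lb) (cost_load \<mu>1 \<mu>2 ?F ?y1 ?y2 ?Lb) w"
      using unique_minimizer_of_quad[OF W2 Kl cb U] by blast
    define e where "e = C0 * \<epsilon> ^ (2 * M)"
    have e: "0 \<le> e" using C0(1) \<epsilon> by (simp add: e_def)
    have "AE x in lebesgue. x \<noteq> (0 :: real^'n)"
    proof -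
      have "AE x in lebesgue. x \<notin> {0 :: real^'n}" by (intro AE_not_in) (simp add: null_sets_completionI)
      then show ?thesis by simp
    qed
    then have close: "AE x in ?M. x \<in> K \<and> \<bar>?La x - ?Lb x\<bar> \<le> e"
      using Kl by (subst AE_restrict_space_iff)
        (auto elim!: eventually_mono simp: bloch_value_def e_def intro: C0(2)[OF \<epsilon> KZ])
    have qd: "AE x in ?M. \<bar>cost_weight \<mu>1 \<mu>2 \<kappa> ?La x - cost_weight \<mu>1 \<mu>2 \<kappa> ?Lb x\<bar> \<le> (\<mu>1 / 2 + \<mu>2) * e"
      using close
    proof eventually_elim
      case (elim x)
      then show ?case using La0[of x] Lb0[of x] by (intro cost_weight_diff(3)[OF mu sq]) auto
    qed
    have bd: "n2 ?M (\<lambda>x. cost_load \<mu>1 \<mu>2 ?F ?y1 ?y2 ?La x - cost_load \<mu>1 \<mu>2 ?F ?y1 ?y2 ?Lb x) \<le> e * Dn"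
      unfolding Dn_def
    proof (rule n2_scale[OF sqint_load_diff_majorant[OF mu sq] _ _ e])
      show "(\<lambda>x. cost_load \<mu>1 \<mu>2 ?F ?y1 ?y2 ?La x - cost_load \<mu>1 \<mu>2 ?F ?y1 ?y2 ?Lb x) \<in> borel_measurable ?M"
        using L2_weight.b_sqint[OF W1] L2_weight.b_sqint[OF W2] by (auto simp: sqint_def)
      show "AE x in ?M. norm (cost_load \<mu>1 \<mu>2 ?F ?y1 ?y2 ?La x - cost_load \<mu>1 \<mu>2 ?F ?y1 ?y2 ?Lb x)
          \<le> e * norm (\<mu>1 / 2 * cmod (?F x) + \<mu>2 / 2 * (cmod (?y2 x) + 2 * cmod (?F x)))"
        using close
      proof eventually_elim
        case (elim x)
        then show ?case using La0[of x] Lb0[of x] by (intro cost_load_diff[OF mu sq]) auto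
      qed
    qed
    have stab: "(\<kappa> / 2) * n2 ?M (\<lambda>x. v x - vM x) \<le> ((\<mu>1 / 2 + \<mu>2) * e) * n2 ?M vM + e * Dn"
      by (rule minimizer_stability[OF W1 W2 U(1,2) v(1,3) vM(1,3) qd bd]) (use mu e in auto)
    have "n2 ?M vM \<le> Rb"
      unfolding Rb_def
    proof (rule L2_weight.minimizer_bound[OF W2 U(1,2) vM(1,3) v0(2)[OF \<epsilon>(1) KZ] _ _ Q])
      show "n2 ?M (cost_load \<mu>1 \<mu>2 ?F ?y1 ?y2 ?Lb) \<le> Bn"
        unfolding Bn_def by (rule n2_cost_load[OF mu sq Lbm]) (simp add: Lb0)
      show "n2 ?M v0 \<le> W" unfolding W_def by (rule order_refl)
    qed
    then have "((\<mu>1 / 2 + \<mu>2) * e) * n2 ?M vM \<le> ((\<mu>1 / 2 + \<mu>2) * e) * Rb"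
      using mu e by (intro mult_left_mono) auto
    with stab have "(\<kappa> / 2) * n2 ?M (\<lambda>x. v x - vM x) \<le> ((\<mu>1 / 2 + \<mu>2) * e) * Rb + e * Dn"
      by linarith
    then have "n2 ?M (\<lambda>x. v x - vM x) \<le> (2 / \<kappa>) * ((\<mu>1 / 2 + \<mu>2) * C0 * Rb + C0 * Dn) * \<epsilon> ^ (2 * M)"
      using mu(3) by (simp add: e_def field_simps)
    also have "\<dots> \<le> C * \<epsilon> ^ (2 * M)"
      unfolding C_def using \<epsilon> by (intro mult_right_mono) auto
    finally have "L2norm K (\<lambda>\<eta>. v \<eta> - vM \<eta>) \<le> C * \<epsilon> ^ (2 * M)"
      by (simp add: L2norm_eq_n2_on[OF Kl])
    with v(2) vM(2) show ?thesis by blast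
  qed
  show ?thesis
    by (rule exI[of _ C]) (use C main in blast)
qed

end
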